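(* Let $n,m$ be natural numbers with $1<n<m-1$. The complex $\mathcal{VR}(\mathcal{F}_n^m, 2)$ is homotopy equivalent to a wedge sum of spheres. Specifically, $$\mathcal{VR}(\mathcal{F}_n^m, 2)\simeq \Big(\bigvee_{\binom{m-1}{n+1}\cdot \binom{n}{2}}S^2\Big) \vee \mathcal{VR}(\mathcal{F}_{n-1}^{m-1}, 2).$$
   Context: $[m]=\{1,\dots,m\}$. Any collection of subsets of $[m]$ is a finite metric space with $d(A,B)=|A\Delta B|$ (size of the symmetric difference). $\mathcal{F}_n^m$ is the collection of all subsets of $[m]$ of size $n$. For a metric space $X$ and $r\ge 0$, the Vietoris-Rips complex $\mathcal{VR}(X,r)$ is the simplicial complex with vertex set $X$ whose simplices are the nonempty finite subsets of $X$ of diameter at most $r$. Here $\simeq$ denotes homotopy equivalence (of geometric realizations), $\vee$ denotes wedge sum, and $\bigvee_k X$ the wedge sum of $k$ copies of $X$. *)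

theory Defs
  imports "HOL-Analysis.Analysis"
begin

definition mdiameter :: "'a metric \<Rightarrow> 'a set \<Rightarrow> real" where
  "mdiameter X S = (if S = {} then 0 else SUP (x, y) \<in> S \<times> S. mdist X x y)"

definition vietoris_rips :: "'a metric \<Rightarrow> real \<Rightarrow> 'a set set" where
  "vietoris_rips X r = {\<sigma>. \<sigma> \<noteq> {} \<and> finite \<sigma> \<and> \<sigma> \<subseteq> mspace X \<and> mdiameter X \<sigma> \<le> r}"

lemma mdiameter_le_iff:
  assumes "S \<noteq> {}" "finite S"
  shows "mdiameter X S \<le> r \<longleftrightarrow> (\<forall>x\<in>S. \<forall>y\<in>S. mdist X x y \<le> r)"
proof -
  have "bdd_above ((\<lambda>(x, y). mdist X x y) ` (S \<times> S))"
    using assms(2) by (intro bdd_above_finite) auto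
  then show ?thesis
    using assms(1) by (auto simp: mdiameter_def cSUP_le_iff)
qed

text \<open>A point of the geometric realization of a complex is given by its barycentric coordinates,
  i.e. a function from vertices to reals. The realization carries the weak topology with respect
  to its closed simplices.\<close>

definition closed_simplex :: "'a set \<Rightarrow> ('a \<Rightarrow> real) set" where
  "closed_simplex \<sigma> = {f. (\<forall>v. 0 \<le> f v) \<and> (\<forall>v. v \<notin> \<sigma> \<longrightarrow> f v = 0) \<and> sum f \<sigma> = 1}"

definition geometric_realization :: "'a set set \<Rightarrow> ('a \<Rightarrow> real) topology" where
  "geometric_realization K = topology (\<lambda>U. U \<subseteq> (\<Union>\<sigma>\<in>K. closed_simplex \<sigma>) \<and>
     (\<forall>\<sigma>\<in>K. openin (subtopology (powertop_real UNIV) (closed_simplex \<sigma>)) (U \<inter> closed_simplex \<sigma>)))"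

lemma openin_geometric_realization:
  "openin (geometric_realization K) U \<longleftrightarrow> U \<subseteq> (\<Union>\<sigma>\<in>K. closed_simplex \<sigma>) \<and>
     (\<forall>\<sigma>\<in>K. openin (subtopology (powertop_real UNIV) (closed_simplex \<sigma>)) (U \<inter> closed_simplex \<sigma>))"
proof -
  let ?T = "\<lambda>\<sigma>. subtopology (powertop_real UNIV) (closed_simplex \<sigma>)"
  have 1: "openin (?T \<sigma>) ((S \<inter> T) \<inter> closed_simplex \<sigma>)"
    if "openin (?T \<sigma>) (S \<inter> closed_simplex \<sigma>)" "openin (?T \<sigma>) (T \<inter> closed_simplex \<sigma>)" for \<sigma> :: "'a set" and S T
    using openin_Int[OF that] by (simp add: Int_ac)
  have 2: "openin (?T \<sigma>) (\<Union>\<K> \<inter> closed_simplex \<sigma>)"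
    if "\<And>S. S \<in> \<K> \<Longrightarrow> openin (?T \<sigma>) (S \<inter> closed_simplex \<sigma>)" for \<sigma> :: "'a set" and \<K>
    unfolding Int_Union2 using that by (intro openin_Union) auto
  have "istopology (\<lambda>U. U \<subseteq> (\<Union>\<sigma>\<in>K. closed_simplex \<sigma>) \<and> (\<forall>\<sigma>\<in>K. openin (?T \<sigma>) (U \<inter> closed_simplex \<sigma>)))"
    unfolding istopology_def
    by (intro conjI allI impI ballI 1 2 Union_least) (simp_all add: le_infI1)
  then show ?thesis
    by (simp add: geometric_realization_def topology_inverse')
qed

lemma topspace_geometric_realization [simp]:
  "topspace (geometric_realization K) = (\<Union>\<sigma>\<in>K. closed_simplex \<sigma>)"
proof (rule subset_antisym)
  show "topspace (geometric_realization K) \<subseteq> (\<Union>\<sigma>\<in>K. closed_simplex \<sigma>)"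
    using openin_geometric_realization openin_topspace by blast
  have *: "(\<Union>\<sigma>\<in>K. closed_simplex \<sigma>) \<inter> closed_simplex \<tau> = closed_simplex \<tau>" if "\<tau> \<in> K" for \<tau>
    using that by blast
  have "openin (subtopology (powertop_real UNIV) C) C" for C :: "('a \<Rightarrow> real) set"
    by (rule openin_subtopology_refl[THEN iffD2]) simp
  then have "openin (geometric_realization K) (\<Union>\<sigma>\<in>K. closed_simplex \<sigma>)"
    by (simp add: openin_geometric_realization *)
  then show "(\<Union>\<sigma>\<in>K. closed_simplex \<sigma>) \<subseteq> topspace (geometric_realization K)"
    by (rule openin_subset)
qed

text \<open>The quotient space \<open>X / A\<close>: the point \<open>None\<close> is the class of \<open>A\<close>, while \<open>Some x\<close> is the
  class of a point \<open>x \<notin> A\<close>. If \<open>A\<close> is empty, then \<open>None\<close> is an added isolated point.\<close>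

definition collapse_map :: "'a set \<Rightarrow> 'a \<Rightarrow> 'a option" where
  "collapse_map A x = (if x \<in> A then None else Some x)"

definition collapse :: "'a topology \<Rightarrow> 'a set \<Rightarrow> 'a option topology" where
  "collapse X A = topology (\<lambda>U. U \<subseteq> insert None (collapse_map A ` topspace X) \<and>
     openin X {x \<in> topspace X. collapse_map A x \<in> U})"

lemma openin_collapse:
  "openin (collapse X A) U \<longleftrightarrow> U \<subseteq> insert None (collapse_map A ` topspace X) \<and>
     openin X {x \<in> topspace X. collapse_map A x \<in> U}"
proof -
  let ?V = "\<lambda>U. {x \<in> topspace X. collapse_map A x \<in> U}"
  have 1: "openin X (?V (S \<inter> T))" if "openin X (?V S)" "openin X (?V T)" for S T
  proof -
    have "?V (S \<inter> T) = ?V S \<inter> ?V T" by auto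
    then show ?thesis using openin_Int[OF that] by simp
  qed
  have 2: "openin X (?V (\<Union>\<K>))" if "\<And>S. S \<in> \<K> \<Longrightarrow> openin X (?V S)" for \<K>
  proof -
    have "?V (\<Union>\<K>) = \<Union> (?V ` \<K>)" by auto
    moreover have "openin X (\<Union> (?V ` \<K>))" using that by (intro openin_Union) auto
    ultimately show ?thesis by simp
  qed
  have "istopology (\<lambda>U. U \<subseteq> insert None (collapse_map A ` topspace X) \<and> openin X (?V U))"
    unfolding istopology_def
    by (intro conjI allI impI 1 2 Union_least) (simp_all add: le_infI1)
  then show ?thesis
    by (simp add: collapse_def topology_inverse')
qed

lemma topspace_collapse [simp]:
  "topspace (collapse X A) = insert None (collapse_map A ` topspace X)"
proof (rule subset_antisym)
  show "topspace (collapse X A) \<subseteq> insert None (collapse_map A ` topspace X)"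
    using openin_collapse openin_topspace by blast
  have "{x \<in> topspace X. collapse_map A x \<in> insert None (collapse_map A ` topspace X)} = topspace X"
    by auto
  then have "openin (collapse X A) (insert None (collapse_map A ` topspace X))"
    unfolding openin_collapse by simp
  then show "insert None (collapse_map A ` topspace X) \<subseteq> topspace (collapse X A)"
    by (rule openin_subset)
qed

lemma quotient_map_collapse:
  assumes "A \<inter> topspace X \<noteq> {}"
  shows "quotient_map X (collapse X A) (collapse_map A)"
proof -
  obtain a where "a \<in> A" "a \<in> topspace X" using assms by blast
  then have "None \<in> collapse_map A ` topspace X"
    by (force simp: collapse_map_def)
  then have *: "insert None (collapse_map A ` topspace X) = collapse_map A ` topspace X"
    by blast
  show ?thesis
    unfolding quotient_map_def by (auto simp: openin_collapse *)
qed

definition binary_sum_topology :: "'a topology \<Rightarrow> 'b topology \<Rightarrow> ('a + 'b) topology" where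
  "binary_sum_topology X Y = topology (\<lambda>U. U \<subseteq> topspace X <+> topspace Y \<and>
     openin X (Inl -` U) \<and> openin Y (Inr -` U))"

lemma openin_binary_sum_topology:
  "openin (binary_sum_topology X Y) U \<longleftrightarrow> U \<subseteq> topspace X <+> topspace Y \<and>
     openin X (Inl -` U) \<and> openin Y (Inr -` U)"
proof -
  have "istopology (\<lambda>U. U \<subseteq> topspace X <+> topspace Y \<and>
     openin X (Inl -` U) \<and> openin Y (Inr -` U))"
    unfolding istopology_def vimage_Int vimage_Union
    by (intro conjI allI impI openin_Int openin_Union Union_least) (auto simp: le_infI1)
  then show ?thesis
    by (simp add: binary_sum_topology_def topology_inverse')
qed

lemma topspace_binary_sum_topology [simp]:
  "topspace (binary_sum_topology X Y) = topspace X <+> topspace Y"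
proof (rule subset_antisym)
  show "topspace (binary_sum_topology X Y) \<subseteq> topspace X <+> topspace Y"
    using openin_binary_sum_topology openin_topspace by blast
  have "Inl -` (topspace X <+> topspace Y) = topspace X"
    "Inr -` (topspace X <+> topspace Y) = topspace Y"
    by auto
  then have "openin (binary_sum_topology X Y) (topspace X <+> topspace Y)"
    by (simp add: openin_binary_sum_topology)
  then show "topspace X <+> topspace Y \<subseteq> topspace (binary_sum_topology X Y)"
    by (rule openin_subset)
qed

text \<open>In both kinds of wedge sum the common basepoint is \<open>None\<close>. The wedge sum of the empty
  family is a point.\<close>

definition wedge :: "'a topology \<Rightarrow> 'a \<Rightarrow> 'b topology \<Rightarrow> 'b \<Rightarrow> ('a + 'b) option topology" where
  "wedge X p Y q = collapse (binary_sum_topology X Y) {Inl p, Inr q}"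

definition Wedge :: "'i set \<Rightarrow> ('i \<Rightarrow> 'a topology) \<Rightarrow> ('i \<Rightarrow> 'a) \<Rightarrow> ('i \<times> 'a) option topology" where
  "Wedge I X p = collapse (sum_topology X I) ((\<lambda>i. (i, p i)) ` I)"

text \<open>The basepoint \<open>(1, 0, \<dots>, 0)\<close> of any sphere \<open>nsphere d\<close>.\<close>

definition sphere_base :: "nat \<Rightarrow> real" where
  "sphere_base = (\<lambda>i. if i = 0 then 1 else 0)"

lemma sphere_base_in_nsphere: "sphere_base \<in> topspace (nsphere d)"
  unfolding sphere_base_def by (rule in_topspace_nsphere)

definition wedge_spheres :: "'i set \<Rightarrow> ('i \<Rightarrow> nat) \<Rightarrow> ('i \<times> (nat \<Rightarrow> real)) option topology" where
  "wedge_spheres I d = Wedge I (\<lambda>i. nsphere (d i)) (\<lambda>i. sphere_base)"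

definition symdiff_metric :: "'a set set \<Rightarrow> 'a set metric" where
  "symdiff_metric \<C> = metric (\<C>, \<lambda>A B. real (card (sym_diff A B)))"

lemma Metric_space_symdiff:
  assumes "\<And>A. A \<in> \<C> \<Longrightarrow> finite A"
  shows "Metric_space \<C> (\<lambda>A B. real (card (sym_diff A B)))"
proof
  fix A B C assume "A \<in> \<C>" "B \<in> \<C>" "C \<in> \<C>"
  then have fin: "finite A" "finite B" "finite C" using assms by auto
  have "card (sym_diff A C) \<le> card (sym_diff A B \<union> sym_diff B C)"
    using fin by (intro card_mono) auto
  also have "\<dots> \<le> card (sym_diff A B) + card (sym_diff B C)"
    by (rule card_Un_le)
  finally show "real (card (sym_diff A C)) \<le> real (card (sym_diff A B)) + real (card (sym_diff B C))"
    by simp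
next
  fix A B assume "A \<in> \<C>" "B \<in> \<C>"
  then have "finite (sym_diff A B)" using assms by auto
  then show "real (card (sym_diff A B)) = 0 \<longleftrightarrow> A = B" by auto
qed (auto simp: Un_commute)

definition subsets_of_size :: "nat \<Rightarrow> nat \<Rightarrow> nat set set" where
  "subsets_of_size n m = {A. A \<subseteq> {1..m} \<and> card A = n}"

lemma
  shows mspace_subsets_of_size [simp]:
      "mspace (symdiff_metric (subsets_of_size n m)) = subsets_of_size n m"
    and mdist_subsets_of_size [simp]:
      "mdist (symdiff_metric (subsets_of_size n m)) = (\<lambda>A B. real (card (sym_diff A B)))"
proof -
  interpret Metric_space "subsets_of_size n m" "\<lambda>A B. real (card (sym_diff A B))"
    by (rule Metric_space_symdiff) (auto simp: subsets_of_size_def intro: finite_subset)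
  show "mspace (symdiff_metric (subsets_of_size n m)) = subsets_of_size n m"
    "mdist (symdiff_metric (subsets_of_size n m)) = (\<lambda>A B. real (card (sym_diff A B)))"
    unfolding symdiff_metric_def by simp_all
qed

definition VR_space :: "nat \<Rightarrow> nat \<Rightarrow> real \<Rightarrow> (nat set \<Rightarrow> real) topology" where
  "VR_space n m r = geometric_realization (vietoris_rips (symdiff_metric (subsets_of_size n m)) r)"

end

theory Submission
  imports Defs
begin

text \<open>The complex \<open>VR(F\<^sub>n\<^sup>m, 2)\<close> is the clique complex of the Johnson graph. Its maximal simplices are of two
  kinds: all \<open>n\<close>-sets containing a fixed \<open>(n-1)\<close>-set, or all \<open>n\<close>-sets contained in a fixed \<open>(n+1)\<close>-set \<open>T\<close>.
  Remove all simplices of dimension at least 2 of the second kind with \<open>m \<notin> T\<close>. What is left collapses onto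
  the sets containing \<open>m\<close>, that is, onto \<open>VR(F\<^sub>n\<^sub>-\<^sub>1\<^sup>m\<^sup>-\<^sup>1, 2)\<close>: the sets avoiding \<open>m\<close> that share
  an \<open>(n-1)\<close>-set \<open>S\<close> are coned off by \<open>S \<union> {m}\<close>, and each remaining set \<open>A\<close> is joined to the simplex
  of all \<open>n\<close>-sets in \<open>A \<union> {m}\<close> containing \<open>m\<close>. Conversely, each of the \<open>(m-1 choose n+1)\<close> removed simplices
  is recovered, up to collapses, by attaching the \<open>(n choose 2)\<close> triangles that contain one fixed vertex.
  The boundary of such a triangle \<open>{T - {x}, T - {y}, T - {z}}\<close> is null-homotopic, because the triangle is
  a face of an octahedron whose other seven faces have a vertex containing \<open>m\<close>. Hence every triangle
  contributes a wedge summand \<open>S\<^sup>2\<close>. For \<open>n = 1\<close> the complex is a simplex, so induction on \<open>n\<close> gives a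
  wedge of spheres.\<close>

section \<open>Attaching cones over a space\<close>

text \<open>The number C(n,2): below an (n+1)-set \<open>T\<close> avoiding \<open>m\<close> only
  the complete graph on the n+1 vertices \<open>T - {x}\<close> survives the removal. The n edges at
  one vertex form a spanning tree, so the graph has C(n+1,2) - n = C(n,2) independent cycles, one
  for each triangle at that vertex. The element \<open>m\<close> supplies the octahedron: opposite
  to \<open>T - {x}\<close> lies \<open>T - {y, z}\<close> together with \<open>m\<close>. The
  obstacle is to turn null-homotopic boundaries into an equivalence with an actual wedge. Both sides
  are therefore described as one kind of object, a space with cones over the same family of circles
  attached: on one side along the boundaries of the triangles, on the other along the constant map
  to the base point. It then suffices that homotopic attaching maps over homotopy equivalent bases
  give homotopy equivalent results. The null-homotopies are free, so path-connectedness of the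
  smaller complex is needed to end at a prescribed base point; the induction carries it
  along.\<close>

abbreviation I01 :: "real topology" where "I01 \<equiv> top_of_set {0..1}"

lemma continuous_map_comp:
  "continuous_map X Y g \<Longrightarrow> continuous_map Y Z f \<Longrightarrow> continuous_map X Z (\<lambda>x. f (g x))"
  using continuous_map_compose[of X Y g Z f] by (simp add: o_def)

lemma continuous_map_fst_eta [simp]: "continuous_map (prod_topology X Y) X (\<lambda>p. fst p)"
  and continuous_map_snd_eta [simp]: "continuous_map (prod_topology X Y) Y (\<lambda>p. snd p)"
  by (rule continuous_map_fst, rule continuous_map_snd)

text \<open>Clamping keeps each branch of a piecewise homotopy inside the unit interval on the whole
  domain, so that a branch is continuous everywhere and not only where it is selected.\<close>

definition clamp01 :: "real \<Rightarrow> real" where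
  "clamp01 u = max 0 (min 1 u)"

lemma clamp01_eq [simp]: "0 \<le> u \<Longrightarrow> u \<le> 1 \<Longrightarrow> clamp01 u = u"
  by (simp add: clamp01_def)

lemma clamp01_in [simp]: "0 \<le> clamp01 u" "clamp01 u \<le> 1"
  by (auto simp: clamp01_def)

lemma continuous_map_clamp01:
  assumes "continuous_map X euclideanreal p"
  shows "continuous_map X I01 (\<lambda>x. clamp01 (p x))"
  unfolding continuous_map_in_subtopology using assms
  by (auto simp: clamp01_def intro!: continuous_map_real_max continuous_map_real_min)

text \<open>Two closed maps that together cover \<open>Y\<close> act as a quotient map: the preimage
  of a closed set under \<open>F\<close> is the union of two closed images.\<close>

lemma continuous_map_jointly_closed:
  assumes "closed_map Z1 Y p1" "closed_map Z2 Y p2"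
    and cov: "topspace Y \<subseteq> p1 ` topspace Z1 \<union> p2 ` topspace Z2"
    and c1: "continuous_map Z1 V (\<lambda>z. F (p1 z))" and c2: "continuous_map Z2 V (\<lambda>z. F (p2 z))"
  shows "continuous_map Y V F"
  unfolding continuous_map_closedin
proof (intro conjI allI impI)
  show "F \<in> topspace Y \<rightarrow> topspace V"
    using cov c1 c2 by (fastforce simp: continuous_map_def Pi_iff)
  fix C assume C: "closedin V C"
  have "{y \<in> topspace Y. F y \<in> C} =
      p1 ` {z \<in> topspace Z1. F (p1 z) \<in> C} \<union> p2 ` {z \<in> topspace Z2. F (p2 z) \<in> C}"
    using cov closed_map_imp_subset_topspace[OF assms(1)] closed_map_imp_subset_topspace[OF assms(2)]
    by blast
  moreover have "closedin Y (p1 ` {z \<in> topspace Z1. F (p1 z) \<in> C})"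
    using assms(1) closedin_continuous_map_preimage[OF c1 C] by (auto simp: closed_map_def)
  moreover have "closedin Y (p2 ` {z \<in> topspace Z2. F (p2 z) \<in> C})"
    using assms(2) closedin_continuous_map_preimage[OF c2 C] by (auto simp: closed_map_def)
  ultimately show "closedin Y {y \<in> topspace Y. F y \<in> C}" by (simp add: closedin_Un)
qed

text \<open>\<open>Y\<close> is \<open>X\<close> with one cone attached for every class of
  \<open>\<pi>\<close> on \<open>A\<close>; \<open>t = 1\<close> is the base of the cone, glued by
  \<open>f\<close>, and \<open>t = 0\<close> its apex. The situation is characterised rather than
  constructed as a quotient, so that a simplicial complex and a wedge can both be instances.
  Compactness below and the Hausdorff property above make \<open>Y\<close> carry the quotient
  topology.\<close>

locale cone_attachment =
  fixes X :: "'x topology" and A :: "'a topology" and \<pi> :: "'a \<Rightarrow> 'j" and f :: "'a \<Rightarrow> 'x"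
    and Y :: "'y topology" and e :: "'x \<Rightarrow> 'y" and c :: "'a \<times> real \<Rightarrow> 'y"
  assumes compact_base: "compact_space X" and compact_A: "compact_space A"
    and Hausdorff_total: "Hausdorff_space Y"
    and cont_f: "continuous_map A X f"
    and cont_e: "continuous_map X Y e"
    and cont_c: "continuous_map (prod_topology A I01) Y c"
    and covers: "topspace Y \<subseteq> e ` topspace X \<union> c ` (topspace A \<times> {0..1})"
    and inj_e: "inj_on e (topspace X)"
    and c_1: "\<And>a. a \<in> topspace A \<Longrightarrow> c (a, 1) = e (f a)"
    and c_0: "\<And>a a'. a \<in> topspace A \<Longrightarrow> a' \<in> topspace A \<Longrightarrow> \<pi> a = \<pi> a' \<Longrightarrow> c (a, 0) = c (a', 0)"
    and c_not_e: "\<And>a t x. a \<in> topspace A \<Longrightarrow> 0 \<le> t \<Longrightarrow> t < 1 \<Longrightarrow> x \<in> topspace X \<Longrightarrow> c (a, t) \<noteq> e x"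
    and c_inj: "\<And>a t a' t'. a \<in> topspace A \<Longrightarrow> a' \<in> topspace A \<Longrightarrow> 0 \<le> t \<Longrightarrow> t < 1 \<Longrightarrow> 0 \<le> t' \<Longrightarrow> t' < 1 \<Longrightarrow>
      c (a, t) = c (a', t') \<Longrightarrow> t = t' \<and> (a = a' \<or> t = 0 \<and> \<pi> a = \<pi> a')"
begin

text \<open>The universal property of the attachment, with a compact parameter space
  \<open>Z\<close> so that it also produces homotopies on \<open>Y\<close>. Compactness makes the
  two maps onto \<open>Z\<close> times \<open>Y\<close> closed, so the quotient property survives
  the product.\<close>

lemma extend_param:
  assumes Z: "compact_space Z" "Hausdorff_space Z"
    and g: "continuous_map (prod_topology Z X) V g"
    and k: "continuous_map (prod_topology Z (prod_topology A I01)) V k"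
    and k1: "\<And>z a. z \<in> topspace Z \<Longrightarrow> a \<in> topspace A \<Longrightarrow> k (z, (a, 1)) = g (z, f a)"
    and k0: "\<And>z a a'. z \<in> topspace Z \<Longrightarrow> a \<in> topspace A \<Longrightarrow> a' \<in> topspace A \<Longrightarrow> \<pi> a = \<pi> a' \<Longrightarrow>
      k (z, (a, 0)) = k (z, (a', 0))"
  obtains F where "continuous_map (prod_topology Z Y) V F"
    and "\<And>z x. z \<in> topspace Z \<Longrightarrow> x \<in> topspace X \<Longrightarrow> F (z, e x) = g (z, x)"
    and "\<And>z a t. z \<in> topspace Z \<Longrightarrow> a \<in> topspace A \<Longrightarrow> 0 \<le> t \<Longrightarrow> t \<le> 1 \<Longrightarrow> F (z, c (a, t)) = k (z, (a, t))"
proof -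
  \<comment> \<open>The choice is harmless: outside the image of \<open>e\<close> two preimages
    under \<open>c\<close> are equal, or both are apexes of the same class, where \<open>k\<close>
    takes the same value by \<open>k0\<close>.\<close>
  define F where "F = (\<lambda>(z, y). if y \<in> e ` topspace X then g (z, inv_into (topspace X) e y)
     else k (z, SOME p. p \<in> topspace A \<times> {0..1} \<and> c p = y))"
  have Fe: "F (z, e x) = g (z, x)" if "x \<in> topspace X" for z x
    using that inj_e by (simp add: F_def)
  have Fc: "F (z, c (a, t)) = k (z, (a, t))"
    if zat: "z \<in> topspace Z" "a \<in> topspace A" "0 \<le> t" "t \<le> 1" for z a t
  proof (cases "t = 1")
    case True
    have "f a \<in> topspace X" using cont_f zat(2) by (auto simp: continuous_map_def)
    then show ?thesis using True zat by (simp add: c_1 Fe k1)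
  next
    case False
    then have t: "t < 1" using zat by simp
    have ne: "c (a, t) \<notin> e ` topspace X" using c_not_e[OF zat(2,3) t] by blast
    define p where "p = (SOME p. p \<in> topspace A \<times> {0..1} \<and> c p = c (a, t))"
    have "p \<in> topspace A \<times> {0..1} \<and> c p = c (a, t)"
      unfolding p_def by (rule someI[of _ "(a, t)"]) (use zat in auto)
    moreover obtain a' t' where p: "p = (a', t')" by (cases p)
    ultimately have p': "a' \<in> topspace A" "0 \<le> t'" "t' \<le> 1" "c (a', t') = c (a, t)" by auto
    have "t' \<noteq> 1"
    proof
      assume "t' = 1"
      then have "c (a, t) = e (f a')" using p' c_1 by simp
      moreover have "f a' \<in> topspace X" using cont_f p'(1) by (auto simp: continuous_map_def)
      ultimately show False using ne by blast
    qed
    then have "t' = t \<and> (a' = a \<or> t' = 0 \<and> \<pi> a' = \<pi> a)"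
      using c_inj[OF p'(1) zat(2) p'(2) _ zat(3) t p'(4)] p'(3) \<open>t' \<noteq> 1\<close> by auto
    then have "k (z, p) = k (z, (a, t))"
      using k0[OF zat(1) p'(1) zat(2)] p by auto
    then show ?thesis using ne by (simp add: F_def p_def)
  qed
  have Hd: "Hausdorff_space (prod_topology Z Y)"
    using Z(2) Hausdorff_total by (simp add: Hausdorff_space_prod_topology)
  have cI: "compact_space I01" by (simp add: compact_space_subtopology)
  have m1: "continuous_map (prod_topology Z X) (prod_topology Z Y) (\<lambda>p. (fst p, e (snd p)))"
    by (intro continuous_map_pairedI continuous_map_comp[OF _ cont_e]) auto
  have m2: "continuous_map (prod_topology Z (prod_topology A I01)) (prod_topology Z Y)
      (\<lambda>p. (fst p, c (snd p)))"
    by (intro continuous_map_pairedI continuous_map_comp[OF _ cont_c]) auto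
  have "continuous_map (prod_topology Z Y) V F"
  proof (rule continuous_map_jointly_closed)
    show "closed_map (prod_topology Z X) (prod_topology Z Y) (\<lambda>p. (fst p, e (snd p)))"
      using m1 Hd Z(1) compact_base
      by (intro continuous_imp_closed_map_gen) (auto simp: compact_space_prod_topology Hausdorff_imp_kc_space)
    show "closed_map (prod_topology Z (prod_topology A I01)) (prod_topology Z Y) (\<lambda>p. (fst p, c (snd p)))"
      using m2 Hd Z(1) compact_A cI
      by (intro continuous_imp_closed_map_gen) (auto simp: compact_space_prod_topology Hausdorff_imp_kc_space)
    show "topspace (prod_topology Z Y) \<subseteq>
      (\<lambda>p. (fst p, e (snd p))) ` topspace (prod_topology Z X) \<union>
      (\<lambda>p. (fst p, c (snd p))) ` topspace (prod_topology Z (prod_topology A I01))"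
    proof
      fix q assume "q \<in> topspace (prod_topology Z Y)"
      then obtain z y where q: "q = (z, y)" "z \<in> topspace Z" "y \<in> topspace Y" by auto
      with covers consider x where "x \<in> topspace X" "y = e x"
        | p where "p \<in> topspace A \<times> {0..1}" "y = c p" by blast
      then show "q \<in> (\<lambda>p. (fst p, e (snd p))) ` topspace (prod_topology Z X) \<union>
          (\<lambda>p. (fst p, c (snd p))) ` topspace (prod_topology Z (prod_topology A I01))"
      proof cases
        case 1
        then show ?thesis using q by (intro UnI1 image_eqI[of _ _ "(z, x)"]) auto
      next
        case 2
        then show ?thesis using q by (intro UnI2 image_eqI[of _ _ "(z, p)"]) auto
      qed
    qed
    show "continuous_map (prod_topology Z X) V (\<lambda>p. F (fst p, e (snd p)))"
      by (rule continuous_map_eq[OF g]) (auto simp: Fe)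
    show "continuous_map (prod_topology Z (prod_topology A I01)) V (\<lambda>p. F (fst p, c (snd p)))"
      by (rule continuous_map_eq[OF k]) (auto simp: Fc)
  qed
  with Fe Fc show thesis by (intro that)
qed

lemma extend:
  assumes g: "continuous_map X V g"
    and k: "continuous_map (prod_topology A I01) V k"
    and k1: "\<And>a. a \<in> topspace A \<Longrightarrow> k (a, 1) = g (f a)"
    and k0: "\<And>a a'. a \<in> topspace A \<Longrightarrow> a' \<in> topspace A \<Longrightarrow> \<pi> a = \<pi> a' \<Longrightarrow> k (a, 0) = k (a', 0)"
  obtains F where "continuous_map Y V F"
    and "\<And>x. x \<in> topspace X \<Longrightarrow> F (e x) = g x"
    and "\<And>a t. a \<in> topspace A \<Longrightarrow> 0 \<le> t \<Longrightarrow> t \<le> 1 \<Longrightarrow> F (c (a, t)) = k (a, t)"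
proof -
  define Z where "Z = top_of_set {0::real}"
  have Z: "compact_space Z" "Hausdorff_space Z" "topspace Z = {0}"
    by (simp_all add: Z_def compact_space_subtopology Hausdorff_space_subtopology)
  obtain F where F: "continuous_map (prod_topology Z Y) V F"
    and Fe: "\<And>z x. z \<in> topspace Z \<Longrightarrow> x \<in> topspace X \<Longrightarrow> F (z, e x) = g (snd (z, x))"
    and Fc: "\<And>z a t. z \<in> topspace Z \<Longrightarrow> a \<in> topspace A \<Longrightarrow> 0 \<le> t \<Longrightarrow> t \<le> 1 \<Longrightarrow> F (z, c (a, t)) = k (snd (z, (a, t)))"
  proof (rule extend_param[of Z V "\<lambda>p. g (snd p)" "\<lambda>p. k (snd p)"])
    show "continuous_map (prod_topology Z X) V (\<lambda>p. g (snd p))"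
      by (rule continuous_map_comp[OF _ g]) simp
    show "continuous_map (prod_topology Z (prod_topology A I01)) V (\<lambda>p. k (snd p))"
      by (rule continuous_map_comp[OF _ k]) simp
    show "k (snd (z, a, 0)) = k (snd (z, a', 0))"
      if "a \<in> topspace A" "a' \<in> topspace A" "\<pi> a = \<pi> a'" for z a a'
      using k0[OF that] by simp
  qed (use Z k1 in auto)
  have "continuous_map Y V (F \<circ> Pair 0)"
    by (rule continuous_map_o_Pair[OF F]) (simp add: Z)
  then show thesis
    by (rule that) (use Fe Fc Z in auto)
qed

text \<open>Every cone point is joined to the image of \<open>X\<close> by its own generating line,
  running to \<open>t = 1\<close>.\<close>

lemma path_connected_total:
  assumes "path_connected_space X"
  shows "path_connected_space Y"
proof -
  have eX: "path_connectedin Y (e ` topspace X)"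
    by (rule path_connectedin_continuous_map_image[OF cont_e]) (simp add: assms path_connectedin_topspace)
  have joined: "\<exists>x\<in>topspace X. path_component_of Y (e x) y" if y: "y \<in> topspace Y" for y
  proof -
    have "y \<in> e ` topspace X \<union> c ` (topspace A \<times> {0..1})" using y covers by blast
    then consider x where "x \<in> topspace X" "y = e x"
      | a t where "a \<in> topspace A" "0 \<le> t" "t \<le> 1" "y = c (a, t)" by auto
    then show ?thesis
    proof cases
      case 1
      then show ?thesis using y by (intro bexI[of _ x]) (auto simp: path_component_of_refl)
    next
      case 2
      have "continuous_map I01 Y (\<lambda>t. c (a, t))"
        using 2(1) by (intro continuous_map_comp[OF _ cont_c] continuous_map_pairedI) auto
      moreover have "path_connectedin I01 {0..1}"
        by (simp add: path_connectedin_subtopology)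
      ultimately have "path_connectedin Y ((\<lambda>t. c (a, t)) ` {0..1})"
        by (rule path_connectedin_continuous_map_image)
      moreover have "c (a, 1) \<in> (\<lambda>t. c (a, t)) ` {0..1}" "y \<in> (\<lambda>t. c (a, t)) ` {0..1}"
        using 2 by simp_all
      ultimately have "path_component_of Y (c (a, 1)) y"
        unfolding path_component_of by blast
      then show ?thesis
        using c_1[OF 2(1)] continuous_map_image_subset_topspace[OF cont_f] 2(1) by auto
    qed
  qed
  have "path_component_of Y (e x) (e x')" if "x \<in> topspace X" "x' \<in> topspace X" for x x'
    using eX that unfolding path_component_of by blast
  then show ?thesis
    unfolding path_connected_space_iff_path_component
  proof (intro ballI)
    fix y y' assume "y \<in> topspace Y" "y' \<in> topspace Y"
    then obtain x x' where x: "x \<in> topspace X" "path_component_of Y (e x) y"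
      "x' \<in> topspace X" "path_component_of Y (e x') y'" using joined by blast
    then show "path_component_of Y y y'"
      using \<open>\<And>x x'. x \<in> topspace X \<Longrightarrow> x' \<in> topspace X \<Longrightarrow> path_component_of Y (e x) (e x')\<close>[of x x']
      by (blast intro: path_component_of_trans path_component_of_sym)
  qed
qed

end

text \<open>The inner half of each cone is stretched over the whole target cone. The outer half is a
  collar on which \<open>H\<close> is run backwards, from \<open>f2\<close> at
  \<open>t = 1/2\<close> to \<open>r\<close> after \<open>f1\<close> at
  \<open>t = 1\<close>.\<close>

lemma cone_attachment_map:
  assumes att1: "cone_attachment X1 A \<pi> f1 Y1 e1 c1" and att2: "cone_attachment X2 A \<pi> f2 Y2 e2 c2"
    and r: "continuous_map X1 X2 r"
    and H: "continuous_map (prod_topology I01 A) X2 H"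
    and H0: "\<And>a. a \<in> topspace A \<Longrightarrow> H (0, a) = r (f1 a)"
    and H1: "\<And>a. a \<in> topspace A \<Longrightarrow> H (1, a) = f2 a"
  obtains \<Phi> where "continuous_map Y1 Y2 \<Phi>"
    and "\<And>x. x \<in> topspace X1 \<Longrightarrow> \<Phi> (e1 x) = e2 (r x)"
    and "\<And>a t. a \<in> topspace A \<Longrightarrow> 0 \<le> t \<Longrightarrow> t \<le> 1 \<Longrightarrow>
      \<Phi> (c1 (a, t)) = (if t \<le> 1/2 then c2 (a, 2 * t) else e2 (H (2 - 2 * t, a)))"
proof -
  interpret a1: cone_attachment X1 A \<pi> f1 Y1 e1 c1 by (rule att1)
  interpret a2: cone_attachment X2 A \<pi> f2 Y2 e2 c2 by (rule att2)
  define k where "k = (\<lambda>p. if snd p \<le> 1/2 then c2 (fst p, clamp01 (2 * snd p))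
    else e2 (H (clamp01 (2 - 2 * snd p), fst p)))"
  have sndR: "continuous_map (prod_topology A I01) euclideanreal (\<lambda>p. snd p)"
    using continuous_map_snd_eta continuous_map_into_fulltopology by blast
  have k: "continuous_map (prod_topology A I01) Y2 k"
    unfolding k_def
  proof (rule continuous_map_cases_le[OF sndR])
    show "continuous_map (subtopology (prod_topology A I01) {x \<in> topspace (prod_topology A I01). snd x \<le> 1/2})
      Y2 (\<lambda>p. c2 (fst p, clamp01 (2 * snd p)))"
      by (intro continuous_map_from_subtopology continuous_map_comp[OF _ a2.cont_c] continuous_map_pairedI
          continuous_map_clamp01 continuous_map_real_mult sndR) auto
    show "continuous_map (subtopology (prod_topology A I01) {x \<in> topspace (prod_topology A I01). 1/2 \<le> snd x})
      Y2 (\<lambda>p. e2 (H (clamp01 (2 - 2 * snd p), fst p)))"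
      by (intro continuous_map_from_subtopology continuous_map_comp[OF _ a2.cont_e] continuous_map_comp[OF _ H]
          continuous_map_pairedI continuous_map_clamp01 continuous_map_diff continuous_map_real_mult sndR) auto
    show "c2 (fst p, clamp01 (2 * snd p)) = e2 (H (clamp01 (2 - 2 * snd p), fst p))"
      if "p \<in> topspace (prod_topology A I01)" "snd p = 1/2" for p
      using that(1) unfolding that(2) by (auto simp: a2.c_1 H1)
  qed simp
  show thesis
  proof (rule a1.extend[of Y2 "\<lambda>x. e2 (r x)" k])
    show "continuous_map X1 Y2 (\<lambda>x. e2 (r x))"
      by (rule continuous_map_comp[OF r a2.cont_e])
    show "continuous_map (prod_topology A I01) Y2 k" by (rule k)
    show "k (a, 1) = e2 (r (f1 a))" if "a \<in> topspace A" for a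
      using that by (simp add: k_def H0)
    show "k (a, 0) = k (a', 0)" if "a \<in> topspace A" "a' \<in> topspace A" "\<pi> a = \<pi> a'" for a a'
      using a2.c_0[OF that] by (simp add: k_def)
    fix F assume F: "continuous_map Y1 Y2 F" "\<And>x. x \<in> topspace X1 \<Longrightarrow> F (e1 x) = e2 (r x)"
      "\<And>a t. a \<in> topspace A \<Longrightarrow> 0 \<le> t \<Longrightarrow> t \<le> 1 \<Longrightarrow> F (c1 (a, t)) = k (a, t)"
    show thesis
    proof (rule that[OF F(1,2)])
      fix a t assume "a \<in> topspace A" "0 \<le> t" "t \<le> (1::real)"
      then show "F (c1 (a, t)) = (if t \<le> 1/2 then c2 (a, 2 * t) else e2 (H (2 - 2 * t, a)))"
        by (simp add: F(3) k_def)
    qed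
  qed
qed

text \<open>The statement repeats for \<open>K\<close> and \<open>\<Psi>\<close> the formulas
  assumed of \<open>H\<close> and \<open>\<Phi>\<close>, so that the lemma can be applied a second
  time, to its own result.\<close>

lemma cone_attachment_map_left_inverse:
  assumes att1: "cone_attachment X1 A \<pi> f1 Y1 e1 c1" and att2: "cone_attachment X2 A \<pi> f2 Y2 e2 c2"
    and r: "continuous_map X1 X2 r" and i: "continuous_map X2 X1 i"
    and ir: "homotopic_with (\<lambda>_. True) X1 X1 (i \<circ> r) id"
    and H: "continuous_map (prod_topology I01 A) X2 H"
    and H0: "\<And>a. a \<in> topspace A \<Longrightarrow> H (0, a) = r (f1 a)"
    and H1: "\<And>a. a \<in> topspace A \<Longrightarrow> H (1, a) = f2 a"
    and \<Phi>: "continuous_map Y1 Y2 \<Phi>"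
    and \<Phi>e: "\<And>x. x \<in> topspace X1 \<Longrightarrow> \<Phi> (e1 x) = e2 (r x)"
    and \<Phi>c: "\<And>a t. a \<in> topspace A \<Longrightarrow> 0 \<le> t \<Longrightarrow> t \<le> 1 \<Longrightarrow>
      \<Phi> (c1 (a, t)) = (if t \<le> 1/2 then c2 (a, 2 * t) else e2 (H (2 - 2 * t, a)))"
  obtains K \<Psi> where "continuous_map (prod_topology I01 A) X1 K"
    and "\<And>a. a \<in> topspace A \<Longrightarrow> K (0, a) = i (f2 a)"
    and "\<And>a. a \<in> topspace A \<Longrightarrow> K (1, a) = f1 a"
    and "continuous_map Y2 Y1 \<Psi>"
    and "\<And>x. x \<in> topspace X2 \<Longrightarrow> \<Psi> (e2 x) = e1 (i x)"
    and "\<And>a t. a \<in> topspace A \<Longrightarrow> 0 \<le> t \<Longrightarrow> t \<le> 1 \<Longrightarrow>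
      \<Psi> (c2 (a, t)) = (if t \<le> 1/2 then c1 (a, 2 * t) else e1 (K (2 - 2 * t, a)))"
    and "homotopic_with (\<lambda>_. True) Y1 Y1 (\<Psi> \<circ> \<Phi>) id"
proof -
  interpret a1: cone_attachment X1 A \<pi> f1 Y1 e1 c1 by (rule att1)
  interpret a2: cone_attachment X2 A \<pi> f2 Y2 e2 c2 by (rule att2)
  obtain P where P: "continuous_map (prod_topology I01 X1) X1 P"
    and P0: "\<And>x. P (0, x) = i (r x)" and P1: "\<And>x. P (1, x) = x"
    using ir unfolding homotopic_with_def by auto
  \<comment> \<open>\<open>K\<close> runs \<open>i\<close> after \<open>H\<close> backwards and then
    along \<open>P\<close>. In the composite, the last collar, which runs \<open>H\<close>
    backwards, then retraces the part of \<open>K\<close> that came from \<open>H\<close>.\<close>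
  define K where "K = (\<lambda>p. if fst p \<le> 1/2 then i (H (clamp01 (1 - 2 * fst p), snd p))
    else P (clamp01 (2 * fst p - 1), f1 (snd p)))"
  have fstR: "continuous_map (prod_topology I01 A) euclideanreal (\<lambda>p. fst p)"
    using continuous_map_fst_eta continuous_map_into_fulltopology by blast
  have K: "continuous_map (prod_topology I01 A) X1 K"
    unfolding K_def
  proof (rule continuous_map_cases_le[OF fstR])
    show "continuous_map (subtopology (prod_topology I01 A) {x \<in> topspace (prod_topology I01 A). fst x \<le> 1/2})
      X1 (\<lambda>p. i (H (clamp01 (1 - 2 * fst p), snd p)))"
      by (intro continuous_map_from_subtopology continuous_map_comp[OF _ i] continuous_map_comp[OF _ H]
          continuous_map_pairedI continuous_map_clamp01 continuous_map_diff continuous_map_real_mult fstR) auto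
    show "continuous_map (subtopology (prod_topology I01 A) {x \<in> topspace (prod_topology I01 A). 1/2 \<le> fst x})
      X1 (\<lambda>p. P (clamp01 (2 * fst p - 1), f1 (snd p)))"
      by (intro continuous_map_from_subtopology continuous_map_comp[OF _ P] continuous_map_comp[OF _ a1.cont_f]
          continuous_map_pairedI continuous_map_clamp01 continuous_map_diff continuous_map_real_mult fstR) auto
    show "i (H (clamp01 (1 - 2 * fst p), snd p)) = P (clamp01 (2 * fst p - 1), f1 (snd p))"
      if "p \<in> topspace (prod_topology I01 A)" "fst p = 1/2" for p
      using that(1) unfolding that(2) by (auto simp: H0 P0)
  qed simp
  have K0: "K (0, a) = i (f2 a)" and K1: "K (1, a) = f1 a" if "a \<in> topspace A" for a
    using that by (auto simp: K_def H1 P1)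
  obtain \<Psi> where \<Psi>: "continuous_map Y2 Y1 \<Psi>"
    and \<Psi>e: "\<And>x. x \<in> topspace X2 \<Longrightarrow> \<Psi> (e2 x) = e1 (i x)"
    and \<Psi>c: "\<And>a t. a \<in> topspace A \<Longrightarrow> 0 \<le> t \<Longrightarrow> t \<le> 1 \<Longrightarrow>
      \<Psi> (c2 (a, t)) = (if t \<le> 1/2 then c1 (a, 2 * t) else e1 (K (2 - 2 * t, a)))"
    by (rule cone_attachment_map[OF att2 att1 i K], erule K0, erule K1, rule that)
  \<comment> \<open>On each cone, \<open>\<Psi> \<circ> \<Phi>\<close> is the track \<open>D\<close> (cone, then \<open>P\<close> backwards, then \<open>i \<circ> H\<close>) run along the
    reparametrisation \<open>\<omega>\<close>, which turns back at 3; it is contracted linearly to the identity.\<close>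
  define D where "D = (\<lambda>p. if snd p \<le> 1 then c1 (fst p, clamp01 (snd p))
    else if snd p \<le> 2 then e1 (P (clamp01 (2 - snd p), f1 (fst p)))
    else e1 (i (H (clamp01 (snd p - 2), fst p))))"
  define \<omega> :: "real \<Rightarrow> real" where "\<omega> = (\<lambda>t. min (max (4 * t) (8 * t - 1)) (4 - 2 * t))"
  let ?AR = "prod_topology A euclideanreal"
  have D: "continuous_map ?AR Y1 D"
    unfolding D_def
  proof (rule continuous_map_cases_le)
    show "continuous_map (subtopology ?AR {x \<in> topspace ?AR. snd x \<le> 1}) Y1 (\<lambda>p. c1 (fst p, clamp01 (snd p)))"
      by (intro continuous_map_from_subtopology continuous_map_comp[OF _ a1.cont_c] continuous_map_pairedI
          continuous_map_clamp01) auto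
    have "continuous_map ?AR Y1 (\<lambda>p. if snd p \<le> 2 then e1 (P (clamp01 (2 - snd p), f1 (fst p)))
       else e1 (i (H (clamp01 (snd p - 2), fst p))))"
    proof (rule continuous_map_cases_le)
      show "continuous_map (subtopology ?AR {x \<in> topspace ?AR. snd x \<le> 2}) Y1
          (\<lambda>p. e1 (P (clamp01 (2 - snd p), f1 (fst p))))"
        by (intro continuous_map_from_subtopology continuous_map_comp[OF _ a1.cont_e] continuous_map_comp[OF _ P]
            continuous_map_comp[OF _ a1.cont_f] continuous_map_pairedI continuous_map_clamp01 continuous_map_diff) auto
      show "continuous_map (subtopology ?AR {x \<in> topspace ?AR. 2 \<le> snd x}) Y1
          (\<lambda>p. e1 (i (H (clamp01 (snd p - 2), fst p))))"
        by (intro continuous_map_from_subtopology continuous_map_comp[OF _ a1.cont_e] continuous_map_comp[OF _ i]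
            continuous_map_comp[OF _ H] continuous_map_pairedI continuous_map_clamp01 continuous_map_diff) auto
    qed (auto simp: P0 H0)
    then show "continuous_map (subtopology ?AR {x \<in> topspace ?AR. 1 \<le> snd x}) Y1
       (\<lambda>p. if snd p \<le> 2 then e1 (P (clamp01 (2 - snd p), f1 (fst p)))
         else e1 (i (H (clamp01 (snd p - 2), fst p))))"
      by (rule continuous_map_from_subtopology)
  qed (auto simp: a1.c_1 P1)
  have D_D0: "D (a, 0) = D (a', 0)" if "a \<in> topspace A" "a' \<in> topspace A" "\<pi> a = \<pi> a'" for a a'
    using a1.c_0[OF that] by (simp add: D_def)
  have \<Psi>\<Phi>: "\<Psi> (\<Phi> (c1 (a, t))) = D (a, \<omega> t)" if a: "a \<in> topspace A" and t: "0 \<le> t" "t \<le> 1" for a t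
  proof -
    \<comment> \<open>Each of the two maps spends half of its parameter on the cone, so the
      composite stays on it up to 1/4. The collar of \<open>\<Psi>\<close> occupies 1/4 to 1/2,
      split at 3/8 where \<open>K\<close> changes branch; the collar of \<open>\<Phi>\<close> is the
      rest.\<close>
    consider "t \<le> 1/4" | "1/4 < t" "t \<le> 3/8" | "3/8 < t" "t \<le> 1/2" | "1/2 < t" by linarith
    then show ?thesis
    proof cases
      case 1
      then have "\<omega> t = 4 * t" using t by (simp add: \<omega>_def)
      then show ?thesis using 1 t a by (simp add: \<Phi>c \<Psi>c D_def)
    next
      case 2
      then have "\<omega> t = 8 * t - 1" using t by (simp add: \<omega>_def)
      then have "D (a, \<omega> t) = e1 (K (2 - 4 * t, a))"
        using 2 t a by (cases "8 * t = 3") (auto simp: D_def K_def H0 P0)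
      then show ?thesis using 2 t a by (simp add: \<Phi>c \<Psi>c)
    next
      case 3
      then have "\<omega> t = 8 * t - 1" using t by (simp add: \<omega>_def)
      then show ?thesis using 3 t a by (simp add: \<Phi>c \<Psi>c D_def K_def)
    next
      case 4
      then have w: "\<omega> t = 4 - 2 * t" using t by (simp add: \<omega>_def)
      have "H (2 - 2 * t, a) \<in> topspace X2"
        using continuous_map_image_subset_topspace[OF H] 4 t a by force
      then show ?thesis using 4 t a w by (auto simp: \<Phi>c \<Psi>e D_def P0 H0)
    qed
  qed
  have "homotopic_with (\<lambda>_. True) Y1 Y1 (\<Psi> \<circ> \<Phi>) id"
  proof -
    let ?g = "\<lambda>p. e1 (P p)" and ?k = "\<lambda>p. D (fst (snd p), (1 - fst p) * \<omega> (snd (snd p)) + fst p * snd (snd p))"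
    have I: "compact_space I01" "Hausdorff_space I01"
      by (simp_all add: compact_space_subtopology Hausdorff_space_subtopology)
    let ?IAI = "prod_topology I01 (prod_topology A I01)"
    have c_fst: "continuous_map ?IAI euclideanreal (\<lambda>p. fst p)"
      using continuous_map_fst_eta continuous_map_into_fulltopology by blast
    have c_snd: "continuous_map ?IAI euclideanreal (\<lambda>p. snd (snd p))"
      using continuous_map_comp[OF continuous_map_snd_eta continuous_map_snd_eta] continuous_map_into_fulltopology by blast
    have c_a: "continuous_map ?IAI A (\<lambda>p. fst (snd p))"
      using continuous_map_comp[OF continuous_map_snd_eta continuous_map_fst_eta] by blast
    have g: "continuous_map (prod_topology I01 X1) Y1 ?g"
      by (rule continuous_map_comp[OF P a1.cont_e])
    have k: "continuous_map ?IAI Y1 ?k"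
      unfolding \<omega>_def
      by (intro continuous_map_comp[OF _ D] continuous_map_pairedI c_fst c_snd c_a continuous_map_add
          continuous_map_real_mult continuous_map_real_max continuous_map_real_min continuous_map_diff) auto
    obtain F where F: "continuous_map (prod_topology I01 Y1) Y1 F"
      and Fe: "\<And>z x. z \<in> topspace I01 \<Longrightarrow> x \<in> topspace X1 \<Longrightarrow> F (z, e1 x) = ?g (z, x)"
      and Fc: "\<And>z a t. z \<in> topspace I01 \<Longrightarrow> a \<in> topspace A \<Longrightarrow> 0 \<le> t \<Longrightarrow> t \<le> 1 \<Longrightarrow> F (z, c1 (a, t)) = ?k (z, (a, t))"
    proof (rule a1.extend_param[OF I g k])
      \<comment> \<open>Since \<open>\<omega> 1 = 2\<close>, the parameter at \<open>t = 1\<close>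
        is \<open>2 - z\<close>, where \<open>D\<close> equals \<open>P\<close> at time
        \<open>z\<close>: the contraction of the track matches the homotopy on the base.\<close>
      show "?k (z, a, 1) = ?g (z, f1 a)" if "z \<in> topspace I01" "a \<in> topspace A" for z a
        using that by (auto simp: \<omega>_def D_def a1.c_1 P1)
      show "?k (z, a, 0) = ?k (z, a', 0)"
        if "z \<in> topspace I01" "a \<in> topspace A" "a' \<in> topspace A" "\<pi> a = \<pi> a'" for z a a'
        using D_D0[OF that(2-4)] by (simp add: \<omega>_def)
    qed (use that in blast)
    show ?thesis
      unfolding homotopic_with[OF refl]
    proof (intro exI conjI ballI)
      have cov: "thesis" if "y \<in> topspace Y1" "\<And>x. x \<in> topspace X1 \<Longrightarrow> y = e1 x \<Longrightarrow> thesis"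
        "\<And>a t. a \<in> topspace A \<Longrightarrow> 0 \<le> t \<Longrightarrow> t \<le> 1 \<Longrightarrow> y = c1 (a, t) \<Longrightarrow> thesis" for y thesis
      proof -
        have "y \<in> e1 ` topspace X1 \<union> c1 ` (topspace A \<times> {0..1})" using that(1) a1.covers by blast
        then show thesis using that(2,3) by auto
      qed
      have rX: "r x \<in> topspace X2" if "x \<in> topspace X1" for x
        using that continuous_map_image_subset_topspace[OF r] by blast
      show "continuous_map (prod_topology I01 Y1) Y1 F" by (rule F)
      show "F (0, y) = (\<Psi> \<circ> \<Phi>) y" if "y \<in> topspace Y1" for y
        by (rule cov[OF that]) (auto simp: Fe Fc \<Psi>\<Phi> \<Phi>e \<Psi>e P0 rX)
      show "F (1, y) = id y" if "y \<in> topspace Y1" for y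
        by (rule cov[OF that]) (auto simp: Fe Fc P1 D_def)
    qed simp
  qed
  with K K0 K1 \<Psi> \<Psi>e \<Psi>c show thesis by (intro that)
qed

text \<open>Any map between attachments that covers a homotopy equivalence of the bases has a left
  homotopy inverse, which is again of this form and hence has a left homotopy inverse itself.\<close>

theorem cone_attachment_homotopy_equivalent:
  assumes att1: "cone_attachment X1 A \<pi> f1 Y1 e1 c1" and att2: "cone_attachment X2 A \<pi> f2 Y2 e2 c2"
    and r: "continuous_map X1 X2 r" and i: "continuous_map X2 X1 i"
    and ir: "homotopic_with (\<lambda>_. True) X1 X1 (i \<circ> r) id"
    and ri: "homotopic_with (\<lambda>_. True) X2 X2 (r \<circ> i) id"
    and hom: "homotopic_with (\<lambda>_. True) A X2 (r \<circ> f1) f2"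
  shows "Y1 homotopy_equivalent_space Y2"
proof -
  obtain H where H: "continuous_map (prod_topology I01 A) X2 H"
    and H0: "\<And>a. H (0, a) = r (f1 a)" and H1: "\<And>a. H (1, a) = f2 a"
    using hom unfolding homotopic_with_def by auto
  obtain \<Phi> where \<Phi>: "continuous_map Y1 Y2 \<Phi>"
    and \<Phi>e: "\<And>x. x \<in> topspace X1 \<Longrightarrow> \<Phi> (e1 x) = e2 (r x)"
    and \<Phi>c: "\<And>a t. a \<in> topspace A \<Longrightarrow> 0 \<le> t \<Longrightarrow> t \<le> 1 \<Longrightarrow>
      \<Phi> (c1 (a, t)) = (if t \<le> 1/2 then c2 (a, 2 * t) else e2 (H (2 - 2 * t, a)))"
    by (rule cone_attachment_map[OF att1 att2 r H H0 H1], rule that)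
  obtain K \<Psi> where K: "continuous_map (prod_topology I01 A) X1 K"
    and K0: "\<And>a. a \<in> topspace A \<Longrightarrow> K (0, a) = i (f2 a)"
    and K1: "\<And>a. a \<in> topspace A \<Longrightarrow> K (1, a) = f1 a"
    and \<Psi>: "continuous_map Y2 Y1 \<Psi>"
    and \<Psi>e: "\<And>x. x \<in> topspace X2 \<Longrightarrow> \<Psi> (e2 x) = e1 (i x)"
    and \<Psi>c: "\<And>a t. a \<in> topspace A \<Longrightarrow> 0 \<le> t \<Longrightarrow> t \<le> 1 \<Longrightarrow>
      \<Psi> (c2 (a, t)) = (if t \<le> 1/2 then c1 (a, 2 * t) else e1 (K (2 - 2 * t, a)))"
    and \<Psi>\<Phi>: "homotopic_with (\<lambda>_. True) Y1 Y1 (\<Psi> \<circ> \<Phi>) id"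
    by (rule cone_attachment_map_left_inverse[OF att1 att2 r i ir H H0 H1 \<Phi>], erule \<Phi>e, (rule \<Phi>c; assumption), rule that)
  obtain \<Phi>' where \<Phi>': "continuous_map Y1 Y2 \<Phi>'"
    and \<Phi>'\<Psi>: "homotopic_with (\<lambda>_. True) Y2 Y2 (\<Phi>' \<circ> \<Psi>) id"
    by (rule cone_attachment_map_left_inverse[OF att2 att1 i r ri K _ _ \<Psi>], erule K0, erule K1, erule \<Psi>e,
      (rule \<Psi>c; assumption), rule that)
  \<comment> \<open>A right and a left inverse of \<open>\<Psi>\<close> agree up to homotopy: both
    \<open>\<Phi>\<close> and \<open>\<Phi>'\<close> are homotopic to the triple composite.\<close>
  have "homotopic_with (\<lambda>_. True) Y1 Y2 (\<Phi>' \<circ> (\<Psi> \<circ> \<Phi>)) (\<Phi>' \<circ> id)"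
    using \<Psi>\<Phi> \<Phi>' by (rule homotopic_with_compose_continuous_map_left) simp
  moreover have "homotopic_with (\<lambda>_. True) Y1 Y2 ((\<Phi>' \<circ> \<Psi>) \<circ> \<Phi>) (id \<circ> \<Phi>)"
    using \<Phi>'\<Psi> \<Phi> by (rule homotopic_with_compose_continuous_map_right) simp
  ultimately have "homotopic_with (\<lambda>_. True) Y1 Y2 \<Phi> \<Phi>'"
    by (metis comp_assoc comp_id homotopic_with_symD homotopic_with_trans id_comp)
  then have "homotopic_with (\<lambda>_. True) Y2 Y2 (\<Phi> \<circ> \<Psi>) (\<Phi>' \<circ> \<Psi>)"
    using \<Psi> by (rule homotopic_with_compose_continuous_map_right) simp
  then have "homotopic_with (\<lambda>_. True) Y2 Y2 (\<Phi> \<circ> \<Psi>) id"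
    using \<Phi>'\<Psi> homotopic_with_trans by blast
  with \<Phi> \<Psi> \<Psi>\<Phi> show ?thesis
    unfolding homotopy_equivalent_space_def by blast
qed

section \<open>Finite simplicial complexes\<close>

abbreviation realize :: "'a set set \<Rightarrow> ('a \<Rightarrow> real) topology" where
  "realize \<equiv> geometric_realization"

definition finite_complex :: "'a set set \<Rightarrow> bool" where
  "finite_complex K \<longleftrightarrow> finite K \<and> (\<forall>\<sigma>\<in>K. finite \<sigma> \<and> \<sigma> \<noteq> {} \<and> (\<forall>\<tau>. \<tau> \<subseteq> \<sigma> \<longrightarrow> \<tau> \<noteq> {} \<longrightarrow> \<tau> \<in> K))"

lemma finite_complexD:
  assumes "finite_complex K"
  shows "finite K" "\<sigma> \<in> K \<Longrightarrow> finite \<sigma>" "\<sigma> \<in> K \<Longrightarrow> \<sigma> \<noteq> {}"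
    "\<sigma> \<in> K \<Longrightarrow> \<tau> \<subseteq> \<sigma> \<Longrightarrow> \<tau> \<noteq> {} \<Longrightarrow> \<tau> \<in> K"
  using assms unfolding finite_complex_def by blast+

lemma closed_simplex_mono:
  assumes "p \<in> closed_simplex \<sigma>" "\<sigma> \<subseteq> \<tau>" "finite \<tau>"
  shows "p \<in> closed_simplex \<tau>"
proof -
  have "sum p \<tau> = sum p \<sigma>"
    using assms by (intro sum.mono_neutral_right) (auto simp: closed_simplex_def)
  with assms show ?thesis by (auto simp: closed_simplex_def)
qed

lemma closed_simplex_face:
  assumes "p \<in> closed_simplex \<sigma>" "\<tau> \<subseteq> \<sigma>" "finite \<sigma>" "\<And>v. v \<in> \<sigma> \<Longrightarrow> v \<notin> \<tau> \<Longrightarrow> p v = 0"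
  shows "p \<in> closed_simplex \<tau>"
proof -
  have "sum p \<tau> = sum p \<sigma>"
    using assms by (intro sum.mono_neutral_left) auto
  with assms show ?thesis by (auto simp: closed_simplex_def)
qed

lemma closed_simplex_convex:
  assumes "p \<in> closed_simplex \<sigma>" "q \<in> closed_simplex \<sigma>" "0 \<le> t" "t \<le> 1"
  shows "(\<lambda>v. (1 - t) * p v + t * q v) \<in> closed_simplex \<sigma>"
  using assms by (auto simp: closed_simplex_def sum.distrib simp flip: sum_distrib_left)

lemma closed_simplex_le_1:
  assumes "p \<in> closed_simplex \<sigma>" "finite \<sigma>"
  shows "p v \<le> 1"
proof (cases "v \<in> \<sigma>")
  case True
  then have "p v \<le> sum p \<sigma>"
    using assms by (intro member_le_sum) (auto simp: closed_simplex_def)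
  then show ?thesis using assms by (simp add: closed_simplex_def)
qed (use assms in \<open>simp add: closed_simplex_def\<close>)

lemma closed_closed_simplex: "closed (closed_simplex \<sigma> :: ('a \<Rightarrow> real) set)"
proof -
  have c: "continuous_on UNIV (\<lambda>f :: 'a \<Rightarrow> real. f v)" for v
    by (rule continuous_on_product_coordinates)
  have "closed_simplex \<sigma> = (\<Inter>v. {f. 0 \<le> f v}) \<inter> (\<Inter>v\<in>-\<sigma>. {f. f v = 0}) \<inter> {f. (\<Sum>v\<in>\<sigma>. f v) = 1}"
    by (auto simp: closed_simplex_def)
  moreover have "closed {f :: 'a \<Rightarrow> real. (\<Sum>v\<in>\<sigma>. f v) = 1}"
    by (intro closed_Collect_eq continuous_on_sum c continuous_on_const)
  ultimately show ?thesis
    by (auto intro!: closed_Int closed_INT closed_Collect_le closed_Collect_eq c continuous_on_const)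
qed

lemma compact_closed_simplex:
  assumes "finite \<sigma>"
  shows "compact (closed_simplex \<sigma> :: ('a \<Rightarrow> real) set)"
proof -
  have "compactin (powertop_real UNIV) (PiE (UNIV :: 'a set) (\<lambda>_. {0..1}))"
    by (subst compactin_PiE) auto
  then have "compact (PiE (UNIV :: 'a set) (\<lambda>_. {0..1::real}))"
    by (simp add: euclidean_product_topology)
  moreover have "closed_simplex \<sigma> \<subseteq> PiE (UNIV :: 'a set) (\<lambda>_. {0..1})"
    using closed_simplex_le_1[OF _ assms] by (auto simp: closed_simplex_def)
  ultimately show ?thesis
    by (metis closed_closed_simplex compact_Int_closed inf.absorb_iff2)
qed

text \<open>Finiteness enters through closed sets: the complement of a weakly open set is a union of
  finitely many pieces, one in each closed simplex, and each piece is closed in the product.\<close>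

lemma geometric_realization_finite:
  assumes "finite K"
  shows "realize K = top_of_set (\<Union>\<sigma>\<in>K. closed_simplex \<sigma>)"
  unfolding topology_eq
proof (intro allI iffI)
  let ?C = "\<Union>\<sigma>\<in>K. closed_simplex \<sigma>"
  fix U
  {
    assume U: "openin (realize K) U"
    have "closed (closed_simplex \<sigma> - U)" if \<sigma>: "\<sigma> \<in> K" for \<sigma>
    proof -
      have "openin (top_of_set (closed_simplex \<sigma>)) (U \<inter> closed_simplex \<sigma>)"
        using U \<sigma> by (simp add: openin_geometric_realization euclidean_product_topology)
      then have "closedin (top_of_set (closed_simplex \<sigma>)) (closed_simplex \<sigma> - (U \<inter> closed_simplex \<sigma>))"
        by (simp add: closedin_def double_diff)
      then have "closed (closed_simplex \<sigma> - (U \<inter> closed_simplex \<sigma>))"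
        using closed_closed_simplex closedin_closed_trans by blast
      then show ?thesis by (simp add: Diff_Int)
    qed
    then have "closed (\<Union>\<sigma>\<in>K. closed_simplex \<sigma> - U)"
      using assms by (intro closed_UN) auto
    moreover have "?C - U = (\<Union>\<sigma>\<in>K. closed_simplex \<sigma> - U)" by auto
    ultimately have "closed (?C - U)" by metis
    then have "closedin (top_of_set ?C) (?C - U)"
      by (intro closed_subset Diff_subset)
    moreover have "U \<subseteq> ?C" using U by (simp add: openin_geometric_realization)
    ultimately show "openin (top_of_set ?C) U"
      by (simp add: closedin_def double_diff)
  }
  {
    assume U: "openin (top_of_set ?C) U"
    then have "U \<subseteq> ?C" using openin_imp_subset by blast
    moreover have "openin (top_of_set (closed_simplex \<sigma>)) (U \<inter> closed_simplex \<sigma>)" if "\<sigma> \<in> K" for \<sigma>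
    proof -
      obtain V where "open V" "U = ?C \<inter> V" using U by (auto simp: openin_open)
      moreover from this have "U \<inter> closed_simplex \<sigma> = closed_simplex \<sigma> \<inter> V" using that by blast
      ultimately show ?thesis by (auto simp: openin_open)
    qed
    ultimately show "openin (realize K) U"
      by (simp add: openin_geometric_realization euclidean_product_topology)
  }
qed

lemma compact_space_realization:
  assumes "finite_complex K"
  shows "compact_space (realize K)"
  using finite_complexD(1,2)[OF assms]
  by (simp add: geometric_realization_finite compact_space_subtopology compact_UN compact_closed_simplex)

lemma Hausdorff_space_realization:
  fixes K :: "'a set set"
  assumes "finite_complex K"
  shows "Hausdorff_space (realize K)"
  using finite_complexD(1)[OF assms] Hausdorff_space_product_topology[of "\<lambda>_. euclideanreal" "UNIV :: 'a set"]
  by (simp add: geometric_realization_finite Hausdorff_space_subtopology euclidean_product_topology)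

lemma continuous_map_realization_coordinate:
  assumes "finite_complex K"
  shows "continuous_map (realize K) euclideanreal (\<lambda>p. p v)"
  using finite_complexD(1)[OF assms]
  by (simp add: geometric_realization_finite continuous_on_subset[OF continuous_on_product_coordinates])

text \<open>From here on maps into a realization are checked one barycentric coordinate at a
  time.\<close>

lemma continuous_map_into_realization:
  assumes "finite_complex K" "\<And>v. continuous_map Z euclideanreal (\<lambda>z. f z v)"
    and "\<And>z. z \<in> topspace Z \<Longrightarrow> \<exists>\<sigma>\<in>K. f z \<in> closed_simplex \<sigma>"
  shows "continuous_map Z (realize K) f"
proof -
  have "continuous_map Z euclidean f"
    using assms(2) by (simp add: continuous_map_componentwise_UNIV flip: euclidean_product_topology)
  with assms(3) show ?thesis
    using finite_complexD(1)[OF assms(1)]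
    by (auto simp: geometric_realization_finite continuous_map_in_subtopology)
qed

lemma continuous_map_from_realization_coordinate:
  assumes "finite_complex K" "continuous_map Z (realize K) f"
  shows "continuous_map Z euclideanreal (\<lambda>z. f z v)"
  by (rule continuous_map_comp[OF assms(2) continuous_map_realization_coordinate[OF assms(1)]])

text \<open>The straight-line homotopy never leaves the common closed simplex.\<close>

lemma contiguous_imp_homotopic:
  assumes K: "finite_complex K"
    and f: "continuous_map Z (realize K) f" and g: "continuous_map Z (realize K) g"
    and fg: "\<And>z. z \<in> topspace Z \<Longrightarrow> \<exists>\<sigma>\<in>K. f z \<in> closed_simplex \<sigma> \<and> g z \<in> closed_simplex \<sigma>"
  shows "homotopic_with (\<lambda>_. True) Z (realize K) f g"
  unfolding homotopic_with[OF refl]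
proof (intro exI conjI ballI)
  let ?h = "\<lambda>p v. (1 - fst p) * f (snd p) v + fst p * g (snd p) v"
  have 1: "continuous_map (prod_topology I01 Z) euclideanreal (\<lambda>p. fst p)"
    using continuous_map_fst_eta continuous_map_into_fulltopology by blast
  have 2: "continuous_map (prod_topology I01 Z) euclideanreal (\<lambda>p. f (snd p) v)"
    "continuous_map (prod_topology I01 Z) euclideanreal (\<lambda>p. g (snd p) v)" for v
    by (intro continuous_map_comp[OF continuous_map_snd_eta] continuous_map_from_realization_coordinate[OF K] f g)+
  show "continuous_map (prod_topology I01 Z) (realize K) ?h"
  proof (rule continuous_map_into_realization[OF K])
    show "continuous_map (prod_topology I01 Z) euclideanreal (\<lambda>p. ?h p v)" for v
      by (intro continuous_map_add continuous_map_real_mult continuous_map_diff 1 2) auto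
    fix p assume "p \<in> topspace (prod_topology I01 Z)"
    then have p: "0 \<le> fst p" "fst p \<le> 1" "snd p \<in> topspace Z" by auto
    from fg[OF p(3)] obtain \<sigma> where "\<sigma> \<in> K" "f (snd p) \<in> closed_simplex \<sigma>" "g (snd p) \<in> closed_simplex \<sigma>"
      by blast
    then show "\<exists>\<sigma>\<in>K. ?h p \<in> closed_simplex \<sigma>"
      using closed_simplex_convex[OF _ _ p(1,2)] by blast
  qed
qed auto

section \<open>Elementary collapses and matchings\<close>

lemma continuous_map_Min:
  fixes f :: "'z \<Rightarrow> 'v \<Rightarrow> real"
  assumes "finite S" "S \<noteq> {}" "\<And>v. v \<in> S \<Longrightarrow> continuous_map Z euclideanreal (\<lambda>z. f z v)"
  shows "continuous_map Z euclideanreal (\<lambda>z. Min ((\<lambda>v. f z v) ` S))"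
  using assms
proof (induction rule: finite_ne_induct)
  case (insert x F)
  have "(\<lambda>z. Min ((\<lambda>v. f z v) ` insert x F)) = (\<lambda>z. min (f z x) (Min ((\<lambda>v. f z v) ` F)))"
    using insert.hyps by auto
  then show ?case using insert by (auto intro!: continuous_map_real_min)
qed auto

text \<open>\<open>\<sigma>\<close> is a free face: apart from itself it lies only in
  \<open>insert v \<sigma>\<close>. Points of that one simplex are pushed off
  \<open>\<sigma>\<close>, all others stay fixed, which gives a deformation retraction.\<close>

lemma elementary_collapse:
  assumes K: "finite_complex K" and \<sigma>: "\<sigma> \<in> K" and v: "v \<notin> \<sigma>" "insert v \<sigma> \<in> K"
    and free: "\<And>\<tau>. \<tau> \<in> K \<Longrightarrow> \<sigma> \<subseteq> \<tau> \<Longrightarrow> \<tau> = \<sigma> \<or> \<tau> = insert v \<sigma>"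
  defines "L \<equiv> K - {\<sigma>, insert v \<sigma>}"
  shows "finite_complex L" and "realize K homotopy_equivalent_space realize L"
proof -
  note K' = finite_complexD[OF K]
  show L: "finite_complex L"
    unfolding finite_complex_def
  proof (intro conjI ballI allI impI)
    fix \<tau> \<rho> assume \<tau>: "\<tau> \<in> L" and \<rho>: "\<rho> \<subseteq> \<tau>" "\<rho> \<noteq> {}"
    then have "\<rho> \<in> K" using K'(4) L_def by auto
    moreover have "\<not> \<sigma> \<subseteq> \<rho>" using \<tau> \<rho> free unfolding L_def by blast
    ultimately show "\<rho> \<in> L" unfolding L_def by blast
  qed (use K' L_def in auto)
  have fin: "finite \<sigma>" "\<sigma> \<noteq> {}" using K' \<sigma> by auto
  define \<mu> :: "('a \<Rightarrow> real) \<Rightarrow> real" where "\<mu> p = Min ((\<lambda>u. p u) ` \<sigma>)" for p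
  \<comment> \<open>A translation in the direction from the barycentre of \<open>\<sigma>\<close> to
    \<open>v\<close>, stopped when the first coordinate on \<open>\<sigma>\<close> reaches 0. The
    factor \<open>card \<sigma>\<close> keeps the coordinate sum at 1.\<close>
  define r :: "('a \<Rightarrow> real) \<Rightarrow> 'a \<Rightarrow> real" where
    "r p u = p u + \<mu> p * (if u \<in> \<sigma> then -1 else if u = v then real (card \<sigma>) else 0)" for p u
  have \<mu>_le: "\<mu> p \<le> p u" if "u \<in> \<sigma>" for p u
    unfolding \<mu>_def using fin that by (intro Min_le) auto
  have \<mu>_attained: "\<exists>u\<in>\<sigma>. p u = \<mu> p" for p
  proof -
    have "Min (p ` \<sigma>) \<in> p ` \<sigma>" using fin by (intro Min_in) auto
    then show ?thesis unfolding \<mu>_def by (auto simp: image_iff dest: sym)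
  qed
  have r_id: "r p = p" if "\<mu> p = 0" for p
    using that by (auto simp: r_def)
  have \<mu>0: "\<mu> p = 0" if p: "p \<in> closed_simplex \<tau>" and \<tau>: "\<not> \<sigma> \<subseteq> \<tau>" for \<tau> p
  proof -
    obtain u where "u \<in> \<sigma>" "u \<notin> \<tau>" using \<tau> by blast
    then have "\<mu> p \<le> 0" using \<mu>_le[of u p] p by (auto simp: closed_simplex_def)
    moreover obtain u' where "u' \<in> \<sigma>" "p u' = \<mu> p" using \<mu>_attained by blast
    moreover have "0 \<le> p u'" using p by (simp add: closed_simplex_def)
    ultimately show ?thesis by simp
  qed
  have in_big: "p \<in> closed_simplex (insert v \<sigma>)" if "\<tau> \<in> K" "p \<in> closed_simplex \<tau>" "\<sigma> \<subseteq> \<tau>" for \<tau> p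
    using free[OF that(1,3)] that(2) closed_simplex_mono[of p \<sigma> "insert v \<sigma>"] fin(1) by auto
  have r_big: "r p \<in> closed_simplex (insert v \<sigma>) \<and> (\<exists>\<tau>\<in>L. r p \<in> closed_simplex \<tau>)"
    if p: "p \<in> closed_simplex (insert v \<sigma>)" for p
  proof -
    obtain u where u: "u \<in> \<sigma>" "p u = \<mu> p" using \<mu>_attained by blast
    have "0 \<le> \<mu> p" using u p unfolding closed_simplex_def by (metis (no_types, lifting) mem_Collect_eq)
    then have "0 \<le> r p w" for w
      using \<mu>_le[of w p] p by (auto simp: r_def closed_simplex_def)
    moreover have "r p w = 0" if "w \<notin> insert v \<sigma>" for w
      using p that by (auto simp: r_def closed_simplex_def)
    moreover have "sum (r p) (insert v \<sigma>) = 1"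
    proof -
      have "sum (r p) \<sigma> = sum p \<sigma> - real (card \<sigma>) * \<mu> p"
        by (simp add: r_def sum_subtractf)
      moreover have "sum p \<sigma> + p v = 1" using p v fin by (simp add: closed_simplex_def)
      ultimately show ?thesis using v fin by (simp add: r_def)
    qed
    ultimately have rp: "r p \<in> closed_simplex (insert v \<sigma>)" by (simp add: closed_simplex_def)
    moreover have "r p \<in> closed_simplex (insert v \<sigma> - {u})"
      using rp fin u by (intro closed_simplex_face[OF rp]) (auto simp: r_def)
    moreover have "insert v \<sigma> - {u} \<in> K" using u v by (intro K'(4)[OF v(2)]) auto
    moreover have "insert v \<sigma> - {u} \<noteq> \<sigma>" "insert v \<sigma> - {u} \<noteq> insert v \<sigma>" using u v by auto
    ultimately show ?thesis unfolding L_def by blast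
  qed
  have r_small: "\<exists>\<sigma>'\<in>L. r p \<in> closed_simplex \<sigma>'" and r_contig: "\<exists>\<sigma>'\<in>K. r p \<in> closed_simplex \<sigma>' \<and> p \<in> closed_simplex \<sigma>'"
    if "\<tau> \<in> K" "p \<in> closed_simplex \<tau>" for \<tau> p
  proof -
    have "(\<exists>\<sigma>'\<in>L. r p \<in> closed_simplex \<sigma>') \<and> (\<exists>\<sigma>'\<in>K. r p \<in> closed_simplex \<sigma>' \<and> p \<in> closed_simplex \<sigma>')"
    proof (cases "\<sigma> \<subseteq> \<tau>")
      case True
      then show ?thesis using r_big in_big that v(2) by blast
    next
      case False
      then have "r p = p" "\<tau> \<in> L" using that \<mu>0 r_id unfolding L_def by auto
      then show ?thesis using that by auto
    qed
    then show "\<exists>\<sigma>'\<in>L. r p \<in> closed_simplex \<sigma>'" "\<exists>\<sigma>'\<in>K. r p \<in> closed_simplex \<sigma>' \<and> p \<in> closed_simplex \<sigma>'" by auto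
  qed
  have cont: "continuous_map (realize K) euclideanreal (\<lambda>p. r p u)" for u
    unfolding r_def \<mu>_def
    by (intro continuous_map_add continuous_map_real_mult continuous_map_Min fin
        continuous_map_realization_coordinate K) auto
  have rL: "continuous_map (realize K) (realize L) r"
    using r_small by (intro continuous_map_into_realization[OF L cont]) auto
  have idL: "continuous_map (realize L) (realize K) id"
    by (rule continuous_map_into_realization[OF K])
       (auto simp: L_def intro!: continuous_map_realization_coordinate[OF L, unfolded L_def])
  have idK: "continuous_map (realize K) (realize K) id"
    by simp
  have rK: "continuous_map (realize K) (realize K) r"
    using continuous_map_compose[OF rL idL] by simp
  show "realize K homotopy_equivalent_space realize L"
  proof (rule deformation_retract_imp_homotopy_equivalent_space)
    show "homotopic_with (\<lambda>x. True) (realize K) (realize K) r id"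
      using r_contig by (intro contiguous_imp_homotopic[OF K rK idK]) auto
    have "r p = p" if "\<tau> \<in> L" "p \<in> closed_simplex \<tau>" for p \<tau>
      using that free \<mu>0 r_id unfolding L_def by blast
    then show "retraction_maps (realize K) (realize L) r id"
      using rL idL by (auto simp: retraction_maps_def)
  qed
qed

text \<open>The last hypothesis takes the place of acyclicity in discrete Morse theory. Any coface
  of a maximal member of the matching becomes a member once \<open>v \<sigma>\<close> is removed,
  hence equals \<open>\<sigma>\<close> after that removal. So a maximal member is a free face and
  its pair can be collapsed first.\<close>

lemma collapse_matching:
  assumes "finite_complex K" and "\<S> \<subseteq> K"
    and "\<And>\<sigma>. \<sigma> \<in> \<S> \<Longrightarrow> v \<sigma> \<notin> \<sigma> \<and> insert (v \<sigma>) \<sigma> \<in> K"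
    and "\<And>\<sigma> \<tau>. \<sigma> \<in> \<S> \<Longrightarrow> \<tau> \<in> K \<Longrightarrow> \<sigma> \<subseteq> \<tau> \<Longrightarrow> v \<tau> = v \<sigma> \<and> \<tau> - {v \<sigma>} \<in> \<S>"
  shows "finite_complex (K - (\<S> \<union> (\<lambda>\<sigma>. insert (v \<sigma>) \<sigma>) ` \<S>)) \<and>
    realize K homotopy_equivalent_space
      realize (K - (\<S> \<union> (\<lambda>\<sigma>. insert (v \<sigma>) \<sigma>) ` \<S>))"
  using assms
proof (induction "card \<S>" arbitrary: K \<S>)
  case 0
  then have "finite \<S>" using finite_complexD(1) finite_subset by metis
  then have "\<S> = {}" using 0 by simp
  then show ?case using 0 by (simp add: homotopy_equivalent_space_refl)
next
  case (Suc n)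
  note K = finite_complexD[OF Suc.prems(1)]
  have finS: "finite \<S>" using Suc.prems(2) K(1) finite_subset by metis
  have "\<S> \<noteq> {}" using Suc.hyps(2) by auto
  then obtain \<sigma> where \<sigma>: "\<sigma> \<in> \<S>" and max: "\<And>\<tau>. \<tau> \<in> \<S> \<Longrightarrow> \<sigma> \<subseteq> \<tau> \<Longrightarrow> \<tau> = \<sigma>"
    using finite_has_maximal[OF finS] by (metis (no_types, lifting))
  have v\<sigma>: "v \<sigma> \<notin> \<sigma>" "insert (v \<sigma>) \<sigma> \<in> K" using Suc.prems(3)[OF \<sigma>] by auto
  have \<sigma>K: "\<sigma> \<in> K" using \<sigma> Suc.prems(2) by blast
  have free: "\<tau> = \<sigma> \<or> \<tau> = insert (v \<sigma>) \<sigma>" if "\<tau> \<in> K" "\<sigma> \<subseteq> \<tau>" for \<tau>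
  proof -
    have "\<tau> - {v \<sigma>} \<in> \<S>" using Suc.prems(4)[OF \<sigma> that] by simp
    moreover have "\<sigma> \<subseteq> \<tau> - {v \<sigma>}" using that v\<sigma> by blast
    ultimately have "\<tau> - {v \<sigma>} = \<sigma>" using max by blast
    then show ?thesis by blast
  qed
  let ?K' = "K - {\<sigma>, insert (v \<sigma>) \<sigma>}" and ?S' = "\<S> - {\<sigma>}"
  note step = elementary_collapse[OF Suc.prems(1) \<sigma>K v\<sigma> free]
  \<comment> \<open>The coface condition for a simplex and its own partner: both carry the same
    matching vertex. Hence the pairs are disjoint, and removing one of them leaves the rest of the
    matching intact.\<close>
  have v_insert: "v (insert (v \<tau>) \<tau>) = v \<tau>" if "\<tau> \<in> \<S>" for \<tau>
    using Suc.prems(3)[OF that] Suc.prems(4)[OF that, of "insert (v \<tau>) \<tau>"] by blast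
  have not_S: "insert (v \<tau>) \<tau> \<notin> \<S>" if "\<tau> \<in> \<S>" for \<tau>
    using Suc.prems(3)[of "insert (v \<tau>) \<tau>"] v_insert[OF that] by auto
  have inj: "\<tau> = \<sigma>" if "\<tau> \<in> \<S>" "insert (v \<tau>) \<tau> = insert (v \<sigma>) \<sigma>" for \<tau>
    using v_insert[OF that(1)] v_insert[OF \<sigma>] that Suc.prems(3)[OF that(1)] v\<sigma>(1) by (metis insert_ident)
  have "finite_complex (?K' - (?S' \<union> (\<lambda>\<sigma>. insert (v \<sigma>) \<sigma>) ` ?S')) \<and>
    realize ?K' homotopy_equivalent_space
      realize (?K' - (?S' \<union> (\<lambda>\<sigma>. insert (v \<sigma>) \<sigma>) ` ?S'))"
  proof (rule Suc.hyps(1))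
    show "n = card ?S'" using Suc.hyps(2) \<sigma> finS by simp
    show "finite_complex ?K'" by (rule step)
    show "?S' \<subseteq> ?K'" using Suc.prems(2) not_S[OF \<sigma>] by auto
    show "v \<tau> \<notin> \<tau> \<and> insert (v \<tau>) \<tau> \<in> ?K'" if "\<tau> \<in> ?S'" for \<tau>
      using that Suc.prems(3)[of \<tau>] inj[of \<tau>] not_S[of \<tau>] \<sigma> by auto
    show "v \<tau> = v \<rho> \<and> \<tau> - {v \<rho>} \<in> ?S'" if "\<rho> \<in> ?S'" "\<tau> \<in> ?K'" "\<rho> \<subseteq> \<tau>" for \<rho> \<tau>
    proof -
      have *: "v \<tau> = v \<rho> \<and> \<tau> - {v \<rho>} \<in> \<S>" using Suc.prems(4)[of \<rho> \<tau>] that by blast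
      moreover have "\<tau> - {v \<rho>} \<noteq> \<sigma>"
      proof
        assume "\<tau> - {v \<rho>} = \<sigma>"
        then show False using that(2) free[of \<tau>] by blast
      qed
      ultimately show ?thesis by blast
    qed
  qed
  note IH = this
  have "?K' - (?S' \<union> (\<lambda>\<sigma>. insert (v \<sigma>) \<sigma>) ` ?S') = K - (\<S> \<union> (\<lambda>\<sigma>. insert (v \<sigma>) \<sigma>) ` \<S>)"
    using \<sigma> by blast
  note IH' = IH[unfolded this]
  then show ?case
    using homotopy_eqv_trans[OF step(2) conjunct2[OF IH']] by blast
qed

section \<open>Polar coordinates on a triangle\<close>

text \<open>A list of weighted vertices instead of a function, so that the vertices in a formula
  need not be distinct: weights of a repeated vertex add up.\<close>

definition point_of :: "('a \<times> real) list \<Rightarrow> 'a \<Rightarrow> real" where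
  "point_of ws u = (\<Sum>(v, w)\<leftarrow>ws. if u = v then w else 0)"

lemma point_of_Nil [simp]: "point_of [] u = 0"
  and point_of_Cons [simp]: "point_of ((v, w) # ws) u = (if u = v then w else 0) + point_of ws u"
  by (simp_all add: point_of_def)

lemma point_of_in_closed_simplex:
  assumes "\<forall>(v, w)\<in>set ws. 0 \<le> w \<and> (w \<noteq> 0 \<longrightarrow> v \<in> \<sigma>)" "sum_list (map snd ws) = 1" "finite \<sigma>"
  shows "point_of ws \<in> closed_simplex \<sigma>"
proof -
  have "(\<forall>u. 0 \<le> point_of ws u) \<and> (\<forall>u. u \<notin> \<sigma> \<longrightarrow> point_of ws u = 0) \<and>
      sum (point_of ws) \<sigma> = sum_list (map snd ws)"
    using assms(1)
  proof (induction ws)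
    case (Cons p ws)
    obtain v w where p: "p = (v, w)" by (cases p)
    have "(\<Sum>u\<in>\<sigma>. if u = v then w else 0) = w"
      using Cons.prems assms(3) p by (auto simp: sum.delta)
    then show ?case using Cons p by (auto simp: sum.distrib)
  qed auto
  then show ?thesis using assms(2) by (auto simp: closed_simplex_def)
qed

section \<open>Families of maps over a discrete index set\<close>

lemma continuous_map_discrete_prod:
  assumes "\<And>j. j \<in> J \<Longrightarrow> continuous_map S V (\<lambda>s. F (j, s))"
  shows "continuous_map (prod_topology (discrete_topology J) S) V F"
  unfolding continuous_map_def
proof (intro conjI allI impI)
  show "F \<in> topspace (prod_topology (discrete_topology J) S) \<rightarrow> topspace V"
    using assms by (fastforce simp: continuous_map_def Pi_iff)
  fix U assume "openin V U"
  then have "openin (prod_topology (discrete_topology J) S) ({j} \<times> {s \<in> topspace S. F (j, s) \<in> U})"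
    if "j \<in> J" for j
    using assms[OF that] that by (auto simp: openin_prod_Times_iff continuous_map_def)
  then have "openin (prod_topology (discrete_topology J) S) (\<Union>j\<in>J. {j} \<times> {s \<in> topspace S. F (j, s) \<in> U})"
    by (intro openin_Union) auto
  moreover have "(\<Union>j\<in>J. {j} \<times> {s \<in> topspace S. F (j, s) \<in> U}) =
      {p \<in> topspace (prod_topology (discrete_topology J) S). F p \<in> U}"
    by auto
  ultimately show "openin (prod_topology (discrete_topology J) S)
      {p \<in> topspace (prod_topology (discrete_topology J) S). F p \<in> U}"
    by simp
qed

lemma continuous_map_discrete_prod_left:
  assumes "\<And>j. j \<in> J \<Longrightarrow> continuous_map (prod_topology S Z) V (\<lambda>q. F ((j, fst q), snd q))"
  shows "continuous_map (prod_topology (prod_topology (discrete_topology J) S) Z) V F"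
proof -
  let ?X = "prod_topology (prod_topology (discrete_topology J) S) Z"
  have 1: "continuous_map (prod_topology (discrete_topology J) (prod_topology S Z)) V
      (\<lambda>p. F ((fst p, fst (snd p)), snd (snd p)))"
    by (rule continuous_map_discrete_prod) (use assms in simp)
  have 2: "continuous_map ?X (prod_topology (discrete_topology J) (prod_topology S Z))
      (\<lambda>p. (fst (fst p), (snd (fst p), snd p)))"
    by (intro continuous_map_pairedI continuous_map_comp[OF continuous_map_fst_eta continuous_map_fst_eta]
        continuous_map_comp[OF continuous_map_fst_eta continuous_map_snd_eta]) simp
  show ?thesis using continuous_map_comp[OF 2 1] by simp
qed

lemma homotopic_with_discrete_prod:
  assumes "\<And>j. j \<in> J \<Longrightarrow> homotopic_with (\<lambda>_. True) S V (\<lambda>s. f (j, s)) (\<lambda>s. g (j, s))"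
  shows "homotopic_with (\<lambda>_. True) (prod_topology (discrete_topology J) S) V f g"
proof -
  have "\<exists>h. continuous_map (prod_topology I01 S) V h \<and> (\<forall>s\<in>topspace S. h (0, s) = f (j, s)) \<and>
      (\<forall>s\<in>topspace S. h (1, s) = g (j, s))" if "j \<in> J" for j
    using assms[OF that] by (auto simp: homotopic_with)
  then obtain h where h: "\<And>j. j \<in> J \<Longrightarrow> continuous_map (prod_topology I01 S) V (h j)"
    and h0: "\<And>j s. j \<in> J \<Longrightarrow> s \<in> topspace S \<Longrightarrow> h j (0, s) = f (j, s)"
    and h1: "\<And>j s. j \<in> J \<Longrightarrow> s \<in> topspace S \<Longrightarrow> h j (1, s) = g (j, s)"
    by metis
  have 1: "continuous_map (prod_topology (discrete_topology J) (prod_topology I01 S)) V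
      (\<lambda>p. h (fst p) (snd p))"
    by (rule continuous_map_discrete_prod) (use h in simp)
  have 2: "continuous_map (prod_topology I01 (prod_topology (discrete_topology J) S))
      (prod_topology (discrete_topology J) (prod_topology I01 S))
      (\<lambda>p. (fst (snd p), (fst p, snd (snd p))))"
    by (intro continuous_map_pairedI continuous_map_comp[OF continuous_map_snd_eta continuous_map_fst_eta]
        continuous_map_comp[OF continuous_map_snd_eta continuous_map_snd_eta]) simp
  show ?thesis
    unfolding homotopic_with[OF refl]
  proof (intro exI conjI ballI)
    show "continuous_map (prod_topology I01 (prod_topology (discrete_topology J) S)) V
        (\<lambda>p. h (fst (snd p)) (fst p, snd (snd p)))"
      using continuous_map_comp[OF 2 1] by simp
  qed (auto simp: h0 h1)
qed

section \<open>Circle, sphere and triangle in coordinates\<close>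

lemma in_nsphere_1: "s \<in> topspace (nsphere 1) \<longleftrightarrow> (s 0)\<^sup>2 + (s 1)\<^sup>2 = 1 \<and> (\<forall>i>1. s i = 0)"
  by (simp add: nsphere topspace_subtopology)

lemmas in_nsphere_Suc_0 = in_nsphere_1[unfolded One_nat_def]

lemma in_nsphere_2: "s \<in> topspace (nsphere 2) \<longleftrightarrow> (s 0)\<^sup>2 + (s 1)\<^sup>2 + (s 2)\<^sup>2 = 1 \<and> (\<forall>i>2. s i = 0)"
  by (simp add: nsphere topspace_subtopology numeral_2_eq_2)

lemma compact_space_nsphere: "compact_space (nsphere d)"
proof -
  let ?S = "{x :: nat \<Rightarrow> real. (\<Sum>i\<le>d. (x i)\<^sup>2) = 1 \<and> (\<forall>i>d. x i = 0)}"
  have "compactin (powertop_real UNIV) (PiE (UNIV :: nat set) (\<lambda>_. {-1..1}))"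
    by (subst compactin_PiE) auto
  then have c: "compact (PiE (UNIV :: nat set) (\<lambda>_. {-1..1::real}))"
    by (simp add: euclidean_product_topology)
  have cont: "continuous_on UNIV (\<lambda>x :: nat \<Rightarrow> real. x i)" for i
    by (rule continuous_on_product_coordinates)
  have "?S = {x. (\<Sum>i\<le>d. (x i)\<^sup>2) = 1} \<inter> (\<Inter>i\<in>{d<..}. {x. x i = 0})" by auto
  moreover have "closed {x :: nat \<Rightarrow> real. (\<Sum>i\<le>d. (x i)\<^sup>2) = 1}"
    by (intro closed_Collect_eq continuous_on_sum continuous_on_power cont continuous_on_const)
  moreover have "closed {x :: nat \<Rightarrow> real. x i = 0}" for i
    by (intro closed_Collect_eq cont continuous_on_const)
  ultimately have "closed ?S" by (simp add: closed_Int closed_INT)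
  moreover have "?S \<subseteq> PiE UNIV (\<lambda>_. {-1..1})"
  proof
    fix x assume x: "x \<in> ?S"
    have "x i \<in> {-1..1}" for i
    proof (cases "i \<le> d")
      case True
      then have "(x i)\<^sup>2 \<le> (\<Sum>i\<le>d. (x i)\<^sup>2)" by (intro member_le_sum) auto
      then have "(x i)\<^sup>2 \<le> 1" using x by simp
      then show ?thesis by (simp add: abs_square_le_1 abs_le_iff)
    qed (use x in auto)
    then show "x \<in> PiE UNIV (\<lambda>_. {-1..1})" by auto
  qed
  ultimately have "compact ?S" using compact_Int_closed[OF c, of ?S] by (simp add: inf.absorb2)
  then show ?thesis by (simp add: nsphere compact_space_subtopology euclidean_product_topology)
qed

text \<open>A direction in the plane of the triangle: the circle supplies the first two components,
  and the third makes the sum 0, so moving along it preserves barycentric coordinates.\<close>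

definition simplex_vec :: "nat \<Rightarrow> (nat \<Rightarrow> real) \<Rightarrow> real" where
  "simplex_vec k s = (if k = 0 then s 0 else if k = 1 then s 1 else - s 0 - s 1)"

text \<open>The Minkowski gauge of the triangle about its barycentre. The ray from the barycentre
  leaves the triangle when the smallest coordinate reaches 0, that is, after
  \<open>1 / (3 * simplex_gauge s)\<close> times the direction.\<close>

definition simplex_gauge :: "(nat \<Rightarrow> real) \<Rightarrow> real" where
  "simplex_gauge s = - min (min (simplex_vec 0 s) (simplex_vec 1 s)) (simplex_vec 2 s)"

text \<open>Polar coordinates on the triangle: for \<open>t = 1\<close> these are the barycentric coordinates of a
  parametrisation of the boundary by the circle, for \<open>t = 0\<close> those of the barycentre.\<close>

definition bary :: "nat \<Rightarrow> (nat \<Rightarrow> real) \<Rightarrow> real \<Rightarrow> real" where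
  "bary k s t = 1/3 + t * simplex_vec k s / (3 * simplex_gauge s)"

text \<open>The three components sum to 0, so if none is negative then all vanish, which is
  impossible on the circle.\<close>

lemma simplex_gauge_pos:
  assumes "s \<in> topspace (nsphere 1)"
  shows "0 < simplex_gauge s"
proof (rule ccontr)
  assume "\<not> 0 < simplex_gauge s"
  then have "s 0 = 0" "s 1 = 0" by (auto simp: simplex_gauge_def simplex_vec_def)
  then show False using assms by (simp add: in_nsphere_Suc_0)
qed

lemma simplex_vec_ge: "k \<le> 2 \<Longrightarrow> - simplex_gauge s \<le> simplex_vec k s"
  and simplex_gauge_attained: "\<exists>k\<le>2. simplex_vec k s = - simplex_gauge s"
proof -
  show "- simplex_gauge s \<le> simplex_vec k s" if "k \<le> 2"
    using that by (auto simp: simplex_gauge_def numeral_2_eq_2 le_Suc_eq min_def)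
  have "simplex_vec 0 s = - simplex_gauge s \<or> simplex_vec 1 s = - simplex_gauge s \<or> simplex_vec 2 s = - simplex_gauge s"
    by (auto simp: simplex_gauge_def min_def)
  then show "\<exists>k\<le>2. simplex_vec k s = - simplex_gauge s" by (metis le_refl one_le_numeral zero_le)
qed

lemma bary_sum: "bary 0 s t + bary 1 s t + bary 2 s t = 1"
proof -
  have "bary 0 s t + bary 1 s t + bary 2 s t =
      1 + t * (simplex_vec 0 s + simplex_vec 1 s + simplex_vec 2 s) / (3 * simplex_gauge s)"
    by (simp add: bary_def add_divide_distrib ring_distribs)
  then show ?thesis by (simp add: simplex_vec_def)
qed

lemma bary_ge:
  assumes "s \<in> topspace (nsphere 1)" "0 \<le> t" "k \<le> 2"
  shows "(1 - t) / 3 \<le> bary k s t"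
proof -
  have "t * (- simplex_gauge s) \<le> t * simplex_vec k s"
    using simplex_vec_ge assms by (intro mult_left_mono) auto
  then have "t * (- simplex_gauge s) / (3 * simplex_gauge s) \<le> t * simplex_vec k s / (3 * simplex_gauge s)"
    using simplex_gauge_pos[OF assms(1)] by (intro divide_right_mono) auto
  then show ?thesis using simplex_gauge_pos[OF assms(1)] by (simp add: bary_def diff_divide_distrib)
qed

text \<open>Together with \<open>bary_ge\<close>: the smallest coordinate is exactly
  \<open>(1 - t) / 3\<close>. Hence the point determines \<open>t\<close>, and at
  \<open>t = 1\<close> some coordinate is 0.\<close>

lemma bary_attained:
  assumes "s \<in> topspace (nsphere 1)"
  shows "\<exists>k\<le>2. \<forall>t. bary k s t = (1 - t) / 3"
proof -
  obtain k where "k \<le> 2" "simplex_vec k s = - simplex_gauge s" using simplex_gauge_attained by blast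
  then show ?thesis using simplex_gauge_pos[OF assms] by (auto simp: bary_def diff_divide_distrib)
qed

lemma bary_0: "bary k s 0 = 1/3"
  by (simp add: bary_def)

lemma bary_inj:
  assumes s: "s \<in> topspace (nsphere 1)" and s': "s' \<in> topspace (nsphere 1)"
    and t: "0 \<le> t" "0 \<le> t'" and eq: "\<And>k. k \<le> 2 \<Longrightarrow> bary k s t = bary k s' t'"
  shows "t = t' \<and> (s = s' \<or> t = 0)"
proof -
  have "t' \<le> t" if s: "s \<in> topspace (nsphere 1)" and s': "s' \<in> topspace (nsphere 1)"
    and "0 \<le> t" and eq: "\<And>k. k \<le> 2 \<Longrightarrow> bary k s t = bary k s' t'" for s s' t t'
  proof -
    obtain k where "k \<le> 2" "bary k s' t' = (1 - t') / 3" using bary_attained[OF s'] by blast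
    then show ?thesis using bary_ge[OF s \<open>0 \<le> t\<close>, of k] eq[of k] by simp
  qed
  from this[OF s s' t(1) eq] this[OF s' s t(2) eq[symmetric]] have tt: "t = t'" by auto
  moreover have "s = s'" if "t \<noteq> 0"
  proof -
    have p: "0 < simplex_gauge s" "0 < simplex_gauge s'" using s s' simplex_gauge_pos by auto
    \<comment> \<open>Equal coordinates make the two direction vectors positively proportional; both
      come from the unit circle, so the ratio is 1.\<close>
    define k where "k = simplex_gauge s / simplex_gauge s'"
    have "simplex_vec i s = k * simplex_vec i s'" if "i \<le> 2" for i
      using eq[OF that] tt \<open>t \<noteq> 0\<close> p by (simp add: bary_def k_def field_simps)
    from this[of 0] this[of 1] have v: "s 0 = k * s' 0" "s 1 = k * s' 1"
      by (simp_all add: simplex_vec_def)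
    have "1 = k\<^sup>2 * ((s' 0)\<^sup>2 + (s' 1)\<^sup>2)"
      using s v by (simp add: in_nsphere_Suc_0 power_mult_distrib ring_distribs)
    then have "k\<^sup>2 = 1" using s' by (simp add: in_nsphere_Suc_0)
    moreover have "0 < k" using p by (simp add: k_def)
    ultimately have "k = 1" by (simp add: power2_eq_1_iff)
    show ?thesis
    proof
      fix i show "s i = s' i"
        using v \<open>k = 1\<close> s s' by (cases "i > 1") (auto simp: in_nsphere_Suc_0 not_less le_Suc_eq)
    qed
  qed
  ultimately show ?thesis by blast
qed

lemma bary_surj:
  assumes g: "0 \<le> g0" "0 \<le> g1" "0 \<le> g2" "g0 + g1 + g2 = 1"
  obtains s t where "s \<in> topspace (nsphere 1)" "0 \<le> t" "t \<le> 1"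
    "bary 0 s t = g0" "bary 1 s t = g1" "bary 2 s t = g2"
proof -
  \<comment> \<open>Three times the offset from the barycentre. Its gauge is \<open>t\<close>,
    chosen so that the smallest coordinate becomes \<open>(1 - t) / 3\<close>, and its normalisation
    will be \<open>s\<close>.\<close>
  define Q0 Q1 where "Q0 = 3 * g0 - 1" and "Q1 = 3 * g1 - 1"
  define t where "t = - min (min Q0 Q1) (- Q0 - Q1)"
  have t: "0 \<le> t" "t \<le> 1" using g by (auto simp: t_def Q0_def Q1_def min_def)
  show thesis
  proof (cases "Q0 = 0 \<and> Q1 = 0")
    case True
    then have "g0 = 1/3" "g1 = 1/3" "g2 = 1/3" using g by (auto simp: Q0_def Q1_def)
    \<comment> \<open>At the barycentre the direction is arbitrary.\<close>
    then show thesis using that[of sphere_base 0] by (simp add: bary_0 sphere_base_in_nsphere)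
  next
    case False
    define n where "n = sqrt (Q0\<^sup>2 + Q1\<^sup>2)"
    have "Q0\<^sup>2 + Q1\<^sup>2 > 0" using False by (simp add: sum_power2_gt_zero_iff)
    then have n: "n > 0" "n\<^sup>2 = Q0\<^sup>2 + Q1\<^sup>2" by (simp_all add: n_def)
    define s :: "nat \<Rightarrow> real" where "s = (\<lambda>i. if i = 0 then Q0 / n else if i = 1 then Q1 / n else 0)"
    have s: "s \<in> topspace (nsphere 1)"
      using n False by (simp add: in_nsphere_Suc_0 s_def power_divide flip: add_divide_distrib)
    have vec: "simplex_vec 0 s = Q0 / n" "simplex_vec 1 s = Q1 / n" "simplex_vec 2 s = (- Q0 - Q1) / n"
      by (simp_all add: simplex_vec_def s_def diff_divide_distrib)
    have "simplex_gauge s = t / n"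
      unfolding simplex_gauge_def vec t_def using n by (simp add: min_divide_distrib_right)
    then have "t \<noteq> 0" using simplex_gauge_pos[OF s] by auto
    have cancel: "t * (q / n) / (3 * (t / n)) = q / 3" for q
      using \<open>t \<noteq> 0\<close> n(1) by simp
    have "bary 0 s t = g0" "bary 1 s t = g1" "bary 2 s t = g2"
      using g unfolding bary_def vec \<open>simplex_gauge s = t / n\<close> cancel by (simp_all add: Q0_def Q1_def field_simps)
    then show thesis using that s t by blast
  qed
qed

lemma continuous_map_simplex_gauge: "continuous_map (nsphere 1) euclideanreal simplex_gauge"
  and continuous_map_simplex_vec: "continuous_map (nsphere 1) euclideanreal (simplex_vec k)"
proof -
  show v: "continuous_map (nsphere 1) euclideanreal (simplex_vec k)" for k
    unfolding simplex_vec_def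
    by (cases "k = 0"; cases "k = 1")
       (auto intro!: continuous_map_nsphere_projection continuous_map_diff continuous_map_minus)
  show "continuous_map (nsphere 1) euclideanreal simplex_gauge"
    unfolding simplex_gauge_def
    by (intro continuous_map_minus continuous_map_real_min v)
qed

lemma continuous_map_bary:
  "continuous_map (prod_topology (nsphere 1) I01) euclideanreal (\<lambda>p. bary k (fst p) (snd p))"
proof -
  have 1: "continuous_map (prod_topology (nsphere 1) I01) euclideanreal (\<lambda>p. snd p)"
    using continuous_map_snd_eta continuous_map_into_fulltopology by blast
  have 2: "continuous_map (prod_topology (nsphere 1) I01) euclideanreal (\<lambda>p. simplex_vec k (fst p))"
    by (rule continuous_map_comp[OF continuous_map_fst_eta continuous_map_simplex_vec])
  have 3: "continuous_map (prod_topology (nsphere 1) I01) euclideanreal (\<lambda>p. simplex_gauge (fst p))"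
    by (rule continuous_map_comp[OF continuous_map_fst_eta continuous_map_simplex_gauge])
  show ?thesis
    unfolding bary_def
    by (intro continuous_map_add continuous_map_real_divide continuous_map_real_mult 1 2 3)
       (use simplex_gauge_pos in force)+
qed

section \<open>Attaching triangles\<close>

definition triangle_map :: "('j \<Rightarrow> 'a) \<Rightarrow> ('j \<Rightarrow> 'a) \<Rightarrow> ('j \<Rightarrow> 'a) \<Rightarrow> ('j \<times> (nat \<Rightarrow> real)) \<times> real \<Rightarrow> 'a \<Rightarrow> real" where
  "triangle_map va vb vc = (\<lambda>((j, s), t).
     point_of [(va j, bary 0 s t), (vb j, bary 1 s t), (vc j, bary 2 s t)])"

lemma triangle_map_in:
  assumes "s \<in> topspace (nsphere 1)" "0 \<le> t" "t \<le> 1"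
  shows "triangle_map va vb vc ((j, s), t) \<in> closed_simplex {va j, vb j, vc j}"
  unfolding triangle_map_def prod.case
proof (rule point_of_in_closed_simplex)
  have "0 \<le> bary k s t" if "k \<le> 2" for k
    using bary_ge[OF assms(1,2) that] assms(3) by simp
  then show "\<forall>(v, w)\<in>set [(va j, bary 0 s t), (vb j, bary 1 s t), (vc j, bary 2 s t)].
      0 \<le> w \<and> (w \<noteq> 0 \<longrightarrow> v \<in> {va j, vb j, vc j})"
    by auto
qed (use bary_sum[of s t] in auto)

lemma triangle_map_vertices:
  assumes "va j \<noteq> vb j" "va j \<noteq> vc j" "vb j \<noteq> vc j"
  shows "triangle_map va vb vc ((j, s), t) (va j) = bary 0 s t"
    "triangle_map va vb vc ((j, s), t) (vb j) = bary 1 s t"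
    "triangle_map va vb vc ((j, s), t) (vc j) = bary 2 s t"
  using assms by (auto simp: triangle_map_def)

text \<open>At \<open>t = 1\<close> one of the three weights is 0, and the point lies on the
  opposite edge.\<close>

lemma triangle_boundary_in:
  assumes "s \<in> topspace (nsphere 1)"
  obtains \<tau> where "\<tau> = {va j, vb j} \<or> \<tau> = {va j, vc j} \<or> \<tau> = {vb j, vc j}"
    "triangle_map va vb vc ((j, s), 1) \<in> closed_simplex \<tau>"
proof -
  obtain k where kt: "k \<le> 2" "\<forall>t. bary k s t = (1 - t) / 3" using bary_attained[OF assms] by blast
  then have k: "k \<le> 2" "bary k s 1 = 0" using kt(2)[rule_format, of 1] by simp_all
  have nn: "0 \<le> bary i s 1" if "i \<le> 2" for i
    using bary_ge[OF assms zero_le_one that] by simp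
  have *: "triangle_map va vb vc ((j, s), 1) \<in> closed_simplex \<tau>"
    if "finite \<tau>" "k \<noteq> 0 \<longrightarrow> va j \<in> \<tau>" "k \<noteq> 1 \<longrightarrow> vb j \<in> \<tau>" "k \<noteq> 2 \<longrightarrow> vc j \<in> \<tau>" for \<tau>
    unfolding triangle_map_def prod.case
  proof (rule point_of_in_closed_simplex)
    show "\<forall>(v, w)\<in>set [(va j, bary 0 s 1), (vb j, bary 1 s 1), (vc j, bary 2 s 1)].
        0 \<le> w \<and> (w \<noteq> 0 \<longrightarrow> v \<in> \<tau>)"
      using nn[of 0] nn[of 1] nn[of 2] k that by auto
  qed (use bary_sum[of s 1] that in auto)
  consider "k = 0" | "k = 1" | "k = 2" using k(1) by linarith
  then show thesis
  proof cases
    case 1 then show thesis using that[of "{vb j, vc j}"] *[of "{vb j, vc j}"] by auto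
  next
    case 2 then show thesis using that[of "{va j, vc j}"] *[of "{va j, vc j}"] by auto
  next
    case 3 then show thesis using that[of "{va j, vb j}"] *[of "{va j, vb j}"] by auto
  qed
qed

lemma continuous_map_point_of:
  assumes "\<forall>p\<in>set ws. continuous_map Z euclideanreal (snd p)"
  shows "continuous_map Z euclideanreal (\<lambda>z. point_of (map (\<lambda>p. (fst p, snd p z)) ws) u)"
  using assms
proof (induction ws)
  case (Cons p ws)
  have "continuous_map Z euclideanreal (\<lambda>z. if u = fst p then snd p z else 0)"
    using Cons.prems by (cases "u = fst p") auto
  with Cons show ?case by (simp add: continuous_map_add)
qed simp

text \<open>The added simplices are triangles only, so their edges are already in \<open>L\<close>.
  An interior point has all three vertices as its support, hence it lies in no simplex of
  \<open>L\<close> and it determines its triangle.\<close>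

lemma triangles_cone_attachment:
  assumes K: "finite_complex K" and L: "finite_complex L" and LK: "L \<subseteq> K" and J: "finite J"
    and bij: "bij_betw (\<lambda>j. {va j, vb j, vc j}) J (K - L)"
    and dist: "\<And>j. j \<in> J \<Longrightarrow> va j \<noteq> vb j \<and> va j \<noteq> vc j \<and> vb j \<noteq> vc j"
  shows "cone_attachment (realize L) (prod_topology (discrete_topology J) (nsphere 1)) fst
    (\<lambda>a. triangle_map va vb vc (a, 1)) (realize K) id (triangle_map va vb vc)"
proof -
  note K' = finite_complexD[OF K] and L' = finite_complexD[OF L]
  let ?c = "triangle_map va vb vc"
  let ?A = "prod_topology (discrete_topology J) (nsphere 1)"
  have \<tau>: "{va j, vb j, vc j} \<in> K" "{va j, vb j, vc j} \<notin> L" if "j \<in> J" for j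
    using bij that by (auto simp: bij_betw_def)
  have card\<tau>: "card {va j, vb j, vc j} = 3" if "j \<in> J" for j
    using dist[OF that] by auto
  have boundary: "\<exists>\<sigma>\<in>L. ?c ((j, s), 1) \<in> closed_simplex \<sigma>" if j: "j \<in> J" and s: "s \<in> topspace (nsphere 1)" for j s
  proof -
    obtain \<sigma> where \<sigma>: "\<sigma> = {va j, vb j} \<or> \<sigma> = {va j, vc j} \<or> \<sigma> = {vb j, vc j}"
      "?c ((j, s), 1) \<in> closed_simplex \<sigma>"
      by (rule triangle_boundary_in[OF s, of va j vb vc], rule that)
    have "\<sigma> \<in> K" using \<sigma>(1) by (intro K'(4)[OF \<tau>(1)[OF j]]) auto
    \<comment> \<open>A proper face cannot be one of the new simplices, which all have three
      vertices, so it belongs to \<open>L\<close>.\<close>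
    moreover have "card \<sigma> \<noteq> 3" using \<sigma>(1) by (auto simp: card_insert_if split: if_splits)
    ultimately have "\<sigma> \<notin> (\<lambda>j. {va j, vb j, vc j}) ` J" "\<sigma> \<in> K" using card\<tau> by fastforce+
    then have "\<sigma> \<in> L" using bij by (auto simp: bij_betw_def)
    then show ?thesis using \<sigma>(2) by blast
  qed
  have pos: "0 < ?c ((j, s), t) v"
    if "j \<in> J" "s \<in> topspace (nsphere 1)" "0 \<le> t" "t < 1" "v \<in> {va j, vb j, vc j}" for j s t v
  proof -
    have "0 < bary k s t" if "k \<le> 2" for k
      using bary_ge[OF \<open>s \<in> topspace (nsphere 1)\<close> \<open>0 \<le> t\<close> that] \<open>t < 1\<close> by simp
    then show ?thesis using dist[OF that(1)] that(5) triangle_map_vertices[of va j vb vc s t] by auto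
  qed
  have not_in_L: "?c ((j, s), t) \<notin> closed_simplex \<sigma>"
    if "j \<in> J" "s \<in> topspace (nsphere 1)" "0 \<le> t" "t < 1" "\<sigma> \<in> L" for j s t \<sigma>
  proof
    assume "?c ((j, s), t) \<in> closed_simplex \<sigma>"
    then have "{va j, vb j, vc j} \<subseteq> \<sigma>"
      using pos[OF that(1-4)] by (fastforce simp: closed_simplex_def)
    then show False using L'(4)[OF that(5)] \<tau>(2)[OF that(1)] by blast
  qed
  have inj: "t = t' \<and> ((j, s) = (j', s') \<or> t = 0 \<and> j = j')"
    if j: "j \<in> J" "j' \<in> J" and s: "s \<in> topspace (nsphere 1)" "s' \<in> topspace (nsphere 1)"
      and t: "0 \<le> t" "t < 1" "0 \<le> t'" "t' < 1" and eq: "?c ((j, s), t) = ?c ((j', s'), t')" for j s t j' s' t'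
  proof -
    \<comment> \<open>The support recovers the triangle and, by bijectivity, its index.\<close>
    have supp: "{v. ?c ((j, s), t) v \<noteq> 0} = {va j, vb j, vc j}"
      if "j \<in> J" "s \<in> topspace (nsphere 1)" "0 \<le> t" "t < 1" for j s t
    proof -
      have "?c ((j, s), t) v = 0" if "v \<notin> {va j, vb j, vc j}" for v
        using that by (auto simp: triangle_map_def)
      then show ?thesis using pos[OF that] by fastforce
    qed
    have "{va j, vb j, vc j} = {va j', vb j', vc j'}"
      using supp[OF j(1) s(1) t(1,2)] supp[OF j(2) s(2) t(3,4)] eq by simp
    then have jj: "j = j'" using bij j by (auto simp: bij_betw_def inj_on_def)
    have "bary k s t = bary k s' t'" if "k \<le> 2" for k
    proof -
      have v: "va j \<noteq> vb j" "va j \<noteq> vc j" "vb j \<noteq> vc j" using dist[OF j(1)] by auto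
      have "k = 0 \<or> k = 1 \<or> k = 2" using that by linarith
      moreover have "bary 0 s t = bary 0 s' t'" "bary 1 s t = bary 1 s' t'" "bary 2 s t = bary 2 s' t'"
        using triangle_map_vertices[of va j vb vc s t] triangle_map_vertices[of va j vb vc s' t'] v eq[folded jj] by metis+
      ultimately show ?thesis by blast
    qed
    then have "t = t' \<and> (s = s' \<or> t = 0)" using bary_inj[OF s t(1,3)] by blast
    then show ?thesis using jj by auto
  qed
  have cont: "continuous_map (prod_topology ?A I01) (realize K) ?c"
  proof (rule continuous_map_discrete_prod_left)
    fix j assume j: "j \<in> J"
    show "continuous_map (prod_topology (nsphere 1) I01) (realize K) (\<lambda>q. ?c ((j, fst q), snd q))"
    proof (rule continuous_map_into_realization[OF K])
      show "continuous_map (prod_topology (nsphere 1) I01) euclideanreal (\<lambda>q. ?c ((j, fst q), snd q) u)" for u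
        using continuous_map_point_of[of "[(va j, \<lambda>q. bary 0 (fst q) (snd q)), (vb j, \<lambda>q. bary 1 (fst q) (snd q)),
            (vc j, \<lambda>q. bary 2 (fst q) (snd q))]" "prod_topology (nsphere 1) I01" u] continuous_map_bary
        by (simp add: triangle_map_def del: point_of_Cons One_nat_def)
      show "\<exists>\<sigma>\<in>K. ?c ((j, fst q), snd q) \<in> closed_simplex \<sigma>" if "q \<in> topspace (prod_topology (nsphere 1) I01)" for q
        using that \<tau>(1)[OF j] triangle_map_in[of "fst q" "snd q" va vb vc j] by auto
    qed
  qed
  have covers: "topspace (realize K) \<subseteq>
      id ` topspace (realize L) \<union> ?c ` (topspace ?A \<times> {0..1})"
  proof
    fix p assume "p \<in> topspace (realize K)"
    then obtain \<sigma> where \<sigma>: "\<sigma> \<in> K" "p \<in> closed_simplex \<sigma>" by auto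
    show "p \<in> id ` topspace (realize L) \<union> ?c ` (topspace ?A \<times> {0..1})"
    proof (cases "\<sigma> \<in> L")
      case True
      then show ?thesis using \<sigma> by auto
    next
      case False
      then obtain j where j: "j \<in> J" "\<sigma> = {va j, vb j, vc j}" using \<sigma>(1) bij by (auto simp: bij_betw_def)
      note v = dist[OF j(1)]
      have nn: "0 \<le> p u" for u using \<sigma>(2) by (simp add: closed_simplex_def)
      have "p (va j) + p (vb j) + p (vc j) = 1"
        using \<sigma>(2) v by (simp add: closed_simplex_def j(2) add.assoc)
      then obtain s t where st: "s \<in> topspace (nsphere 1)" "0 \<le> t" "t \<le> 1"
        "bary 0 s t = p (va j)" "bary 1 s t = p (vb j)" "bary 2 s t = p (vc j)"
        using bary_surj[OF nn nn nn] by metis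
      have "p = ?c ((j, s), t)"
      proof
        fix u show "p u = ?c ((j, s), t) u"
          using \<sigma>(2) v st by (auto simp: triangle_map_def closed_simplex_def j(2))
      qed
      then show ?thesis using st j by auto
    qed
  qed
  have contf: "continuous_map ?A (realize L) (\<lambda>a. ?c (a, 1))"
  proof (rule continuous_map_into_realization[OF L])
    have "continuous_map ?A (prod_topology ?A I01) (\<lambda>a. (a, 1))"
      by (intro continuous_map_pairedI) auto
    from continuous_map_comp[OF this cont]
    show "continuous_map ?A euclideanreal (\<lambda>a. ?c (a, 1) v)" for v
      by (rule continuous_map_from_realization_coordinate[OF K])
    show "\<exists>\<sigma>\<in>L. ?c (a, 1) \<in> closed_simplex \<sigma>" if "a \<in> topspace ?A" for a
      using boundary that by (cases a) auto
  qed
  have conte: "continuous_map (realize L) (realize K) id"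
    using LK by (intro continuous_map_into_realization[OF K]) (auto intro!: continuous_map_realization_coordinate[OF L])
  show ?thesis
  proof
    show "compact_space (realize L)" by (rule compact_space_realization[OF L])
    show "compact_space ?A"
      using J by (simp add: compact_space_prod_topology compact_space_nsphere compact_space_discrete_topology)
    show "Hausdorff_space (realize K)" by (rule Hausdorff_space_realization[OF K])
    show "?c (a, 0) = ?c (a', 0)" if "fst a = fst a'" for a a' :: "_ \<times> (nat \<Rightarrow> real)"
      using that by (cases a; cases a') (simp add: triangle_map_def bary_0)
    show "?c (a, t) \<noteq> id x" if "a \<in> topspace ?A" "0 \<le> t" "t < 1" "x \<in> topspace (realize L)" for a t x
      using that not_in_L by (cases a) auto
    show "t = t' \<and> (a = a' \<or> t = 0 \<and> fst a = fst a')"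
      if "a \<in> topspace ?A" "a' \<in> topspace ?A" "0 \<le> t" "t < 1" "0 \<le> t'" "t' < 1" "?c (a, t) = ?c (a', t')" for a t a' t'
      using that inj[of "fst a" "fst a'" "snd a" "snd a'" t t']
      by (simp add: mem_Times_iff prod_eq_iff del: One_nat_def) blast
  qed (use cont contf conte covers in \<open>simp_all\<close>)
qed

text \<open>The edge opposite to \<open>a\<^sub>k\<close> is pushed into the face \<open>{a\<^sub>i, a\<^sub>j, o\<^sub>k}\<close> and then, across the
  faces \<open>{a\<^sub>i, o\<^sub>j, o\<^sub>k}\<close>, to the triangle \<open>{o\<^sub>0, o\<^sub>1, o\<^sub>2}\<close>.\<close>

lemma octahedron_boundary_nullhomotopic:
  assumes L: "finite_complex L"
    and f: "{a1, a2, o0} \<in> L" "{a0, a2, o1} \<in> L" "{a0, a1, o2} \<in> L"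
      "{a0, o1, o2} \<in> L" "{a1, o0, o2} \<in> L" "{a2, o0, o1} \<in> L" "{o0, o1, o2} \<in> L"
  shows "homotopic_with (\<lambda>_. True) (nsphere 1) (realize L)
    (\<lambda>s. point_of [(a0, bary 0 s 1), (a1, bary 1 s 1), (a2, bary 2 s 1)]) (\<lambda>s. point_of [(o0, 1)])"
proof -
  \<comment> \<open>On the boundary one coordinate is 0, so only the \<open>w\<close> of the edge
    carrying the point can be nonzero. It is taken away from both ends of that edge, and twice its
    value goes to the \<open>o\<close> above the edge; the \<open>h\<close> are what remains at the
    \<open>a\<close>.\<close>
  define w01 w02 w12 where "w01 s = min (bary 0 s 1) (bary 1 s 1)"
    and "w02 s = min (bary 0 s 1) (bary 2 s 1)" and "w12 s = min (bary 1 s 1) (bary 2 s 1)" for s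
  define h0 h1 h2 where "h0 s = bary 0 s 1 - w01 s - w02 s" and "h1 s = bary 1 s 1 - w01 s - w12 s"
    and "h2 s = bary 2 s 1 - w02 s - w12 s" for s
  \<comment> \<open>\<open>G\<close> keeps the remaining weights at the \<open>a\<close>;
    \<open>H\<close> splits the weight left at each \<open>a\<close> evenly between the two
    \<open>o\<close> adjacent to it, that is, those with a different index.\<close>
  define F G H C where "F s = point_of [(a0, bary 0 s 1), (a1, bary 1 s 1), (a2, bary 2 s 1)]"
    and "G s = point_of [(a0, h0 s), (a1, h1 s), (a2, h2 s), (o0, 2 * w12 s), (o1, 2 * w02 s), (o2, 2 * w01 s)]"
    and "H s = point_of [(o0, 2 * w12 s + (h1 s + h2 s) / 2), (o1, 2 * w02 s + (h0 s + h2 s) / 2),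
      (o2, 2 * w01 s + (h0 s + h1 s) / 2)]"
    and "C s = point_of [(o0, 1)]" for s
  have bary_cont: "continuous_map (nsphere 1) euclideanreal (\<lambda>s. bary k s 1)" for k
  proof -
    have "continuous_map (nsphere 1) (prod_topology (nsphere 1) I01) (\<lambda>s. (s, 1))"
      by (intro continuous_map_pairedI) auto
    from continuous_map_comp[OF this continuous_map_bary] show ?thesis by simp
  qed
  have w_cont: "continuous_map (nsphere 1) euclideanreal w01" "continuous_map (nsphere 1) euclideanreal w02"
    "continuous_map (nsphere 1) euclideanreal w12"
    unfolding w01_def w02_def w12_def by (intro continuous_map_real_min bary_cont)+
  have h_cont: "continuous_map (nsphere 1) euclideanreal h0" "continuous_map (nsphere 1) euclideanreal h1"
    "continuous_map (nsphere 1) euclideanreal h2"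
    unfolding h0_def h1_def h2_def by (intro continuous_map_diff w_cont bary_cont)+
  have F_cont: "continuous_map (nsphere 1) euclideanreal (\<lambda>s. F s u)" for u
    using continuous_map_point_of[of "[(a0, \<lambda>s. bary 0 s 1), (a1, \<lambda>s. bary 1 s 1), (a2, \<lambda>s. bary 2 s 1)]" "nsphere 1" u]
      bary_cont by (simp add: F_def del: point_of_Cons One_nat_def)
  have G_cont: "continuous_map (nsphere 1) euclideanreal (\<lambda>s. G s u)" for u
    using continuous_map_point_of[of "[(a0, h0), (a1, h1), (a2, h2), (o0, \<lambda>s. 2 * w12 s), (o1, \<lambda>s. 2 * w02 s),
      (o2, \<lambda>s. 2 * w01 s)]" "nsphere 1" u] w_cont h_cont
    by (simp add: G_def continuous_map_real_mult del: point_of_Cons One_nat_def)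
  have H_cont: "continuous_map (nsphere 1) euclideanreal (\<lambda>s. H s u)" for u
    using continuous_map_point_of[of "[(o0, \<lambda>s. 2 * w12 s + (h1 s + h2 s) / 2), (o1, \<lambda>s. 2 * w02 s + (h0 s + h2 s) / 2),
      (o2, \<lambda>s. 2 * w01 s + (h0 s + h1 s) / 2)]" "nsphere 1" u] w_cont h_cont
    by (simp add: H_def continuous_map_real_mult continuous_map_add continuous_map_real_divide
        del: point_of_Cons One_nat_def)
  have C_cont: "continuous_map (nsphere 1) euclideanreal (\<lambda>s. C s u)" for u
    by (simp add: C_def)
  have faces: "(\<exists>\<sigma>\<in>L. F s \<in> closed_simplex \<sigma> \<and> G s \<in> closed_simplex \<sigma>) \<and>
      (\<exists>\<sigma>\<in>L. G s \<in> closed_simplex \<sigma> \<and> H s \<in> closed_simplex \<sigma>) \<and>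
      H s \<in> closed_simplex {o0, o1, o2} \<and> C s \<in> closed_simplex {o0, o1, o2}"
    if s: "s \<in> topspace (nsphere 1)" for s
  proof -
    have nn: "0 \<le> bary k s 1" if "k \<le> 2" for k
      using bary_ge[OF s zero_le_one that] by simp
    obtain k where kt: "k \<le> 2" "\<forall>t. bary k s t = (1 - t) / 3" using bary_attained[OF s] by blast
    then have "k \<le> 2" "bary k s 1 = 0" using kt(2)[rule_format, of 1] by simp_all
    then consider "bary 0 s 1 = 0" | "bary 1 s 1 = 0" | "bary 2 s 1 = 0"
      by (metis le_Suc_eq le_zero_eq numeral_2_eq_2 One_nat_def)
    note cases = this
    define x y z where "x = bary 0 s 1" and "y = bary 1 s 1" and "z = bary 2 s 1"
    have xyz: "0 \<le> x" "0 \<le> y" "0 \<le> z" "x + y + z = 1" "x = 0 \<or> y = 0 \<or> z = 0"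
      using nn bary_sum[of s 1] cases by (auto simp: x_def y_def z_def)
    note defs = w01_def w02_def w12_def h0_def h1_def h2_def
    have expand: "F s = point_of [(a0, x), (a1, y), (a2, z)]"
      "G s = point_of [(a0, x - min x y - min x z), (a1, y - min x y - min y z), (a2, z - min x z - min y z),
        (o0, 2 * min y z), (o1, 2 * min x z), (o2, 2 * min x y)]"
      "H s = point_of [(o0, 2 * min y z + ((y - min x y - min y z) + (z - min x z - min y z)) / 2),
        (o1, 2 * min x z + ((x - min x y - min x z) + (z - min x z - min y z)) / 2),
        (o2, 2 * min x y + ((x - min x y - min x z) + (y - min x y - min y z)) / 2)]"
      by (simp_all only: F_def G_def H_def defs x_def y_def z_def)
    have goal: ?thesis if "\<tau> \<in> L" "\<rho> \<in> L" "F s \<in> closed_simplex \<tau>" "G s \<in> closed_simplex \<tau>"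
      "G s \<in> closed_simplex \<rho>" "H s \<in> closed_simplex \<rho>" for \<tau> \<rho>
    proof -
      have "H s \<in> closed_simplex {o0, o1, o2}"
        unfolding expand by (rule point_of_in_closed_simplex) (use xyz in \<open>auto simp: min_def\<close>)
      moreover have "C s \<in> closed_simplex {o0, o1, o2}"
        unfolding C_def by (rule point_of_in_closed_simplex) auto
      ultimately show ?thesis using that by blast
    qed
    \<comment> \<open>The vanishing coordinate selects the face shared by \<open>F\<close> and
      \<open>G\<close>. The smaller of the other two weights is used up, so \<open>G\<close> keeps a
      single \<open>a\<close>, which selects the face shared by \<open>G\<close> and
      \<open>H\<close>.\<close>
    consider "x = 0" "y \<le> z" | "x = 0" "z \<le> y" | "y = 0" "x \<le> z" | "y = 0" "z \<le> x"
      | "z = 0" "x \<le> y" | "z = 0" "y \<le> x" using xyz(5) by linarith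
    then show ?thesis
    proof cases
      case 1
      show ?thesis
        unfolding expand
        by (rule goal[OF f(1) f(6), unfolded expand]; rule point_of_in_closed_simplex)
           (use 1 xyz in \<open>auto simp: min_def\<close>)
    next
      case 2
      show ?thesis
        unfolding expand
        by (rule goal[OF f(1) f(5), unfolded expand]; rule point_of_in_closed_simplex)
           (use 2 xyz in \<open>auto simp: min_def field_simps\<close>)
    next
      case 3
      show ?thesis
        unfolding expand
        by (rule goal[OF f(2) f(6), unfolded expand]; rule point_of_in_closed_simplex)
           (use 3 xyz in \<open>auto simp: min_def field_simps\<close>)
    next
      case 4
      show ?thesis
        unfolding expand
        by (rule goal[OF f(2) f(4), unfolded expand]; rule point_of_in_closed_simplex)
           (use 4 xyz in \<open>auto simp: min_def field_simps\<close>)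
    next
      case 5
      show ?thesis
        unfolding expand
        by (rule goal[OF f(3) f(5), unfolded expand]; rule point_of_in_closed_simplex)
           (use 5 xyz in \<open>auto simp: min_def field_simps\<close>)
    next
      case 6
      show ?thesis
        unfolding expand
        by (rule goal[OF f(3) f(4), unfolded expand]; rule point_of_in_closed_simplex)
           (use 6 xyz in \<open>auto simp: min_def field_simps\<close>)
    qed
  qed
  have into: "continuous_map (nsphere 1) (realize L) F"
    "continuous_map (nsphere 1) (realize L) G"
    "continuous_map (nsphere 1) (realize L) H"
    "continuous_map (nsphere 1) (realize L) C"
    using faces f(7)
    by (intro continuous_map_into_realization[OF L] F_cont G_cont H_cont C_cont; blast)+
  have "homotopic_with (\<lambda>_. True) (nsphere 1) (realize L) F G"
    "homotopic_with (\<lambda>_. True) (nsphere 1) (realize L) G H"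
    "homotopic_with (\<lambda>_. True) (nsphere 1) (realize L) H C"
    using faces f(7) by (intro contiguous_imp_homotopic[OF L] into; blast)+
  then have "homotopic_with (\<lambda>_. True) (nsphere 1) (realize L) F C"
    using homotopic_with_trans by blast
  then show ?thesis by (simp add: F_def[abs_def] C_def[abs_def] del: point_of_Cons)
qed

section \<open>Wedge sums of spheres\<close>

lemma continuous_map_collapse_map: "continuous_map X (collapse X A) (collapse_map A)"
  by (auto simp: continuous_map_def openin_collapse)

text \<open>The condition on \<open>None\<close> has content when \<open>A\<close> misses the space:
  then \<open>None\<close> is an added point outside the image of \<open>collapse_map\<close>, as in
  the wedge of an empty family.\<close>

lemma continuous_map_from_collapse:
  assumes "continuous_map X V (\<lambda>x. g (collapse_map A x))" "g None \<in> topspace V"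
  shows "continuous_map (collapse X A) V g"
  unfolding continuous_map_def
proof (intro conjI allI impI)
  show "g \<in> topspace (collapse X A) \<rightarrow> topspace V"
    using assms by (auto simp: continuous_map_def Pi_iff)
  fix U assume U: "openin V U"
  have "openin X {x \<in> topspace X. g (collapse_map A x) \<in> U}"
    using assms(1) U by (simp add: continuous_map_def)
  moreover have "{x \<in> topspace X. collapse_map A x \<in> {y \<in> topspace (collapse X A). g y \<in> U}} =
      {x \<in> topspace X. g (collapse_map A x) \<in> U}"
    by auto
  ultimately show "openin (collapse X A) {y \<in> topspace (collapse X A). g y \<in> U}"
    unfolding openin_collapse by (auto simp only: topspace_collapse)
qed

lemma continuous_map_from_sum_topology:
  assumes "\<And>i. i \<in> I \<Longrightarrow> continuous_map (X i) V (\<lambda>x. g (i, x))"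
  shows "continuous_map (sum_topology X I) V g"
  unfolding continuous_map_def
proof (intro conjI allI impI)
  show "g \<in> topspace (sum_topology X I) \<rightarrow> topspace V"
    using assms by (auto simp: continuous_map_def Pi_iff)
  fix U assume U: "openin V U"
  have "openin (X i) {x. (i, x) \<in> {p \<in> topspace (sum_topology X I). g p \<in> U}}" if "i \<in> I" for i
    using assms[OF that] U that by (simp add: continuous_map_def)
  then show "openin (sum_topology X I) {p \<in> topspace (sum_topology X I). g p \<in> U}"
    unfolding openin_sum_topology by auto
qed

lemma continuous_map_from_binary_sum:
  assumes "continuous_map X V (\<lambda>x. g (Inl x))" "continuous_map Y V (\<lambda>y. g (Inr y))"
  shows "continuous_map (binary_sum_topology X Y) V g"
  unfolding continuous_map_def
proof (intro conjI allI impI)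
  show "g \<in> topspace (binary_sum_topology X Y) \<rightarrow> topspace V"
    using assms by (auto simp: continuous_map_def Pi_iff)
  fix U assume U: "openin V U"
  have "Inl -` {p \<in> topspace (binary_sum_topology X Y). g p \<in> U} = {x \<in> topspace X. g (Inl x) \<in> U}"
    "Inr -` {p \<in> topspace (binary_sum_topology X Y). g p \<in> U} = {y \<in> topspace Y. g (Inr y) \<in> U}"
    by auto
  then show "openin (binary_sum_topology X Y) {p \<in> topspace (binary_sum_topology X Y). g p \<in> U}"
    using assms U unfolding openin_binary_sum_topology by (auto simp: continuous_map_def)
qed

lemma continuous_map_Inl: "continuous_map X (binary_sum_topology X Y) Inl"
  and continuous_map_Inr: "continuous_map Y (binary_sum_topology X Y) Inr"
proof -
  have "{x \<in> topspace X. Inl x \<in> U} = Inl -` U" "{y \<in> topspace Y. Inr y \<in> U} = Inr -` U"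
    if "openin (binary_sum_topology X Y) U" for U
    using that by (auto simp: openin_binary_sum_topology)
  then show "continuous_map X (binary_sum_topology X Y) Inl" "continuous_map Y (binary_sum_topology X Y) Inr"
    by (auto simp: continuous_map_def openin_binary_sum_topology)
qed

text \<open>Each sphere is translated so that its base point is the origin and is given its own
  block of coordinates. This maps the wedge injectively and continuously into a product of real
  lines, from which it inherits the Hausdorff property.\<close>

definition sphere_coords :: "('i \<times> (nat \<Rightarrow> real)) option \<Rightarrow> 'i \<Rightarrow> nat \<Rightarrow> real" where
  "sphere_coords p j k = (case p of None \<Rightarrow> 0 | Some (i, x) \<Rightarrow> if j = i then x k - sphere_base k else 0)"

definition coord_space :: "('i \<Rightarrow> nat \<Rightarrow> real) topology" where
  "coord_space = product_topology (\<lambda>_. powertop_real UNIV) UNIV"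

lemma Hausdorff_coord_space: "Hausdorff_space coord_space"
  by (simp add: coord_space_def Hausdorff_space_product_topology)

lemma topspace_coord_space [simp]: "topspace coord_space = UNIV"
  by (auto simp: coord_space_def)

definition base_points :: "'i set \<Rightarrow> ('i \<times> (nat \<Rightarrow> real)) set" where
  "base_points I = (\<lambda>i. (i, sphere_base)) ` I"

lemma wedge_spheres_eq: "wedge_spheres I d = collapse (sum_topology (\<lambda>i. nsphere (d i)) I) (base_points I)"
  by (simp add: wedge_spheres_def Wedge_def base_points_def)

lemma topspace_wedge_spheres:
  "p \<in> topspace (wedge_spheres I d) \<longleftrightarrow>
    p = None \<or> (\<exists>i x. p = Some (i, x) \<and> i \<in> I \<and> x \<in> topspace (nsphere (d i)) \<and> x \<noteq> sphere_base)"
  by (auto simp: wedge_spheres_eq base_points_def collapse_map_def image_iff)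

lemma continuous_map_sphere_inclusion:
  assumes "i \<in> I"
  shows "continuous_map (nsphere (d i)) (wedge_spheres I d) (\<lambda>x. collapse_map (base_points I) (i, x))"
  unfolding wedge_spheres_eq
  by (rule continuous_map_comp[OF continuous_map_component_injection continuous_map_collapse_map]) (rule assms)

lemma continuous_map_from_wedge_spheres:
  assumes "\<And>i. i \<in> I \<Longrightarrow> continuous_map (nsphere (d i)) V (\<lambda>x. g (collapse_map (base_points I) (i, x)))"
    and "g None \<in> topspace V"
  shows "continuous_map (wedge_spheres I d) V g"
  unfolding wedge_spheres_eq
  by (intro continuous_map_from_collapse continuous_map_from_sum_topology assms)

lemma continuous_map_sphere_coords: "continuous_map (wedge_spheres I d) coord_space sphere_coords"
proof (rule continuous_map_from_wedge_spheres)
  fix i assume "i \<in> I"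
  then have "sphere_coords (collapse_map (base_points I) (i, x)) j k = (if j = i then x k - sphere_base k else 0)"
    for x j k
    by (auto simp: sphere_coords_def collapse_map_def base_points_def)
  moreover have "continuous_map (nsphere (d i)) euclideanreal (\<lambda>x. if j = i then x k - sphere_base k else 0)" for j k
    by (cases "j = i") (auto intro!: continuous_map_diff continuous_map_nsphere_projection)
  ultimately show "continuous_map (nsphere (d i)) coord_space (\<lambda>x. sphere_coords (collapse_map (base_points I) (i, x)))"
    by (simp add: coord_space_def continuous_map_componentwise_UNIV)
qed simp

lemma inj_on_sphere_coords: "inj_on sphere_coords (topspace (wedge_spheres I d))"
proof (rule inj_onI)
  have ne: "\<exists>k. x k \<noteq> sphere_base k" if "x \<noteq> sphere_base" for x using that by auto
  fix p q assume pq: "p \<in> topspace (wedge_spheres I d)" "q \<in> topspace (wedge_spheres I d)"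
    "sphere_coords p = sphere_coords q"
  then have eq: "sphere_coords p j k = sphere_coords q j k" for j k by simp
  show "p = q"
  proof (cases p)
    case None
    show ?thesis
    proof (cases q)
      case (Some r)
      then obtain i x where q: "q = Some (i, x)" "x \<noteq> sphere_base" using pq(2) by (auto simp: topspace_wedge_spheres)
      then obtain k where "x k \<noteq> sphere_base k" using ne by blast
      then show ?thesis using eq[of i k] None q by (simp add: sphere_coords_def)
    qed (use None in simp)
  next
    case (Some r)
    then obtain i x where p: "p = Some (i, x)" "x \<noteq> sphere_base" using pq(1) by (auto simp: topspace_wedge_spheres)
    then obtain k where k: "x k \<noteq> sphere_base k" using ne by blast
    have "sphere_coords q i k \<noteq> 0" using eq[of i k] p k by (simp add: sphere_coords_def)
    then obtain y where q: "q = Some (i, y)"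
      by (auto simp: sphere_coords_def split: option.splits prod.splits if_splits)
    have "x = y"
    proof
      fix l show "x l = y l" using eq[of i l] p q by (simp add: sphere_coords_def)
    qed
    then show ?thesis using p q by simp
  qed
qed

lemma Hausdorff_wedge_spheres: "Hausdorff_space (wedge_spheres I d)"
  using Hausdorff_space_injective_preimage[OF Hausdorff_coord_space continuous_map_sphere_coords inj_on_sphere_coords] .

lemma compact_wedge_spheres:
  assumes "finite I"
  shows "compact_space (wedge_spheres I d)"
proof -
  let ?Y = "wedge_spheres I d"
  have "compactin ?Y ((\<lambda>x. collapse_map (base_points I) (i, x)) ` topspace (nsphere (d i)))" if "i \<in> I" for i
    using continuous_map_sphere_inclusion[OF that] compact_space_nsphere
    by (intro image_compactin) (auto simp: compact_space_def)
  then have "compactin ?Y (\<Union>i\<in>I. (\<lambda>x. collapse_map (base_points I) (i, x)) ` topspace (nsphere (d i)))"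
    using assms by (intro compactin_Union) auto
  \<comment> \<open>For empty \<open>I\<close> this point is the whole space.\<close>
  moreover have "compactin ?Y {None}"
    by (simp add: topspace_wedge_spheres)
  ultimately have "compactin ?Y ({None} \<union> (\<Union>i\<in>I. (\<lambda>x. collapse_map (base_points I) (i, x)) ` topspace (nsphere (d i))))"
    by (intro compactin_Un)
  moreover have "{None} \<union> (\<Union>i\<in>I. (\<lambda>x. collapse_map (base_points I) (i, x)) ` topspace (nsphere (d i))) = topspace ?Y"
    by (fastforce simp: wedge_spheres_eq)
  ultimately show ?thesis by (simp add: compact_space_def)
qed

text \<open>The 2-sphere as a cone over the circle whose boundary is pinched to the base point.\<close>

definition pinch :: "(nat \<Rightarrow> real) \<Rightarrow> real \<Rightarrow> nat \<Rightarrow> real" where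
  "pinch s t i = (if i = 0 then 2 * t - 1 else if i \<le> 2 then 2 * sqrt (t * (1 - t)) * s (i - 1) else 0)"

text \<open>With height \<open>2 * t - 1\<close> along the axis through the base point, the parallel
  circle has radius \<open>2 * sqrt (t * (1 - t))\<close>, because the two squares add up to
  1.\<close>

lemma pinch_in:
  assumes "s \<in> topspace (nsphere 1)" "0 \<le> t" "t \<le> 1"
  shows "pinch s t \<in> topspace (nsphere 2)"
proof -
  define R where "R = sqrt (t * (1 - t))"
  have R: "R\<^sup>2 = t * (1 - t)" using assms by (simp add: R_def)
  have "pinch s t 0 = 2 * t - 1" "pinch s t 1 = 2 * R * s 0" "pinch s t 2 = 2 * R * s 1"
    by (simp_all add: pinch_def R_def)
  then have "(pinch s t 0)\<^sup>2 + (pinch s t 1)\<^sup>2 + (pinch s t 2)\<^sup>2 =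
      (2 * t - 1)\<^sup>2 + 4 * R\<^sup>2 * ((s 0)\<^sup>2 + (s 1)\<^sup>2)"
    by (simp add: power_mult_distrib ring_distribs)
  also have "\<dots> = (2 * t - 1)\<^sup>2 + 4 * (t * (1 - t))"
    using assms(1) R by (simp add: in_nsphere_Suc_0)
  also have "\<dots> = 1" by (simp add: power2_eq_square algebra_simps)
  finally show ?thesis by (simp add: in_nsphere_2 pinch_def)
qed

lemma pinch_1: "pinch s 1 = sphere_base"
  by (auto simp: pinch_def sphere_base_def)

lemma pinch_0: "pinch s 0 = pinch s' 0"
  by (auto simp: pinch_def)

lemma pinch_ne_base: "t < 1 \<Longrightarrow> pinch s t \<noteq> sphere_base"
  by (auto simp: pinch_def sphere_base_def fun_eq_iff intro!: exI[of _ 0])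

lemma pinch_inj:
  assumes s: "s \<in> topspace (nsphere 1)" "s' \<in> topspace (nsphere 1)"
    and t: "0 \<le> t" "t < 1" and eq: "pinch s t = pinch s' t'"
  shows "t = t' \<and> (s = s' \<or> t = 0)"
proof -
  have e: "pinch s t i = pinch s' t' i" for i using eq by simp
  have tt: "t = t'" using e[of 0] by (simp add: pinch_def)
  moreover have "s = s'" if "t \<noteq> 0"
  proof
    have "t * (1 - t) \<noteq> 0" using that t by simp
    then have "s 0 = s' 0" "s 1 = s' 1"
      using e[of 1] e[of 2] tt by (simp_all add: pinch_def)
    then show "s i = s' i" for i
      using s by (cases "i > 1") (auto simp: in_nsphere_Suc_0 not_less le_Suc_eq)
  qed
  ultimately show ?thesis by blast
qed

lemma pinch_surj:
  assumes x: "x \<in> topspace (nsphere 2)"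
  obtains s t where "s \<in> topspace (nsphere 1)" "0 \<le> t" "t \<le> 1" "x = pinch s t"
proof -
  have sq: "(x 0)\<^sup>2 + (x 1)\<^sup>2 + (x 2)\<^sup>2 = 1" and z: "\<And>i. i > 2 \<Longrightarrow> x i = 0"
    using x by (auto simp: in_nsphere_2)
  define t where "t = (x 0 + 1) / 2"
  have "(x 0)\<^sup>2 \<le> 1" using sq by (smt (verit) zero_le_power2)
  then have t: "0 \<le> t" "t \<le> 1" by (simp_all add: t_def abs_square_le_1 abs_le_iff)
  define n where "n = 2 * sqrt (t * (1 - t))"
  have "n\<^sup>2 = 4 * (t * (1 - t))" using t by (simp add: n_def power_mult_distrib)
  also have "\<dots> = 1 - (x 0)\<^sup>2" by (simp add: t_def power2_eq_square field_simps)
  finally have n2: "n\<^sup>2 = (x 1)\<^sup>2 + (x 2)\<^sup>2" using sq by simp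
  have small: "i = 0 \<or> i = 1 \<or> i = 2 \<or> i > 2" for i :: nat by auto
  show thesis
  proof (cases "n = 0")
    case True
    then have x0: "x 1 = 0" "x 2 = 0" using n2 by (auto simp: sum_power2_eq_zero_iff)
    \<comment> \<open>Radius 0 means one of the two poles, where any direction on the circle
      serves.\<close>
    have "x = pinch sphere_base t"
    proof
      fix i show "x i = pinch sphere_base t i"
        using small[of i] x0 z True by (auto simp: pinch_def t_def[symmetric] n_def) (simp_all add: t_def)
    qed
    then show thesis using that[OF sphere_base_in_nsphere t] by blast
  next
    case False
    define s :: "nat \<Rightarrow> real" where "s = (\<lambda>i. if i = 0 then x 1 / n else if i = 1 then x 2 / n else 0)"
    have s: "s \<in> topspace (nsphere 1)"
    proof -
      have "(x 1 / n)\<^sup>2 + (x 2 / n)\<^sup>2 = ((x 1)\<^sup>2 + (x 2)\<^sup>2) / n\<^sup>2"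
        by (simp add: power_divide add_divide_distrib)
      also have "\<dots> = 1" unfolding n2[symmetric] using False by simp
      finally show ?thesis by (simp add: in_nsphere_Suc_0 s_def)
    qed
    have "x = pinch s t"
    proof
      fix i show "x i = pinch s t i"
        using small[of i] z False unfolding pinch_def n_def[symmetric] by (auto simp: s_def t_def add_divide_distrib)
    qed
    then show thesis using that[OF s t] by blast
  qed
qed

lemma continuous_map_pinch:
  "continuous_map (prod_topology (nsphere 1) I01) (nsphere 2) (\<lambda>q. pinch (fst q) (snd q))"
proof -
  have t: "continuous_map (prod_topology (nsphere 1) I01) euclideanreal (\<lambda>q. snd q)"
    using continuous_map_snd_eta continuous_map_into_fulltopology by blast
  have s: "continuous_map (prod_topology (nsphere 1) I01) euclideanreal (\<lambda>q. fst q k)" for k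
    by (rule continuous_map_comp[OF continuous_map_fst_eta continuous_map_nsphere_projection])
  have "continuous_map (prod_topology (nsphere 1) I01) euclideanreal (\<lambda>q. pinch (fst q) (snd q) i)" for i
    unfolding pinch_def
    by (cases "i = 0"; cases "i \<le> 2")
       (auto simp del: One_nat_def intro!: continuous_map_diff continuous_map_real_mult continuous_map_sqrt s t)
  then show ?thesis
    using pinch_in
    by (auto simp: nsphere continuous_map_in_subtopology continuous_map_componentwise_UNIV)
qed

lemma compact_circles:
  "finite J \<Longrightarrow> compact_space (prod_topology (discrete_topology J) (nsphere 1))"
  by (simp add: compact_space_prod_topology compact_space_nsphere compact_space_discrete_topology)

text \<open>A cone over a circle whose base is glued to the single point \<open>b\<close> is a
  2-sphere touching \<open>X\<close> at \<open>b\<close>.\<close>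

lemma wedge_cone_attachment:
  assumes X: "compact_space X" "Hausdorff_space X" and b: "b \<in> topspace X" and J: "finite J"
  shows "cone_attachment X (prod_topology (discrete_topology J) (nsphere 1)) fst (\<lambda>_. b)
    (wedge (wedge_spheres J (\<lambda>_. 2)) None X b) (\<lambda>x. collapse_map {Inl None, Inr b} (Inr x))
    (\<lambda>p. collapse_map {Inl None, Inr b} (Inl (collapse_map (base_points J)
      (fst (fst p), pinch (snd (fst p)) (snd p)))))"
proof -
  let ?W = "wedge_spheres J (\<lambda>_. 2)"
  let ?Y = "wedge ?W None X b" and ?q = "collapse_map {Inl None, Inr b}"
  let ?A = "prod_topology (discrete_topology J) (nsphere 1)"
  let ?c = "\<lambda>p. ?q (Inl (collapse_map (base_points J) (fst (fst p), pinch (snd (fst p)) (snd p))))"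
  have qL: "continuous_map ?W ?Y (\<lambda>x. ?q (Inl x))"
    unfolding wedge_def by (rule continuous_map_comp[OF continuous_map_Inl continuous_map_collapse_map])
  have qR: "continuous_map X ?Y (\<lambda>x. ?q (Inr x))"
    unfolding wedge_def by (rule continuous_map_comp[OF continuous_map_Inr continuous_map_collapse_map])
  have cW: "collapse_map (base_points J) (j, pinch s t) = Some (j, pinch s t)"
    if "j \<in> J" "t < 1" for j s t
    using that pinch_ne_base[of t s] by (auto simp: collapse_map_def base_points_def)
  have cW1: "collapse_map (base_points J) (j, sphere_base) = None" if "j \<in> J" for j
    using that by (auto simp: collapse_map_def base_points_def)
  have Hd: "Hausdorff_space ?Y"
  proof -
    \<comment> \<open>The wedge is laid out along two axes of a product, the spheres over
      \<open>b\<close> and \<open>X\<close> over the image of \<open>None\<close>. The axes meet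
      only in the base point, so this continuous map is injective and transfers the Hausdorff
      property.\<close>
    define E where "E = (\<lambda>w. case w of None \<Rightarrow> (sphere_coords None, b)
      | Some (Inl p) \<Rightarrow> (sphere_coords p, b) | Some (Inr x) \<Rightarrow> (sphere_coords (None :: ('b \<times> (nat \<Rightarrow> real)) option), x))"
    have EL: "E (?q (Inl p)) = (sphere_coords p, b)" and ER: "E (?q (Inr x)) = (sphere_coords None, x)" for p x
      by (auto simp: E_def collapse_map_def)
    have "continuous_map ?Y (prod_topology coord_space X) E"
      unfolding wedge_def
    proof (rule continuous_map_from_collapse[OF continuous_map_from_binary_sum])
      show "continuous_map ?W (prod_topology coord_space X) (\<lambda>x. E (?q (Inl x)))"
        unfolding EL using b by (intro continuous_map_pairedI continuous_map_sphere_coords) auto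
      show "continuous_map X (prod_topology coord_space X) (\<lambda>x. E (?q (Inr x)))"
        unfolding ER by (intro continuous_map_pairedI) auto
      show "E None \<in> topspace (prod_topology coord_space X)"
        using b by (simp add: E_def)
    qed
    moreover have "inj_on E (topspace ?Y)"
    proof (rule inj_onI)
      fix u v assume uv: "u \<in> topspace ?Y" "v \<in> topspace ?Y" "E u = E v"
      have cases: "(\<exists>p\<in>topspace ?W. w = ?q (Inl p)) \<or> (\<exists>x\<in>topspace X. w = ?q (Inr x))" if "w \<in> topspace ?Y" for w
      proof -
        have "None = ?q (Inr b)" by (simp add: collapse_map_def)
        then show ?thesis using that b by (auto simp: wedge_def)
      qed
      have None: "None \<in> topspace ?W" by (simp add: topspace_wedge_spheres)
      have inj: "p = p'" if "sphere_coords p = sphere_coords p'" "p \<in> topspace ?W" "p' \<in> topspace ?W" for p p'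
        using inj_on_sphere_coords that by (auto dest: inj_onD)
      have LR: "?q (Inl p) = ?q (Inr x)" if "p \<in> topspace ?W" "E (?q (Inl p)) = E (?q (Inr x))" for p x
      proof -
        have "p = None" "x = b" using that inj[OF _ that(1) None] by (auto simp: EL ER)
        then show ?thesis by (simp add: collapse_map_def)
      qed
      from cases[OF uv(1)] show "u = v"
      proof (elim disjE bexE)
        fix p assume p: "p \<in> topspace ?W" "u = ?q (Inl p)"
        from cases[OF uv(2)] show ?thesis
        proof (elim disjE bexE)
          fix p' assume "p' \<in> topspace ?W" "v = ?q (Inl p')"
          then show ?thesis using p uv(3) inj[of p p'] by (simp add: EL)
        next
          fix x assume "v = ?q (Inr x)"
          then show ?thesis using p uv(3) LR[of p x] by simp
        qed
      next
        fix x assume x: "u = ?q (Inr x)"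
        from cases[OF uv(2)] show ?thesis
        proof (elim disjE bexE)
          fix p assume "p \<in> topspace ?W" "v = ?q (Inl p)"
          then show ?thesis using x uv(3) LR[of p x] by simp
        next
          fix x' assume "v = ?q (Inr x')"
          then show ?thesis using x uv(3) by (simp add: ER)
        qed
      qed
    qed
    ultimately show ?thesis
      using Hausdorff_coord_space X(2)
      by (intro Hausdorff_space_injective_preimage[of "prod_topology coord_space X" ?Y E])
         (auto simp: Hausdorff_space_prod_topology)
  qed
  show ?thesis
  proof
    show "compact_space X" by (rule X)
    show "compact_space ?A" by (rule compact_circles[OF J])
    show "Hausdorff_space ?Y" by (rule Hd)
    show "continuous_map ?A X (\<lambda>_. b)" using b by simp
    show "continuous_map X ?Y (\<lambda>x. ?q (Inr x))" by (rule qR)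
    show "continuous_map (prod_topology ?A I01) ?Y ?c"
    proof (rule continuous_map_discrete_prod_left)
      fix j assume "j \<in> J"
      from continuous_map_comp[OF continuous_map_comp[OF continuous_map_pinch continuous_map_sphere_inclusion[OF this]] qL]
      show "continuous_map (prod_topology (nsphere 1) I01) ?Y (\<lambda>q. ?c ((j, fst q), snd q))" by simp
    qed
    show "inj_on (\<lambda>x. ?q (Inr x)) (topspace X)"
      by (auto simp: inj_on_def collapse_map_def split: if_splits)
    show "?c (a, 1) = ?q (Inr b)" if "a \<in> topspace ?A" for a
      using that cW1 by (auto simp: pinch_1 collapse_map_def[of "{_, _}"])
    show "?c (a, 0) = ?c (a', 0)" if "fst a = fst a'" for a a'
      using that pinch_0[of "snd a" "snd a'"] by simp
    show "?c (a, t) \<noteq> ?q (Inr x)" if "a \<in> topspace ?A" "t < 1" for a t x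
      using that cW by (auto simp: collapse_map_def[of "{_, _}"])
    show "t = t' \<and> (a = a' \<or> t = 0 \<and> fst a = fst a')"
      if "a \<in> topspace ?A" "a' \<in> topspace ?A" "0 \<le> t" "t < 1" "0 \<le> t'" "t' < 1" "?c (a, t) = ?c (a', t')" for a t a' t'
    proof -
      have j: "fst a \<in> J" "fst a' \<in> J" and s: "snd a \<in> topspace (nsphere 1)" "snd a' \<in> topspace (nsphere 1)"
        using that by (auto simp: mem_Times_iff)
      from that(7) have "fst a = fst a' \<and> pinch (snd a) t = pinch (snd a') t'"
        unfolding fst_conv snd_conv cW[OF j(1) that(4)] cW[OF j(2) that(6)] by (simp add: collapse_map_def)
      then show ?thesis using pinch_inj[OF s that(3,4)] by (auto simp: prod_eq_iff)
    qed
    show "topspace ?Y \<subseteq> (\<lambda>x. ?q (Inr x)) ` topspace X \<union> ?c ` (topspace ?A \<times> {0..1})"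
    proof
      fix w assume "w \<in> topspace ?Y"
      then have "w = None \<or> (\<exists>p\<in>topspace ?W. w = ?q (Inl p)) \<or> (\<exists>x\<in>topspace X. w = ?q (Inr x))"
        by (auto simp: wedge_def)
      moreover have N: "?q (Inl None) = ?q (Inr b)" "None = ?q (Inr b)" by (simp_all add: collapse_map_def)
      ultimately consider x where "x \<in> topspace X" "w = ?q (Inr x)"
        | p where "p \<in> topspace ?W" "p \<noteq> None" "w = ?q (Inl p)"
        using b by metis
      then show "w \<in> (\<lambda>x. ?q (Inr x)) ` topspace X \<union> ?c ` (topspace ?A \<times> {0..1})"
      proof cases
        case 2
        then obtain j y where p: "p = Some (j, y)" "j \<in> J" "y \<in> topspace (nsphere 2)" "y \<noteq> sphere_base"
          by (auto simp: topspace_wedge_spheres)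
        obtain s t where st: "s \<in> topspace (nsphere 1)" "0 \<le> t" "t \<le> 1" "y = pinch s t"
          using pinch_surj[OF p(3)] .
        then have "t < 1" using p(4) pinch_1[of s] by (cases "t = 1") auto
        then have "w = ?c ((j, s), t)" using 2 p st cW by simp
        then show ?thesis using st p by (intro UnI2 image_eqI[of _ _ "((j, s), t)"]) auto
      qed auto
    qed
  qed
qed

text \<open>The same attachment for a base that is itself a wedge of spheres, arranged so that the
  result is again of the form \<open>wedge_spheres\<close> and the induction on the size of the sets
  can continue.\<close>

lemma wedge_spheres_cone_attachment:
  assumes I: "finite I" and J: "finite J" and disj: "I \<inter> J = {}"
  shows "cone_attachment (wedge_spheres I d) (prod_topology (discrete_topology J) (nsphere 1)) fst (\<lambda>_. None)
    (wedge_spheres (I \<union> J) (\<lambda>i. if i \<in> J then 2 else d i)) id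
    (\<lambda>p. collapse_map (base_points (I \<union> J)) (fst (fst p), pinch (snd (fst p)) (snd p)))"
proof -
  let ?d = "\<lambda>i. if i \<in> J then 2 else d i"
  let ?X = "wedge_spheres I d" and ?Y = "wedge_spheres (I \<union> J) ?d" and ?q = "collapse_map (base_points (I \<union> J))"
  let ?A = "prod_topology (discrete_topology J) (nsphere 1)"
  let ?c = "\<lambda>p. ?q (fst (fst p), pinch (snd (fst p)) (snd p))"
  have cW: "?q (j, pinch s t) = Some (j, pinch s t)" if "t < 1" for j s t
    using that pinch_ne_base[of t s] by (auto simp: collapse_map_def base_points_def)
  show ?thesis
  proof
    show "compact_space ?X" by (rule compact_wedge_spheres[OF I])
    show "compact_space ?A" by (rule compact_circles[OF J])
    show "Hausdorff_space ?Y" by (rule Hausdorff_wedge_spheres)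
    show "continuous_map ?A ?X (\<lambda>_. None)" by (simp add: topspace_wedge_spheres)
    show "continuous_map ?X ?Y id"
    proof (rule continuous_map_from_wedge_spheres)
      fix i assume i: "i \<in> I"
      then have "i \<notin> J" using disj by blast
      then have "continuous_map (nsphere (d i)) ?Y (\<lambda>x. ?q (i, x))"
        using continuous_map_sphere_inclusion[of i "I \<union> J" ?d] i by simp
      moreover have "?q (i, x) = id (collapse_map (base_points I) (i, x))" for x
        using i by (auto simp: collapse_map_def base_points_def)
      ultimately show "continuous_map (nsphere (d i)) ?Y (\<lambda>x. id (collapse_map (base_points I) (i, x)))"
        by (rule continuous_map_eq)
    qed (simp add: topspace_wedge_spheres)
    show "continuous_map (prod_topology ?A I01) ?Y ?c"
    proof (rule continuous_map_discrete_prod_left)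
      fix j assume "j \<in> J"
      then have "continuous_map (nsphere 2) ?Y (\<lambda>x. ?q (j, x))"
        using continuous_map_sphere_inclusion[of j "I \<union> J" ?d] by simp
      from continuous_map_comp[OF continuous_map_pinch this]
      show "continuous_map (prod_topology (nsphere 1) I01) ?Y (\<lambda>q. ?c ((j, fst q), snd q))" by simp
    qed
    show "inj_on id (topspace ?X)" by simp
    show "?c (a, 1) = id None" if "a \<in> topspace ?A" for a
      using that by (auto simp: pinch_1 collapse_map_def base_points_def)
    show "?c (a, 0) = ?c (a', 0)" if "fst a = fst a'" for a a'
      using that pinch_0[of "snd a" "snd a'"] by simp
    show "?c (a, t) \<noteq> id x" if "a \<in> topspace ?A" "t < 1" "x \<in> topspace ?X" for a t x
      using that disj cW by (auto simp: topspace_wedge_spheres)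
    show "t = t' \<and> (a = a' \<or> t = 0 \<and> fst a = fst a')"
      if "a \<in> topspace ?A" "a' \<in> topspace ?A" "0 \<le> t" "t < 1" "0 \<le> t'" "t' < 1" "?c (a, t) = ?c (a', t')" for a t a' t'
    proof -
      have s: "snd a \<in> topspace (nsphere 1)" "snd a' \<in> topspace (nsphere 1)"
        using that by (auto simp: mem_Times_iff)
      have "fst a = fst a' \<and> pinch (snd a) t = pinch (snd a') t'"
        using that(4,6,7) by (simp add: cW)
      then show ?thesis using pinch_inj[OF s that(3,4)] by (auto simp: prod_eq_iff)
    qed
    show "topspace ?Y \<subseteq> id ` topspace ?X \<union> ?c ` (topspace ?A \<times> {0..1})"
    proof
      fix w assume w: "w \<in> topspace ?Y"
      show "w \<in> id ` topspace ?X \<union> ?c ` (topspace ?A \<times> {0..1})"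
      proof (cases "w \<in> topspace ?X")
        case False
        then obtain j y where p: "w = Some (j, y)" "j \<in> J" "y \<in> topspace (nsphere 2)" "y \<noteq> sphere_base"
          using w by (auto simp: topspace_wedge_spheres split: if_splits)
        obtain s t where st: "s \<in> topspace (nsphere 1)" "0 \<le> t" "t \<le> 1" "y = pinch s t"
          using pinch_surj[OF p(3)] .
        then have "t < 1" using p(4) pinch_1[of s] by (cases "t = 1") auto
        then have "w = ?c ((j, s), t)" using p st cW by simp
        then show ?thesis using st p by (intro UnI2 image_eqI[of _ _ "((j, s), t)"]) auto
      qed simp
    qed
  qed
qed

section \<open>The clique complex of the Johnson graph\<close>

definition johnson_complex :: "nat \<Rightarrow> nat \<Rightarrow> nat set set set" where
  "johnson_complex n m = {F. F \<noteq> {} \<and> F \<subseteq> subsets_of_size n m \<and> (\<forall>A\<in>F. \<forall>B\<in>F. card (A - B) \<le> 1)}"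

lemma subsets_of_sizeD:
  assumes "A \<in> subsets_of_size n m"
  shows "finite A" "card A = n" "A \<subseteq> {1..m}"
  using assms by (auto simp: subsets_of_size_def intro: finite_subset)

lemma finite_subsets_of_size: "finite (subsets_of_size n m)"
  by (rule finite_subset[of _ "Pow {1..m}"]) (auto simp: subsets_of_size_def)

lemma card_Diff_commute:
  assumes "finite A" "finite B" "card A = card B"
  shows "card (A - B) = card (B - A)"
  using assms by (metis card_Diff_subset_Int finite_Int inf_commute)

text \<open>For sets of equal size both halves of the symmetric difference have the same size, so
  distance at most 2 means that each half has at most one element.\<close>

lemma vietoris_rips_eq_johnson:
  "vietoris_rips (symdiff_metric (subsets_of_size n m)) 2 = johnson_complex n m"
proof -
  have sd: "real (card (sym_diff A B)) \<le> 2 \<longleftrightarrow> card (A - B) \<le> 1"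
    if "A \<in> subsets_of_size n m" "B \<in> subsets_of_size n m" for A B
  proof -
    have "card (sym_diff A B) = card (A - B) + card (B - A)"
      using subsets_of_sizeD(1)[OF that(1)] subsets_of_sizeD(1)[OF that(2)] by (intro card_Un_disjoint) auto
    moreover have "card (A - B) = card (B - A)"
      using that by (intro card_Diff_commute) (auto dest: subsets_of_sizeD)
    ultimately show ?thesis by auto
  qed
  have "F \<in> vietoris_rips (symdiff_metric (subsets_of_size n m)) 2 \<longleftrightarrow> F \<in> johnson_complex n m" for F
  proof (cases "F \<noteq> {} \<and> F \<subseteq> subsets_of_size n m")
    case True
    then have "finite F" using finite_subsets_of_size finite_subset by blast
    then have "mdiameter (symdiff_metric (subsets_of_size n m)) F \<le> 2 \<longleftrightarrow>
        (\<forall>A\<in>F. \<forall>B\<in>F. real (card (sym_diff A B)) \<le> 2)"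
      using True by (simp add: mdiameter_le_iff)
    also have "\<dots> \<longleftrightarrow> (\<forall>A\<in>F. \<forall>B\<in>F. card (A - B) \<le> 1)"
      using True sd by (meson subsetD)
    finally show ?thesis using True \<open>finite F\<close> by (simp add: vietoris_rips_def johnson_complex_def)
  qed (auto simp: vietoris_rips_def johnson_complex_def)
  then show ?thesis by blast
qed

lemma VR_space_eq: "VR_space n m 2 = realize (johnson_complex n m)"
  by (simp add: VR_space_def vietoris_rips_eq_johnson)

lemma johnson_complexD:
  assumes "F \<in> johnson_complex n m"
  shows "F \<noteq> {}" "F \<subseteq> subsets_of_size n m" "A \<in> F \<Longrightarrow> B \<in> F \<Longrightarrow> card (A - B) \<le> 1" "finite F"
    "A \<in> F \<Longrightarrow> finite A" "A \<in> F \<Longrightarrow> card A = n"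
  using assms finite_subset[OF _ finite_subsets_of_size] unfolding johnson_complex_def
  by (auto dest: subsets_of_sizeD)

lemma johnson_complex_subset: "F \<in> johnson_complex n m \<Longrightarrow> \<tau> \<subseteq> F \<Longrightarrow> \<tau> \<noteq> {} \<Longrightarrow> \<tau> \<in> johnson_complex n m"
  by (auto simp: johnson_complex_def)

lemma finite_complex_subcomplex:
  assumes "K \<subseteq> johnson_complex n m" "\<And>F \<tau>. F \<in> K \<Longrightarrow> \<tau> \<subseteq> F \<Longrightarrow> \<tau> \<noteq> {} \<Longrightarrow> \<tau> \<in> K"
  shows "finite_complex K"
proof -
  have "K \<subseteq> Pow (subsets_of_size n m)"
    using assms(1) by (auto simp: johnson_complex_def)
  then have "finite K"
    using finite_subsets_of_size finite_subset by blast
  then show ?thesis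
    unfolding finite_complex_def using assms johnson_complexD(1,4) by (metis subsetD)
qed

lemma finite_complex_johnson: "finite_complex (johnson_complex n m)"
  by (rule finite_complex_subcomplex) (auto intro: johnson_complex_subset)

lemma insert_in_johnson:
  assumes "F \<in> johnson_complex n m" "V \<in> subsets_of_size n m" "\<And>C. C \<in> F \<Longrightarrow> card (C - V) \<le> 1"
  shows "insert V F \<in> johnson_complex n m"
proof -
  have "card (V - C) \<le> 1" if "C \<in> F" for C
    using assms(3)[OF that] card_Diff_commute[of C V] johnson_complexD(5,6)[OF assms(1) that] subsets_of_sizeD[OF assms(2)]
    by simp
  with assms show ?thesis by (auto simp: johnson_complex_def)
qed

lemma card_Diff_le_1: "A - B \<subseteq> {x} \<Longrightarrow> card (A - B) \<le> 1"
  using card_mono[of "{x}" "A - B"] by simp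

lemma johnson_edge:
  assumes F: "F \<in> johnson_complex n m" and AB: "A \<in> F" "B \<in> F" "A \<noteq> B"
  obtains a b where "A - B = {a}" "B - A = {b}" "a \<in> A" "a \<notin> B" "b \<in> B" "b \<notin> A"
    "card (A \<union> B) = Suc n" "Suc (card (A \<inter> B)) = n"
proof -
  note D = johnson_complexD[OF F]
  have eq: "card (A - B) = card (B - A)"
    using AB D by (intro card_Diff_commute) auto
  have "card (A - B) \<noteq> 0"
  proof
    assume "card (A - B) = 0"
    then have "card (A - B) = 0 \<and> card (B - A) = 0" using eq by simp
    moreover have "finite (A - B)" "finite (B - A)" using AB D(5) by auto
    ultimately have "A - B = {}" "B - A = {}" by (simp_all only: card_eq_0_iff) auto
    then show False using AB by blast
  qed
  then have "card (A - B) = 1" "card (B - A) = 1" using D(3)[OF AB(1,2)] eq by auto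
  then obtain a b where ab: "A - B = {a}" "B - A = {b}" by (auto simp: card_1_singleton_iff)
  then have "b \<notin> A" "a \<notin> A \<inter> B" "A \<union> B = insert b A" "A = insert a (A \<inter> B)" by auto
  moreover have fin: "finite A" "card A = n" using D AB by auto
  ultimately have "card (A \<union> B) = Suc n" "Suc (card (A \<inter> B)) = n"
    by (metis card_insert_disjoint, metis card_insert_disjoint finite_Int)
  with ab show thesis by (intro that[of a b]) auto
qed

text \<open>The source of the two kinds of maximal cliques. If \<open>C\<close> misses some
  \<open>s\<close> of the intersection, it must contain all n other elements of the union of
  \<open>A\<close> and \<open>B\<close>; one more element from outside would make it too
  large.\<close>

lemma johnson_dichotomy:
  assumes F: "F \<in> johnson_complex n m" and ABC: "A \<in> F" "B \<in> F" "C \<in> F" "A \<noteq> B"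
  shows "A \<inter> B \<subseteq> C \<or> C \<subseteq> A \<union> B"
proof (rule ccontr)
  assume "\<not> (A \<inter> B \<subseteq> C \<or> C \<subseteq> A \<union> B)"
  then obtain s c where s: "s \<in> A" "s \<in> B" "s \<notin> C" and c: "c \<in> C" "c \<notin> A \<union> B" by blast
  note D = johnson_complexD[OF F]
  have one: "x \<in> C" if "X \<in> F" "s \<in> X" "x \<in> X" "x \<noteq> s" for X x
  proof (rule ccontr)
    assume "x \<notin> C"
    then have "card {x, s} \<le> card (X - C)" using that s D(5) by (intro card_mono) auto
    then show False using that D(3)[OF that(1) ABC(3)] by simp
  qed
  have "insert c ((A \<union> B) - {s}) \<subseteq> C" using one[OF ABC(1) s(1)] one[OF ABC(2) s(2)] c by blast
  moreover have "card (A \<union> B) = Suc n" using johnson_edge[OF F ABC(1,2,4)] by metis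
  moreover have "finite A" "finite B" "finite C" "card C = n" using D ABC by auto
  ultimately show False
    using c s card_mono[of C "insert c ((A \<union> B) - {s})"] by (simp add: card_Diff_singleton)
qed

text \<open>Among cliques with at least three elements, the size of the union tells the two kinds of maximal
  simplices apart.\<close>

definition down_simplex :: "nat \<Rightarrow> nat \<Rightarrow> nat set set \<Rightarrow> bool" where
  "down_simplex n m F \<longleftrightarrow> 3 \<le> card F \<and> card (\<Union>F) = Suc n \<and> m \<notin> \<Union>F"

section \<open>Simplices below an (n+1)-set that avoids \<open>m\<close>\<close>

lemma finite_Union_johnson: "F \<in> johnson_complex n m \<Longrightarrow> finite (\<Union>F)"
  using johnson_complexD(4,5) by blast

lemma three_distinct:
  assumes "3 \<le> card F"
  obtains A B C where "A \<in> F" "B \<in> F" "C \<in> F" "A \<noteq> B" "A \<noteq> C" "B \<noteq> C"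
proof -
  obtain \<tau> where "\<tau> \<subseteq> F" "card \<tau> = 3" by (rule obtain_subset_with_card_n[OF assms], rule that)
  then show thesis using that by (auto simp: card_3_iff)
qed

lemma two_distinct:
  assumes "2 \<le> card F"
  obtains A B where "A \<in> F" "B \<in> F" "A \<noteq> B"
proof -
  obtain \<tau> where "\<tau> \<subseteq> F" "card \<tau> = 2" by (rule obtain_subset_with_card_n[OF assms], rule that)
  then show thesis using that by (auto simp: card_2_iff)
qed

text \<open>Two distinct adjacent vertices already have n+1 elements in their union.\<close>

lemma down_simplex_Union:
  assumes F: "F \<in> johnson_complex n m" and down: "down_simplex n m F"
    and AB: "A \<in> F" "B \<in> F" "A \<noteq> B"
  shows "\<Union>F = A \<union> B"
proof -
  have "card (A \<union> B) = Suc n" using johnson_edge[OF F AB] by metis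
  then have "card (A \<union> B) = card (\<Union>F)" using down by (simp add: down_simplex_def)
  moreover have "A \<union> B \<subseteq> \<Union>F" using AB by blast
  ultimately show ?thesis using card_subset_eq[OF finite_Union_johnson[OF F]] by metis
qed

text \<open>Three vertices pin the (n+1)-set down. A further vertex \<open>C\<close> not inside it
  would, by the dichotomy, contain the intersections of \<open>A\<close> with \<open>B\<close> and
  with \<open>D\<close>. These two cover \<open>A\<close>, so \<open>C\<close> would equal
  \<open>A\<close>. Hence removing all these simplices leaves a complex.\<close>

lemma down_simplex_superset:
  assumes F: "F \<in> johnson_complex n m" and down: "down_simplex n m F"
    and \<tau>: "\<tau> \<in> johnson_complex n m" "F \<subseteq> \<tau>"
  shows "\<Union>\<tau> = \<Union>F" and "down_simplex n m \<tau>"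
proof -
  obtain A B D where ABD: "A \<in> F" "B \<in> F" "D \<in> F" "A \<noteq> B" "A \<noteq> D" "B \<noteq> D"
    using three_distinct down by (metis down_simplex_def)
  have T: "\<Union>F = A \<union> B" "\<Union>F = A \<union> D" "\<Union>F = B \<union> D"
    using down_simplex_Union[OF F down] ABD by metis+
  have in_\<tau>: "A \<in> \<tau>" "B \<in> \<tau>" "D \<in> \<tau>" using ABD \<tau>(2) by auto
  have "C \<subseteq> \<Union>F" if C: "C \<in> \<tau>" for C
  proof (rule ccontr)
    assume ne: "\<not> C \<subseteq> \<Union>F"
    then have "A \<inter> B \<subseteq> C" "A \<inter> D \<subseteq> C"
      using johnson_dichotomy[OF \<tau>(1) in_\<tau>(1,2) C ABD(4)] johnson_dichotomy[OF \<tau>(1) in_\<tau>(1,3) C ABD(5)] T by auto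
    moreover have "A \<subseteq> (A \<inter> B) \<union> (A \<inter> D)" using T by blast
    ultimately have "A \<subseteq> C" by blast
    then have "A = C"
      using johnson_complexD(5,6)[OF \<tau>(1)] in_\<tau>(1) C by (metis card_subset_eq)
    then show False using ne ABD(1) by blast
  qed
  then show U: "\<Union>\<tau> = \<Union>F" using \<tau>(2) by blast
  show "down_simplex n m \<tau>"
    using down card_mono[OF johnson_complexD(4)[OF \<tau>(1)] \<tau>(2)] by (simp add: down_simplex_def U)
qed

text \<open>It depends on the union alone, which all cofaces of a down simplex share; this is the
  constancy that \<open>collapse_matching\<close> asks for.\<close>

definition apex_down :: "nat set set \<Rightarrow> nat set" where
  "apex_down F = \<Union>F - {Min (\<Union>F)}"

definition no_down :: "nat \<Rightarrow> nat \<Rightarrow> nat set set set" where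
  "no_down n m = {F \<in> johnson_complex n m. \<not> down_simplex n m F}"

text \<open>The critical cells of the matching by \<open>apex_down\<close>: without its apex such a
  triangle is only an edge, which is not a down simplex, so it has no partner.\<close>

definition down_triangles :: "nat \<Rightarrow> nat \<Rightarrow> nat set set set" where
  "down_triangles n m = {F \<in> johnson_complex n m. down_simplex n m F \<and> card F = 3 \<and> apex_down F \<in> F}"

lemma finite_complex_no_down: "finite_complex (no_down n m)"
proof (rule finite_complex_subcomplex)
  show "no_down n m \<subseteq> johnson_complex n m" by (auto simp: no_down_def)
  show "\<tau> \<in> no_down n m" if "F \<in> no_down n m" "\<tau> \<subseteq> F" "\<tau> \<noteq> {}" for F \<tau>
    using that johnson_complex_subset down_simplex_superset(2) unfolding no_down_def by blast
qed

lemma apex_down_in: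
  assumes F: "F \<in> johnson_complex n m" and down: "down_simplex n m F"
  shows "apex_down F \<in> subsets_of_size n m" "insert (apex_down F) F \<in> johnson_complex n m"
    "\<Union>(insert (apex_down F) F) = \<Union>F"
proof -
  note fin = finite_Union_johnson[OF F]
  have cU: "card (\<Union>F) = Suc n" using down by (simp add: down_simplex_def)
  then have "\<Union>F \<noteq> {}" by (metis card.empty nat.distinct(1))
  then have "Min (\<Union>F) \<in> \<Union>F" using fin by (rule Min_in[rotated])
  moreover have "\<Union>F \<subseteq> {1..m}" using johnson_complexD(2)[OF F] subsets_of_sizeD(3) by blast
  ultimately show v: "apex_down F \<in> subsets_of_size n m"
    using cU fin by (auto simp: apex_down_def subsets_of_size_def)
  show "insert (apex_down F) F \<in> johnson_complex n m"
  proof (rule insert_in_johnson[OF F v])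
    show "card (C - apex_down F) \<le> 1" if "C \<in> F" for C
      using that by (intro card_Diff_le_1[of _ _ "Min (\<Union>F)"]) (auto simp: apex_down_def)
  qed
  show "\<Union>(insert (apex_down F) F) = \<Union>F" by (auto simp: apex_down_def)
qed

text \<open>Down simplices are paired by adding or removing the apex of their (n+1)-set.\<close>

lemma johnson_collapse_to_triangles:
  shows "finite_complex (no_down n m \<union> down_triangles n m)"
    and "realize (johnson_complex n m) homotopy_equivalent_space
      realize (no_down n m \<union> down_triangles n m)"
proof -
  let ?K = "johnson_complex n m"
  define \<S> where "\<S> = {F \<in> ?K. down_simplex n m F \<and> apex_down F \<notin> F}"
  have sup: "apex_down \<tau> = apex_down F \<and> \<tau> - {apex_down F} \<in> \<S>" if F: "F \<in> \<S>" and \<tau>: "\<tau> \<in> ?K" "F \<subseteq> \<tau>" for F \<tau>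
  proof -
    have s: "F \<in> ?K" "down_simplex n m F" "apex_down F \<notin> F" using F by (auto simp: \<S>_def)
    let ?G = "\<tau> - {apex_down F}"
    have "F \<subseteq> ?G" using \<tau>(2) s(3) by blast
    moreover from this have "?G \<in> ?K" using johnson_complexD(1)[OF s(1)] by (intro johnson_complex_subset[OF \<tau>(1)]) auto
    ultimately have "\<Union>?G = \<Union>F" "down_simplex n m ?G" "\<Union>\<tau> = \<Union>F"
      using down_simplex_superset[OF s(1,2)] \<tau> by auto
    then have "apex_down \<tau> = apex_down F" "apex_down ?G = apex_down F" "down_simplex n m ?G"
      by (simp_all only: apex_down_def)
    then show ?thesis using \<open>?G \<in> ?K\<close> by (simp add: \<S>_def)
  qed
  have "?K - (\<S> \<union> (\<lambda>F. insert (apex_down F) F) ` \<S>) = no_down n m \<union> down_triangles n m"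
  proof (intro equalityI subsetI)
    fix F assume F: "F \<in> ?K - (\<S> \<union> (\<lambda>F. insert (apex_down F) F) ` \<S>)"
    then have FK: "F \<in> ?K" and FS: "F \<notin> \<S>" and FI: "\<And>G. G \<in> \<S> \<Longrightarrow> F \<noteq> insert (apex_down G) G"
      by auto
    show "F \<in> no_down n m \<union> down_triangles n m"
    proof (cases "down_simplex n m F")
      case True
      then have ap: "apex_down F \<in> F" using FK FS by (simp add: \<S>_def)
      have "card F = 3"
      proof (rule ccontr)
        assume "card F \<noteq> 3"
        then have 4: "4 \<le> card F" using True by (simp add: down_simplex_def)
        \<comment> \<open>With at least four vertices, three remain after removing the apex. They
          have the same union, so this face is a down simplex matched with \<open>F\<close>.\<close>
        let ?G = "F - {apex_down F}"
        have c: "3 \<le> card ?G" using 4 ap by (simp add: card_Diff_singleton)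
        then have "?G \<noteq> {}" by (metis card.empty not_numeral_le_zero)
        then have G: "?G \<in> ?K" by (intro johnson_complex_subset[OF FK]) blast
        obtain A B where AB: "A \<in> ?G" "B \<in> ?G" "A \<noteq> B" by (rule two_distinct[OF order_trans[OF _ c]], simp, rule that)
        have "\<Union>F = A \<union> B" by (rule down_simplex_Union[OF FK True]) (use AB in simp_all)
        moreover have "A \<union> B \<subseteq> \<Union>?G" using AB(1,2) by (intro Un_least Union_upper)
        moreover have "\<Union>?G \<subseteq> \<Union>F" by (intro Union_mono Diff_subset)
        ultimately have U: "\<Union>?G = \<Union>F" by (metis subset_antisym)
        then have "down_simplex n m ?G" using True c by (simp add: down_simplex_def)
        moreover have apU: "apex_down ?G = apex_down F" unfolding apex_down_def[of ?G] U by (simp add: apex_down_def)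
        ultimately have "?G \<in> \<S>" using G by (simp add: \<S>_def)
        moreover have "F = insert (apex_down ?G) ?G" unfolding apU using ap by (simp add: insert_absorb)
        ultimately show False using FI by blast
      qed
      then show ?thesis using FK True ap by (simp add: down_triangles_def)
    qed (use FK in \<open>simp add: no_down_def\<close>)
  next
    fix F assume F: "F \<in> no_down n m \<union> down_triangles n m"
    have "F \<notin> \<S>" using F by (auto simp: \<S>_def no_down_def down_triangles_def)
    moreover have "F \<noteq> insert (apex_down G) G" if G: "G \<in> \<S>" for G
    proof
      assume eq: "F = insert (apex_down G) G"
      have r: "G \<in> ?K" "down_simplex n m G" "apex_down G \<notin> G" using G by (auto simp: \<S>_def)
      have "card F \<ge> 4" using r johnson_complexD(4)[OF r(1)] by (simp add: eq down_simplex_def)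
      moreover have "down_simplex n m F"
        unfolding eq by (rule down_simplex_superset(2)[OF r(1,2)]) (use apex_down_in(2)[OF r(1,2)] in auto)
      ultimately show False using F by (auto simp: no_down_def down_triangles_def)
    qed
    ultimately show "F \<in> ?K - (\<S> \<union> (\<lambda>F. insert (apex_down F) F) ` \<S>)"
      using F by (auto simp: no_down_def down_triangles_def)
  qed
  moreover have "finite_complex (?K - (\<S> \<union> (\<lambda>F. insert (apex_down F) F) ` \<S>)) \<and>
      realize ?K homotopy_equivalent_space
      realize (?K - (\<S> \<union> (\<lambda>F. insert (apex_down F) F) ` \<S>))"
  proof (rule collapse_matching[OF finite_complex_johnson])
    show "\<S> \<subseteq> ?K" by (auto simp: \<S>_def)
    show "apex_down F \<notin> F \<and> insert (apex_down F) F \<in> ?K" if "F \<in> \<S>" for F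
      using that apex_down_in(2)[of F n m] by (simp add: \<S>_def)
  qed (rule sup)
  ultimately show "finite_complex (no_down n m \<union> down_triangles n m)"
    "realize (johnson_complex n m) homotopy_equivalent_space
      realize (no_down n m \<union> down_triangles n m)"
    by simp_all
qed

text \<open>Only the vertices avoiding \<open>m\<close> enter, so adding or removing the apex, which
  contains \<open>m\<close>, does not change it. It is meant for simplices with at least two such
  vertices.\<close>

definition star_apex :: "nat \<Rightarrow> nat set set \<Rightarrow> nat set" where
  "star_apex m F = insert m (\<Inter>{A \<in> F. m \<notin> A})"

definition one_free :: "nat \<Rightarrow> nat \<Rightarrow> nat set set set" where
  "one_free n m = {F \<in> johnson_complex n m. \<forall>A\<in>F. \<forall>B\<in>F. m \<notin> A \<longrightarrow> m \<notin> B \<longrightarrow> A = B}"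

text \<open>Of the two alternatives in the dichotomy, a \<open>C\<close> inside the union of
  \<open>A\<close> and \<open>B\<close> but not above their intersection would give a down triangle.
  So every vertex contains the common (n-1)-set, and the only possible vertex through
  \<open>m\<close> is that set with \<open>m\<close> added.\<close>

lemma no_down_structure:
  assumes F: "F \<in> no_down n m" and AB: "A \<in> F" "B \<in> F" "A \<noteq> B" "m \<notin> A" "m \<notin> B"
  shows "C \<in> F \<Longrightarrow> A \<inter> B \<subseteq> C" and "star_apex m F = insert m (A \<inter> B)"
    and "C \<in> F \<Longrightarrow> m \<in> C \<Longrightarrow> C = star_apex m F"
proof -
  have FJ: "F \<in> johnson_complex n m" and nd: "\<not> down_simplex n m F" using F by (auto simp: no_down_def)
  note D = johnson_complexD[OF FJ]
  have cAB: "card (A \<union> B) = Suc n" "Suc (card (A \<inter> B)) = n"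
    by (rule johnson_edge[OF FJ AB(1-3)]; simp)+
  have sub: "A \<inter> B \<subseteq> C" if C: "C \<in> F" for C
  proof (rule ccontr)
    assume ne: "\<not> A \<inter> B \<subseteq> C"
    then have C_sub: "C \<subseteq> A \<union> B" using johnson_dichotomy[OF FJ AB(1,2) C AB(3)] by blast
    have CAB: "C \<noteq> A" "C \<noteq> B" using ne by auto
    let ?G = "{A, B, C}"
    have G: "?G \<in> johnson_complex n m" "?G \<subseteq> F" using AB C by (auto intro!: johnson_complex_subset[OF FJ])
    have "\<Union>?G = A \<union> B" using C_sub by auto
    moreover have "card ?G = 3" using CAB AB(3) by auto
    ultimately have "down_simplex n m ?G" using cAB AB(4,5) by (simp add: down_simplex_def)
    then show False using down_simplex_superset(2)[OF G(1) _ FJ G(2)] nd by blast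
  qed
  then show "C \<in> F \<Longrightarrow> A \<inter> B \<subseteq> C" .
  have "\<Inter>{A \<in> F. m \<notin> A} = A \<inter> B"
  proof (rule subset_antisym)
    show "\<Inter>{A \<in> F. m \<notin> A} \<subseteq> A \<inter> B" using AB by blast
    show "A \<inter> B \<subseteq> \<Inter>{A \<in> F. m \<notin> A}" using sub by blast
  qed
  then show ap: "star_apex m F = insert m (A \<inter> B)" by (simp add: star_apex_def)
  show "C = star_apex m F" if "C \<in> F" "m \<in> C"
  proof -
    have "insert m (A \<inter> B) \<subseteq> C" using sub[OF that(1)] that(2) by blast
    moreover have "card (insert m (A \<inter> B)) = card C"
      using cAB AB D(5,6) that by simp
    ultimately show ?thesis unfolding ap using D(5)[OF that(1)] card_subset_eq by metis
  qed
qed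

lemma insert_star_apex:
  assumes m: "1 \<le> m" and F: "F \<in> no_down n m" and AB: "A \<in> F" "B \<in> F" "A \<noteq> B" "m \<notin> A" "m \<notin> B"
  shows "insert (star_apex m F) F \<in> no_down n m"
proof -
  have FJ: "F \<in> johnson_complex n m" using F by (auto simp: no_down_def)
  note D = johnson_complexD[OF FJ]
  note S = no_down_structure[OF F AB]
  have cAB: "Suc (card (A \<inter> B)) = n"
    by (rule johnson_edge[OF FJ AB(1-3)]; simp)
  have "A \<inter> B \<subseteq> {1..m}" using D(2) AB(1) subsets_of_sizeD(3) by blast
  then have v: "star_apex m F \<in> subsets_of_size n m"
    unfolding S(2) using cAB AB D(5) m by (simp add: subsets_of_size_def)
  have "insert (star_apex m F) F \<in> johnson_complex n m"
  proof (rule insert_in_johnson[OF FJ v])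
    fix C assume C: "C \<in> F"
    have "card (C - star_apex m F) \<le> card (C - A \<inter> B)"
      unfolding S(2) using D(5)[OF C] by (intro card_mono) auto
    also have "\<dots> = card C - card (A \<inter> B)"
      using S(1)[OF C] D(5)[OF C] AB(1) by (intro card_Diff_subset) (auto intro: finite_subset)
    also have "\<dots> \<le> 1" using D(6)[OF C] cAB by simp
    finally show "card (C - star_apex m F) \<le> 1" .
  qed
  \<comment> \<open>The enlarged simplex has \<open>m\<close> in its union and so cannot be a down
    simplex.\<close>
  then show ?thesis by (simp add: no_down_def down_simplex_def star_apex_def)
qed

text \<open>A simplex with two vertices avoiding \<open>m\<close> has at most one vertex through
  \<open>m\<close>, its \<open>star_apex\<close>. So such simplices come in pairs without and with
  the apex, and they are exactly what the collapse removes.\<close>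

lemma no_down_collapse_to_one_free:
  assumes m: "1 \<le> m"
  shows "finite_complex (one_free n m)"
    and "realize (no_down n m) homotopy_equivalent_space realize (one_free n m)"
proof -
  let ?K = "no_down n m"
  define \<S> where "\<S> = {F \<in> ?K. m \<notin> \<Union>F \<and> 2 \<le> card F}"
  have subK: "\<tau> \<in> ?K" if "F \<in> ?K" "\<tau> \<subseteq> F" "\<tau> \<noteq> {}" for F \<tau>
    using finite_complexD(4)[OF finite_complex_no_down] that by blast
  have fin: "finite F" if "F \<in> ?K" for F
    using finite_complexD(2)[OF finite_complex_no_down that] .
  have apex: "star_apex m G = star_apex m F" if "F \<in> ?K" "G \<in> ?K" "A \<in> F" "B \<in> F" "A \<in> G" "B \<in> G"
    "A \<noteq> B" "m \<notin> A" "m \<notin> B" for F G A B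
    using no_down_structure(2)[OF that(1,3,4,7-9)] no_down_structure(2)[OF that(2,5-9)] by simp
  have free: "F - {star_apex m F} \<in> \<S>"
    if F: "F \<in> ?K" and AB: "A \<in> F" "B \<in> F" "A \<noteq> B" "m \<notin> A" "m \<notin> B" for F A B
  proof -
    let ?G = "F - {star_apex m F}"
    have "m \<in> star_apex m F" by (simp add: star_apex_def)
    then have ABG: "A \<in> ?G" "B \<in> ?G" using AB by auto
    then have "?G \<in> ?K" using subK[OF F, of ?G] by blast
    moreover have "m \<notin> \<Union>?G" using no_down_structure(3)[OF F AB] by blast
    moreover have "2 \<le> card ?G"
    proof -
      have "card {A, B} \<le> card ?G" using ABG fin[OF F] by (intro card_mono) auto
      then show ?thesis using AB(3) by simp
    qed
    ultimately show ?thesis by (simp add: \<S>_def)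
  qed
  have two: "thesis" if "F \<in> \<S>" "\<And>A B. A \<in> F \<Longrightarrow> B \<in> F \<Longrightarrow> A \<noteq> B \<Longrightarrow> m \<notin> A \<Longrightarrow> m \<notin> B \<Longrightarrow> thesis" for F thesis
  proof -
    have "2 \<le> card F" using that(1) by (simp add: \<S>_def)
    then obtain A B where "A \<in> F" "B \<in> F" "A \<noteq> B" by (rule two_distinct)
    moreover have "m \<notin> \<Union>F" using that(1) by (simp add: \<S>_def)
    ultimately show thesis using that(2) by blast
  qed
  have "?K - (\<S> \<union> (\<lambda>F. insert (star_apex m F) F) ` \<S>) = one_free n m"
  proof (intro equalityI subsetI)
    fix F assume "F \<in> ?K - (\<S> \<union> (\<lambda>F. insert (star_apex m F) F) ` \<S>)"
    then have F: "F \<in> ?K" "F \<notin> \<S>" and FI: "\<And>G. G \<in> \<S> \<Longrightarrow> F \<noteq> insert (star_apex m G) G" by auto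
    have "A = B" if AB: "A \<in> F" "B \<in> F" "m \<notin> A" "m \<notin> B" for A B
    proof (rule ccontr)
      assume ne: "A \<noteq> B"
      let ?G = "F - {star_apex m F}"
      have G: "?G \<in> \<S>" by (rule free[OF F(1) AB(1,2) ne AB(3,4)])
      have "star_apex m F \<in> F" using G F(2) by (metis Diff_empty Diff_insert0)
      moreover have "m \<in> star_apex m F" by (simp add: star_apex_def)
      then have "A \<in> ?G" "B \<in> ?G" using AB by auto
      then have "star_apex m ?G = star_apex m F" using G AB ne F(1) by (intro apex[of F ?G A B]) (auto simp: \<S>_def)
      ultimately have "F = insert (star_apex m ?G) ?G" by (simp add: insert_absorb)
      then show False using FI[OF G] by simp
    qed
    then show "F \<in> one_free n m" using F(1) by (auto simp: one_free_def no_down_def)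
  next
    fix F assume F: "F \<in> one_free n m"
    then have uniq: "\<And>A B. A \<in> F \<Longrightarrow> B \<in> F \<Longrightarrow> m \<notin> A \<Longrightarrow> m \<notin> B \<Longrightarrow> A = B"
      and FJ: "F \<in> johnson_complex n m" by (auto simp: one_free_def)
    have "\<not> down_simplex n m F"
    proof
      assume d: "down_simplex n m F"
      then have "2 \<le> card F" by (simp add: down_simplex_def)
      then obtain A B where "A \<in> F" "B \<in> F" "A \<noteq> B" by (rule two_distinct)
      then show False using uniq d unfolding down_simplex_def by blast
    qed
    moreover have "F \<notin> \<S>" using two[of F] uniq by metis
    moreover have "F \<noteq> insert (star_apex m G) G" if "G \<in> \<S>" for G
      using two[OF that] uniq by (metis insertCI)
    ultimately show "F \<in> ?K - (\<S> \<union> (\<lambda>F. insert (star_apex m F) F) ` \<S>)"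
      using FJ by (auto simp: no_down_def)
  qed
  moreover have "finite_complex (?K - (\<S> \<union> (\<lambda>F. insert (star_apex m F) F) ` \<S>)) \<and>
      realize ?K homotopy_equivalent_space
      realize (?K - (\<S> \<union> (\<lambda>F. insert (star_apex m F) F) ` \<S>))"
  proof (rule collapse_matching[OF finite_complex_no_down])
    show "\<S> \<subseteq> ?K" by (auto simp: \<S>_def)
    show "star_apex m F \<notin> F \<and> insert (star_apex m F) F \<in> ?K" if F: "F \<in> \<S>" for F
    proof (rule two[OF F])
      fix A B assume AB: "A \<in> F" "B \<in> F" "A \<noteq> B" "m \<notin> A" "m \<notin> B"
      have s: "F \<in> ?K" "m \<notin> \<Union>F" using F by (auto simp: \<S>_def)
      have "m \<in> star_apex m F" by (simp add: star_apex_def)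
      then show ?thesis using insert_star_apex[OF m s(1) AB] s(2) by blast
    qed
    show "star_apex m \<tau> = star_apex m F \<and> \<tau> - {star_apex m F} \<in> \<S>"
      if F: "F \<in> \<S>" and \<tau>: "\<tau> \<in> ?K" "F \<subseteq> \<tau>" for F \<tau>
    proof (rule two[OF F])
      fix A B assume AB: "A \<in> F" "B \<in> F" "A \<noteq> B" "m \<notin> A" "m \<notin> B"
      have s: "F \<in> ?K" using F by (auto simp: \<S>_def)
      have AB': "A \<in> \<tau>" "B \<in> \<tau>" using AB \<tau>(2) by auto
      have "star_apex m \<tau> = star_apex m F" by (rule apex[OF s \<tau>(1) AB(1,2) AB' AB(3-5)])
      then show ?thesis using free[OF \<tau>(1) AB' AB(3-5)] by simp
    qed
  qed
  ultimately show "finite_complex (one_free n m)"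
    "realize (no_down n m) homotopy_equivalent_space realize (one_free n m)"
    by simp_all
qed

text \<open>Used when a single vertex \<open>A\<close> avoids \<open>m\<close>; the union is then a
  way to name \<open>A\<close>. The apex exchanges the least element of \<open>A\<close> for
  \<open>m\<close> and so depends on \<open>A\<close> only.\<close>

definition cone_apex :: "nat \<Rightarrow> nat set set \<Rightarrow> nat set" where
  "cone_apex m F = (let U = \<Union>{A \<in> F. m \<notin> A} in insert m (U - {Min U}))"

definition no_free :: "nat \<Rightarrow> nat \<Rightarrow> nat set set set" where
  "no_free n m = {F \<in> johnson_complex n m. \<forall>A\<in>F. m \<in> A}"

lemma cone_apex_eq:
  assumes "F \<in> one_free n m" "A \<in> F" "m \<notin> A"
  shows "cone_apex m F = insert m (A - {Min A})"
proof -
  have "{A \<in> F. m \<notin> A} = {A}" using assms by (auto simp: one_free_def)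
  then show ?thesis by (simp add: cone_apex_def)
qed

text \<open>Every vertex of \<open>F\<close> lies in the (n+1)-set \<open>insert m A\<close>, and so
  does the apex; two n-subsets of an (n+1)-set are adjacent.\<close>

lemma insert_cone_apex:
  assumes n: "1 \<le> n" and m: "1 \<le> m" and F: "F \<in> one_free n m" and A: "A \<in> F" "m \<notin> A"
  shows "insert (cone_apex m F) F \<in> one_free n m"
proof -
  have FJ: "F \<in> johnson_complex n m" using F by (auto simp: one_free_def)
  note D = johnson_complexD[OF FJ]
  note ap = cone_apex_eq[OF F A]
  have cA: "finite A" "card A = n" using D(5,6) A by auto
  have "A \<noteq> {}" using cA n by auto
  then have Min: "Min A \<in> A" using cA by simp
  have "A \<subseteq> {1..m}" using D(2) A(1) subsets_of_sizeD(3) by blast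
  then have v: "cone_apex m F \<in> subsets_of_size n m"
    unfolding ap using cA Min A(2) m n by (auto simp: subsets_of_size_def card_Diff_singleton)
  have "insert (cone_apex m F) F \<in> johnson_complex n m"
  proof (rule insert_in_johnson[OF FJ v])
    fix C assume C: "C \<in> F"
    show "card (C - cone_apex m F) \<le> 1"
    proof (cases "m \<in> C")
      case True
      have "C - A = {m}"
      proof -
        have "m \<in> C - A" using True A by blast
        moreover have "card (C - A) \<le> 1" "finite (C - A)" using D(3)[OF C A(1)] D(5)[OF C] by auto
        ultimately show ?thesis by (metis One_nat_def card_le_Suc0_iff_eq singletonI subsetI subset_antisym singletonD)
      qed
      then show ?thesis unfolding ap by (intro card_Diff_le_1[of _ _ "Min A"]) blast
    next
      case False
      then have "C = A" using F C A by (auto simp: one_free_def)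
      then show ?thesis unfolding ap by (intro card_Diff_le_1[of _ _ "Min A"]) blast
    qed
  qed
  moreover have "m \<in> cone_apex m F" by (simp add: ap)
  ultimately show ?thesis using F by (auto simp: one_free_def)
qed

text \<open>Adding or removing \<open>cone_apex\<close> pairs all simplices that still have a vertex
  avoiding \<open>m\<close>. Removing the apex never empties such a simplex, because that vertex
  stays.\<close>

lemma one_free_collapse_to_no_free:
  assumes n: "1 \<le> n" and m: "1 \<le> m"
  shows "realize (one_free n m) homotopy_equivalent_space realize (no_free n m)"
proof -
  let ?K = "one_free n m"
  note K = no_down_collapse_to_one_free(1)[OF m, of n]
  define \<S> where "\<S> = {F \<in> ?K. (\<exists>A\<in>F. m \<notin> A) \<and> cone_apex m F \<notin> F}"
  have free: "F - {cone_apex m F} \<in> \<S> \<and> cone_apex m (F - {cone_apex m F}) = cone_apex m F"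
    if F: "F \<in> ?K" and A: "A \<in> F" "m \<notin> A" for F A
  proof -
    have "m \<in> cone_apex m F" by (simp add: cone_apex_def Let_def)
    then have AG: "A \<in> F - {cone_apex m F}" using A by blast
    then have "F - {cone_apex m F} \<noteq> {}" by (metis empty_iff)
    then have G: "F - {cone_apex m F} \<in> ?K" by (rule finite_complexD(4)[OF K F Diff_subset])
    have "cone_apex m (F - {cone_apex m F}) = cone_apex m F"
      using cone_apex_eq[OF G AG A(2)] cone_apex_eq[OF F A] by simp
    then show ?thesis using G AG A(2) by (auto simp: \<S>_def)
  qed
  have "?K - (\<S> \<union> (\<lambda>F. insert (cone_apex m F) F) ` \<S>) = no_free n m"
  proof (intro equalityI subsetI)
    fix F assume "F \<in> ?K - (\<S> \<union> (\<lambda>F. insert (cone_apex m F) F) ` \<S>)"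
    then have F: "F \<in> ?K" "F \<notin> \<S>" and FI: "\<And>G. G \<in> \<S> \<Longrightarrow> F \<noteq> insert (cone_apex m G) G" by auto
    have "m \<in> A" if A: "A \<in> F" for A
    proof (rule ccontr)
      assume nA: "m \<notin> A"
      have G: "F - {cone_apex m F} \<in> \<S>" "cone_apex m (F - {cone_apex m F}) = cone_apex m F"
        using free[OF F(1) A nA] by auto
      have "cone_apex m F \<in> F" using F A nA by (auto simp: \<S>_def)
      then have "F = insert (cone_apex m (F - {cone_apex m F})) (F - {cone_apex m F})"
        unfolding G(2) by (simp add: insert_absorb)
      then show False using FI[OF G(1)] by simp
    qed
    then show "F \<in> no_free n m" using F(1) by (auto simp: no_free_def one_free_def)
  next
    fix F assume F: "F \<in> no_free n m"
    have "F \<noteq> insert (cone_apex m G) G" if "G \<in> \<S>" for G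
      using that F by (auto simp: \<S>_def no_free_def)
    moreover have "F \<notin> \<S>" using F by (auto simp: \<S>_def no_free_def)
    ultimately show "F \<in> ?K - (\<S> \<union> (\<lambda>F. insert (cone_apex m F) F) ` \<S>)"
      using F by (auto simp: no_free_def one_free_def)
  qed
  moreover have "finite_complex (?K - (\<S> \<union> (\<lambda>F. insert (cone_apex m F) F) ` \<S>)) \<and>
      realize ?K homotopy_equivalent_space
      realize (?K - (\<S> \<union> (\<lambda>F. insert (cone_apex m F) F) ` \<S>))"
  proof (rule collapse_matching[OF K])
    show "\<S> \<subseteq> ?K" by (auto simp: \<S>_def)
    show "cone_apex m F \<notin> F \<and> insert (cone_apex m F) F \<in> ?K" if "F \<in> \<S>" for F
      using that insert_cone_apex[OF n m] by (auto simp: \<S>_def)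
    show "cone_apex m \<tau> = cone_apex m F \<and> \<tau> - {cone_apex m F} \<in> \<S>"
      if F: "F \<in> \<S>" and \<tau>: "\<tau> \<in> ?K" "F \<subseteq> \<tau>" for F \<tau>
    proof -
      obtain A where A: "A \<in> F" "m \<notin> A" "F \<in> ?K" using F by (auto simp: \<S>_def)
      have A\<tau>: "A \<in> \<tau>" using A \<tau> by blast
      have "cone_apex m \<tau> = cone_apex m F"
        using cone_apex_eq[OF \<tau>(1) A\<tau> A(2)] cone_apex_eq[OF A(3,1,2)] by simp
      then show ?thesis using free[OF \<tau>(1) A\<tau> A(2)] by simp
    qed
  qed
  ultimately show ?thesis by simp
qed

section \<open>Deleting \<open>m\<close> from every vertex\<close>

lemma geometric_realization_relabel:
  assumes K: "finite_complex K" and inj: "inj_on g (\<Union>K)"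
  shows "realize K homeomorphic_space realize ((`) g ` K)"
proof -
  note K' = finite_complexD[OF K]
  let ?V = "\<Union>K" and ?L = "(`) g ` K"
  have L: "finite_complex ?L"
    unfolding finite_complex_def
  proof (intro conjI ballI allI impI)
    fix F \<tau> assume "F \<in> ?L" and \<tau>: "\<tau> \<subseteq> F" "\<tau> \<noteq> {}"
    then obtain G where G: "G \<in> K" "F = g ` G" by blast
    then obtain G' where "G' \<subseteq> G" "\<tau> = g ` G'" using \<tau>(1) by (metis subset_imageE)
    then show "\<tau> \<in> ?L" using K'(4)[OF G(1)] \<tau>(2) by auto
  qed (use K'(1-3) in auto)
  \<comment> \<open>Coordinates are transported along \<open>g\<close> and set to 0 off the vertex
    sets, where points of the realizations vanish anyway.\<close>
  define \<phi> where "\<phi> p u = (if u \<in> g ` ?V then p (inv_into ?V g u) else (0::real))" for p u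
  define \<psi> where "\<psi> q v = (if v \<in> ?V then q (g v) else (0::real))" for q v
  have \<phi>g: "\<phi> p (g v) = p v" if "v \<in> ?V" for p v
    unfolding \<phi>_def using that inj by (simp add: inv_into_f_f)
  have \<phi>_in: "\<phi> p \<in> closed_simplex (g ` F)" if F: "F \<in> K" "p \<in> closed_simplex F" for F p
  proof -
    have sub: "F \<subseteq> ?V" using F(1) by blast
    have "\<phi> p (g v) = p v" if "v \<in> F" for v using \<phi>g sub that by blast
    then have "sum (\<phi> p) (g ` F) = sum p F"
      using inj_on_subset[OF inj sub] by (simp add: sum.reindex)
    moreover have "\<phi> p u = 0" if "u \<notin> g ` F" for u
    proof (cases "u \<in> g ` ?V")
      case True
      then obtain v where "v \<in> ?V" "u = g v" by blast
      then show ?thesis using \<phi>g[of v p] F(2) that by (auto simp: closed_simplex_def)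
    qed (simp add: \<phi>_def)
    ultimately show ?thesis using F(2) by (auto simp: closed_simplex_def \<phi>_def)
  qed
  have \<psi>_in: "\<psi> q \<in> closed_simplex F" if F: "F \<in> K" "q \<in> closed_simplex (g ` F)" for F q
  proof -
    have sub: "F \<subseteq> ?V" using F(1) by blast
    have "\<psi> q v = q (g v)" if "v \<in> F" for v using sub that by (auto simp: \<psi>_def)
    then have "sum (\<psi> q) F = sum q (g ` F)"
      using inj_on_subset[OF inj sub] by (simp add: sum.reindex)
    moreover have "\<psi> q v = 0" if "v \<notin> F" for v
    proof (cases "v \<in> ?V")
      case True
      then have "g v \<notin> g ` F" using inj sub that by (meson inj_on_image_mem_iff)
      then show ?thesis using F(2) by (simp add: \<psi>_def closed_simplex_def)
    qed (simp add: \<psi>_def)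
    ultimately show ?thesis using F(2) by (auto simp: closed_simplex_def \<psi>_def)
  qed
  have "homeomorphic_maps (realize K) (realize ?L) \<phi> \<psi>"
    unfolding homeomorphic_maps_def
  proof (intro conjI ballI)
    show "continuous_map (realize K) (realize ?L) \<phi>"
    proof (rule continuous_map_into_realization[OF L])
      show "continuous_map (realize K) euclideanreal (\<lambda>p. \<phi> p u)" for u
        unfolding \<phi>_def
        by (cases "u \<in> g ` ?V") (simp_all add: continuous_map_realization_coordinate[OF K])
    qed (use \<phi>_in in auto)
    show "continuous_map (realize ?L) (realize K) \<psi>"
    proof (rule continuous_map_into_realization[OF K])
      show "continuous_map (realize ?L) euclideanreal (\<lambda>q. \<psi> q v)" for v
        unfolding \<psi>_def
        by (cases "v \<in> ?V") (simp_all add: continuous_map_realization_coordinate[OF L])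
    qed (use \<psi>_in in auto)
    show "\<psi> (\<phi> p) = p" if p: "p \<in> topspace (realize K)" for p
    proof
      fix v
      obtain F where "F \<in> K" "p \<in> closed_simplex F" using p by auto
      then show "\<psi> (\<phi> p) v = p v"
        using \<phi>g[of v p] by (cases "v \<in> ?V") (auto simp: \<psi>_def closed_simplex_def)
    qed
    show "\<phi> (\<psi> q) = q" if q: "q \<in> topspace (realize ?L)" for q
    proof
      fix u
      obtain F where F: "F \<in> K" "q \<in> closed_simplex (g ` F)" using q by auto
      show "\<phi> (\<psi> q) u = q u"
      proof (cases "u \<in> g ` ?V")
        case True
        then obtain v where "v \<in> ?V" "u = g v" by blast
        then show ?thesis using \<phi>g[of v "\<psi> q"] by (simp add: \<psi>_def)
      next
        case False
        then have "u \<notin> g ` F" using F(1) by blast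
        then show ?thesis using False F(2) by (simp add: \<phi>_def closed_simplex_def)
      qed
    qed
  qed
  then show ?thesis by (auto simp: homeomorphic_space_def)
qed

text \<open>Adding \<open>m\<close> to sets that avoid it leaves all differences
  \<open>A - B\<close> unchanged, and therefore adjacency too.\<close>

lemma no_free_relabel:
  assumes n: "1 \<le> n" and m: "1 \<le> m"
  shows "realize (johnson_complex (n - 1) (m - 1)) homeomorphic_space
    realize (no_free n m)"
proof -
  let ?J = "johnson_complex (n - 1) (m - 1)"
  have notm: "m \<notin> A" if "A \<in> subsets_of_size (n - 1) (m - 1)" for A
    using subsets_of_sizeD(3)[OF that] m by auto
  have V: "\<Union>?J \<subseteq> subsets_of_size (n - 1) (m - 1)" using johnson_complexD(2) by blast
  have inj: "inj_on (insert m) (subsets_of_size (n - 1) (m - 1))"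
    using notm by (auto simp: inj_on_def insert_ident)
  have size: "insert m A \<in> subsets_of_size n m" if "A \<in> subsets_of_size (n - 1) (m - 1)" for A
  proof -
    have "A \<subseteq> {1..m}"
      using subsets_of_sizeD(3)[OF that] atLeastatMost_subset_iff[of 1 "m - 1" 1 m] by (meson diff_le_self order_trans le_refl)
    then show ?thesis
      using subsets_of_sizeD(1,2)[OF that] notm[OF that] n m by (simp add: subsets_of_size_def)
  qed
  have unsize: "A - {m} \<in> subsets_of_size (n - 1) (m - 1)" if "A \<in> subsets_of_size n m" "m \<in> A" for A
    using subsets_of_sizeD[OF that(1)] that(2) by (auto simp: subsets_of_size_def card_Diff_singleton)
  have "(`) (insert m) ` ?J = no_free n m"
  proof (intro equalityI subsetI)
    fix F assume "F \<in> (`) (insert m) ` ?J"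
    then obtain G where G: "G \<in> ?J" "F = insert m ` G" by blast
    have "card (insert m A - insert m B) \<le> 1" if "A \<in> G" "B \<in> G" for A B
    proof -
      have "insert m A - insert m B = A - B" using notm johnson_complexD(2)[OF G(1)] that by blast
      then show ?thesis using johnson_complexD(3)[OF G(1) that] by simp
    qed
    then show "F \<in> no_free n m"
      using size johnson_complexD(1,2)[OF G(1)] by (auto simp: G(2) no_free_def johnson_complex_def)
  next
    fix F assume "F \<in> no_free n m"
    then have F: "F \<in> johnson_complex n m" and m: "\<And>A. A \<in> F \<Longrightarrow> m \<in> A" by (auto simp: no_free_def)
    let ?G = "(\<lambda>A. A - {m}) ` F"
    have "card (A - {m} - (B - {m})) \<le> 1" if "A \<in> F" "B \<in> F" for A B
    proof -
      have "A - {m} - (B - {m}) = A - B" using m that by blast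
      then show ?thesis using johnson_complexD(3)[OF F that] by simp
    qed
    then have "?G \<in> ?J"
      using unsize m johnson_complexD(1,2)[OF F] unfolding johnson_complex_def by blast
    moreover have "F = insert m ` ?G"
      using m by (force simp: image_image insert_absorb)
    ultimately show "F \<in> (`) (insert m) ` ?J" by blast
  qed
  then show ?thesis
    using geometric_realization_relabel[OF finite_complex_johnson inj_on_subset[OF inj V]] by simp
qed

section \<open>Triangles and the homotopy type\<close>

text \<open>A triangle below \<open>T\<close> is given by the three elements it omits in turn. One
  of them is \<open>Min T\<close>, which yields the apex, and \<open>Q\<close> holds the other two;
  this makes the product of binomials visible.\<close>

definition triangle_index :: "nat \<Rightarrow> nat \<Rightarrow> (nat set \<times> nat set) set" where
  "triangle_index n m = (SIGMA T : {T. T \<subseteq> {1..m - 1} \<and> card T = Suc n}. {Q. Q \<subseteq> T - {Min T} \<and> card Q = 2})"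

definition index_triangle :: "nat set \<times> nat set \<Rightarrow> nat set set" where
  "index_triangle = (\<lambda>(T, Q). (\<lambda>y. T - {y}) ` insert (Min T) Q)"

lemma card_triangle_index: "card (triangle_index n m) = ((m - 1) choose (n + 1)) * (n choose 2)"
proof -
  let ?\<T> = "{T. T \<subseteq> {1..m - 1} \<and> card T = Suc n}"
  have "card {Q. Q \<subseteq> T - {Min T} \<and> card Q = 2} = n choose 2" if "T \<in> ?\<T>" for T
  proof -
    have T: "finite T" "card T = Suc n" using that finite_subset[of T "{1..m - 1}"] by simp_all
    then have "T \<noteq> {}" by auto
    then have "card (T - {Min T}) = n" using T by (simp add: card_Diff_singleton)
    then show ?thesis using T by (simp add: n_subsets)
  qed
  moreover have "card ?\<T> = (m - 1) choose (n + 1)" by (simp add: n_subsets)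
  moreover have fin: "finite ?\<T>" by (rule finite_subset[of _ "Pow {1..m - 1}"]) auto
  moreover have "finite {Q. Q \<subseteq> T - {Min T} \<and> card Q = 2}" if "T \<in> ?\<T>" for T
  proof (rule finite_subset)
    show "{Q. Q \<subseteq> T - {Min T} \<and> card Q = 2} \<subseteq> Pow T" by blast
    show "finite (Pow T)" using that finite_subset[of T "{1..m - 1}"] by simp
  qed
  then have "card (triangle_index n m) = (\<Sum>T\<in>?\<T>. card {Q. Q \<subseteq> T - {Min T} \<and> card Q = 2})"
    unfolding triangle_index_def by (intro card_SigmaI[OF fin]) blast
  ultimately show ?thesis by simp
qed

lemma triangle_indexD:
  assumes "(T, Q) \<in> triangle_index n m"
  shows "finite T" "card T = Suc n" "T \<subseteq> {1..m - 1}" "Min T \<in> T" "Q \<subseteq> T" "Min T \<notin> Q" "card Q = 2" "finite Q"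
proof -
  show T: "card T = Suc n" "T \<subseteq> {1..m - 1}" "Q \<subseteq> T" "Min T \<notin> Q" "card Q = 2"
    using assms by (auto simp: triangle_index_def)
  show "finite T" using T(2) by (rule finite_subset) simp
  have "T \<noteq> {}" using T(1) by auto
  then show "Min T \<in> T" using \<open>finite T\<close> by simp
  show "finite Q" using T(3) \<open>finite T\<close> by (rule finite_subset)
qed

lemma index_triangle_Union:
  assumes "(T, Q) \<in> triangle_index n m"
  shows "\<Union>(index_triangle (T, Q)) = T"
proof -
  note D = triangle_indexD[OF assms]
  obtain y where y: "y \<in> Q" using D(7) by fastforce
  then have "y \<noteq> Min T" using D(6) by blast
  then have "T \<subseteq> (T - {y}) \<union> (T - {Min T})" by blast
  then show ?thesis using y by (auto simp: index_triangle_def)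
qed

lemma inj_on_remove: "inj_on (\<lambda>y. T - {y}) T"
  by (rule inj_onI) blast

lemma remove_in_index_triangle_iff:
  assumes "(T, Q) \<in> triangle_index n m" "y \<in> T"
  shows "T - {y} \<in> index_triangle (T, Q) \<longleftrightarrow> y \<in> insert (Min T) Q"
proof -
  note D = triangle_indexD[OF assms(1)]
  have "y = z" if "T - {y} = T - {z}" "z \<in> insert (Min T) Q" for z
    using that assms(2) D(4,5) by blast
  then show ?thesis by (auto simp: index_triangle_def)
qed

text \<open>\<open>T\<close> is recovered as the union of the triangle, and \<open>Q\<close> from
  the elements whose removal from \<open>T\<close> gives a vertex.\<close>

lemma bij_betw_index_triangle:
  assumes m: "1 \<le> m"
  shows "bij_betw index_triangle (triangle_index n m) (down_triangles n m)"
  unfolding bij_betw_def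
proof (intro conjI equalityI subsetI)
  show "inj_on index_triangle (triangle_index n m)"
  proof (rule inj_onI)
    fix p p' assume p: "p \<in> triangle_index n m" "p' \<in> triangle_index n m" "index_triangle p = index_triangle p'"
    obtain T Q T' Q' where pp: "p = (T, Q)" "p' = (T', Q')" by (cases p; cases p')
    note P = p[unfolded pp]
    have T: "T = T'" using index_triangle_Union[OF P(1)] index_triangle_Union[OF P(2)] P(3) by simp
    note D = triangle_indexD[OF P(1)] and D' = triangle_indexD[OF P(2)]
    have "y \<in> Q \<longleftrightarrow> y \<in> Q'" if "y \<in> T" for y
      using remove_in_index_triangle_iff[OF P(1) that] remove_in_index_triangle_iff[OF P(2)] that P(3) T D(6) D'(6) by auto
    then have "Q = Q'" using D(5) D'(5) T by blast
    then show "p = p'" using pp T by simp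
  qed
next
  fix F assume "F \<in> index_triangle ` triangle_index n m"
  then obtain T Q where TQ: "(T, Q) \<in> triangle_index n m" "F = index_triangle (T, Q)" by auto
  note D = triangle_indexD[OF TQ(1)]
  have sub: "insert (Min T) Q \<subseteq> T" using D by blast
  have F: "F = (\<lambda>y. T - {y}) ` insert (Min T) Q" by (simp add: TQ index_triangle_def)
  have "inj_on (\<lambda>y. T - {y}) (insert (Min T) Q)" by (rule inj_on_subset[OF inj_on_remove sub])
  then have c3: "card F = 3" unfolding F using D(6-8) by (simp only: card_image) simp
  have U: "\<Union>F = T" using index_triangle_Union TQ by simp
  have "m \<notin> T" using D(3) m by auto
  then have "m \<notin> \<Union>F" "card (\<Union>F) = Suc n" by (simp_all only: U D(2)) simp_all
  have "apex_down F = T - {Min T}" by (simp only: apex_down_def U)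
  then have "apex_down F \<in> F" by (simp add: F)
  moreover have "F \<in> johnson_complex n m"
    unfolding johnson_complex_def
  proof (intro CollectI conjI ballI)
    show "F \<noteq> {}" by (simp add: F)
    have "T \<subseteq> {1..m}" using D(3) by (auto simp: subset_iff)
    then show "F \<subseteq> subsets_of_size n m"
      using sub D(1,2) by (auto simp: F subsets_of_size_def card_Diff_singleton)
    show "card (A - B) \<le> 1" if "A \<in> F" "B \<in> F" for A B
    proof -
      obtain y where "B = T - {y}" "A \<subseteq> T" using \<open>A \<in> F\<close> \<open>B \<in> F\<close> by (auto simp: F)
      then show ?thesis by (intro card_Diff_le_1[of _ _ y]) auto
    qed
  qed
  ultimately show "F \<in> down_triangles n m"
    using c3 \<open>m \<notin> \<Union>F\<close> \<open>card (\<Union>F) = Suc n\<close>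
    by (simp add: down_triangles_def down_simplex_def)
next
  fix F assume "F \<in> down_triangles n m"
  then have F: "F \<in> johnson_complex n m" "card (\<Union>F) = Suc n" "m \<notin> \<Union>F" "card F = 3" "apex_down F \<in> F"
    by (auto simp: down_triangles_def down_simplex_def)
  define T where "T = \<Union>F"
  have fT: "finite T" unfolding T_def by (rule finite_Union_johnson[OF F(1)])
  have cT: "card T = Suc n" using F(2) by (simp add: T_def)
  then have "T \<noteq> {}" by auto
  then have Min: "Min T \<in> T" using fT by simp
  define Y where "Y = {y \<in> T. T - {y} \<in> F}"
  have FY: "F = (\<lambda>y. T - {y}) ` Y"
  proof (intro equalityI subsetI)
    fix A assume A: "A \<in> F"
    then have sub: "A \<subseteq> T" unfolding T_def by blast
    have "card (T - A) = 1"
      using johnson_complexD(5,6)[OF F(1) A] sub cT by (simp add: card_Diff_subset)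
    then obtain y where "T - A = {y}" by (auto simp: card_1_singleton_iff)
    then have "A = T - {y}" "y \<in> T" using sub by auto
    then show "A \<in> (\<lambda>y. T - {y}) ` Y" using A by (auto simp: Y_def)
  qed (auto simp: Y_def)
  have inj: "inj_on (\<lambda>y. T - {y}) Y" by (rule inj_on_subset[OF inj_on_remove]) (simp add: Y_def)
  have cY: "card Y = 3" using F(4) card_image[OF inj] FY by simp
  have MY: "Min T \<in> Y" using F(5) Min by (simp add: Y_def apex_down_def T_def)
  define Q where "Q = Y - {Min T}"
  have "T \<subseteq> {1..m}" unfolding T_def using johnson_complexD(2)[OF F(1)] subsets_of_sizeD(3) by blast
  moreover have "m \<notin> T" using F(3) by (simp add: T_def)
  ultimately have "T \<subseteq> {1..m - 1}"
  proof (intro subsetI)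
    fix x assume "T \<subseteq> {1..m}" "m \<notin> T" "x \<in> T"
    then have "1 \<le> x" "x \<le> m" "x \<noteq> m" by auto
    then show "x \<in> {1..m - 1}" by simp
  qed
  then have "(T, Q) \<in> triangle_index n m"
    using cT cY MY by (auto simp: triangle_index_def Q_def Y_def card_Diff_singleton)
  moreover have "insert (Min T) Q = Y" using MY by (auto simp: Q_def)
  then have "F = index_triangle (T, Q)" using FY by (simp only: index_triangle_def prod.case)
  ultimately show "F \<in> index_triangle ` triangle_index n m" by blast
qed

text \<open>Antipodal vertices are \<open>a x\<close> and \<open>o' y z\<close> with three different
  indices; all other pairs differ in at most one element. One face of each shape is treated, the
  others follow by permuting the indices. Each face has a vertex through \<open>m\<close>, so none
  is a down simplex.\<close>

lemma octahedron_in_no_down: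
  assumes n: "1 \<le> n" and m: "1 \<le> m" and T: "finite T" "card T = Suc n" "T \<subseteq> {1..m - 1}"
    and x: "x0 \<in> T" "x1 \<in> T" "x2 \<in> T" "x0 \<noteq> x1" "x0 \<noteq> x2" "x1 \<noteq> x2"
  defines "a \<equiv> \<lambda>x. T - {x}" and "o' \<equiv> \<lambda>x y. insert m (T - {x, y})"
  shows "{a x1, a x2, o' x1 x2} \<in> no_down n m" "{a x0, o' x0 x2, o' x0 x1} \<in> no_down n m"
    "{o' x1 x2, o' x0 x2, o' x0 x1} \<in> no_down n m"
proof -
  have mT: "m \<notin> T" and Tm: "T \<subseteq> {1..m}" using T(3) m by (auto simp: subset_iff)
  have a: "a x \<in> subsets_of_size n m" if "x \<in> T" for x
    using that T Tm by (auto simp: a_def subsets_of_size_def card_Diff_singleton)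
  have o: "o' x y \<in> subsets_of_size n m" if "x \<in> T" "y \<in> T" "x \<noteq> y" for x y
  proof -
    have "card {x, y} = 2" using that by simp
    then have "card (T - {x, y}) = n - 1" using that T by (subst card_Diff_subset) auto
    then show ?thesis using T(1) Tm mT n m by (auto simp: o'_def subsets_of_size_def)
  qed
  have aa: "card (a x - a y) \<le> 1" and ao: "card (a x - o' x y) \<le> 1" "card (a x - o' y x) \<le> 1"
    and oa: "card (o' x y - a x) \<le> 1" "card (o' y x - a x) \<le> 1"
    and oo: "card (o' x y - o' x z) \<le> 1" "card (o' x y - o' z x) \<le> 1" "card (o' y x - o' x z) \<le> 1"
      "card (o' y x - o' z x) \<le> 1" for x y z
    unfolding a_def o'_def
    by (rule card_Diff_le_1[of _ _ y], blast, rule card_Diff_le_1[of _ _ y], blast,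
        rule card_Diff_le_1[of _ _ y], blast, rule card_Diff_le_1[of _ _ m], blast,
        rule card_Diff_le_1[of _ _ m], blast, rule card_Diff_le_1[of _ _ z], blast,
        rule card_Diff_le_1[of _ _ z], blast, rule card_Diff_le_1[of _ _ z], blast,
        rule card_Diff_le_1[of _ _ z], blast)
  have m_o: "m \<in> o' x y" for x y by (simp add: o'_def)
  show "{a x1, a x2, o' x1 x2} \<in> no_down n m"
    using a o aa[of x1 x2] aa[of x2 x1] ao(1)[of x1 x2] ao(2)[of x2 x1] oa(1)[of x1 x2] oa(2)[of x1 x2] m_o x
    by (auto simp: no_down_def down_simplex_def johnson_complex_def)
  show "{a x0, o' x0 x2, o' x0 x1} \<in> no_down n m"
    using a o ao(1)[of x0] oa(1)[of x0] oo(1)[of x0] m_o x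
    by (auto simp: no_down_def down_simplex_def johnson_complex_def)
  show "{o' x1 x2, o' x0 x2, o' x0 x1} \<in> no_down n m"
    using o oo[of x0] oo[of x1] oo[of x2] m_o x
    by (auto simp: no_down_def down_simplex_def johnson_complex_def)
qed

text \<open>The index set is any \<open>J\<close> of the right size: the explicit wedge uses an
  initial segment of the naturals, the induction a set disjoint from earlier indices.\<close>

lemma triangle_enumeration:
  assumes m: "1 \<le> m" and J: "finite J" "card J = ((m - 1) choose (n + 1)) * (n choose 2)"
  obtains T :: "'j \<Rightarrow> nat set" and x0 x1 x2 where
    "bij_betw (\<lambda>j. {T j - {x0 j}, T j - {x1 j}, T j - {x2 j}}) J (down_triangles n m)"
    and "\<And>j. j \<in> J \<Longrightarrow> finite (T j) \<and> card (T j) = Suc n \<and> T j \<subseteq> {1..m - 1} \<and>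
      x0 j \<in> T j \<and> x1 j \<in> T j \<and> x2 j \<in> T j \<and> x0 j \<noteq> x1 j \<and> x0 j \<noteq> x2 j \<and> x1 j \<noteq> x2 j"
proof -
  have "finite (triangle_index n m)"
  proof (rule finite_subset)
    show "triangle_index n m \<subseteq> Pow {1..m - 1} \<times> Pow {1..m - 1}"
      by (auto simp: triangle_index_def)
  qed simp
  then obtain h where h: "bij_betw h J (triangle_index n m)"
    using finite_same_card_bij[OF J(1)] J(2) card_triangle_index by metis
  have hj: "(fst (h j), snd (h j)) \<in> triangle_index n m" if "j \<in> J" for j
    using h that by (auto simp: bij_betw_def)
  \<comment> \<open>Minimum and maximum list the two elements of the pair, which turns the vertices
    of the triangle into functions of \<open>j\<close>.\<close>
  have Q: "snd (h j) = {Min (snd (h j)), Max (snd (h j))} \<and> Min (snd (h j)) \<noteq> Max (snd (h j))" if j: "j \<in> J" for j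
  proof -
    obtain a b where ab: "snd (h j) = {a, b}" "a \<noteq> b"
      using triangle_indexD(7)[OF hj[OF j]] by (auto simp: card_2_iff)
    then show ?thesis by (cases "a \<le> b") (auto simp: min_def max_def)
  qed
  let ?T = "\<lambda>j. fst (h j)"
  have eq: "(index_triangle \<circ> h) j = {?T j - {Min (?T j)}, ?T j - {Min (snd (h j))}, ?T j - {Max (snd (h j))}}"
    if "j \<in> J" for j
  proof -
    have "index_triangle (h j) = (\<lambda>y. ?T j - {y}) ` insert (Min (?T j)) (snd (h j))"
      by (simp add: index_triangle_def case_prod_beta)
    also have "\<dots> = (\<lambda>y. ?T j - {y}) ` {Min (?T j), Min (snd (h j)), Max (snd (h j))}"
      using Q[OF that] by metis
    finally show ?thesis by simp
  qed
  show thesis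
  proof (rule that[of ?T "\<lambda>j. Min (?T j)" "\<lambda>j. Min (snd (h j))" "\<lambda>j. Max (snd (h j))"])
    show "bij_betw (\<lambda>j. {?T j - {Min (?T j)}, ?T j - {Min (snd (h j))}, ?T j - {Max (snd (h j))}}) J (down_triangles n m)"
      by (rule iffD1[OF bij_betw_cong[OF eq] bij_betw_trans[OF h bij_betw_index_triangle[OF m]]])
    fix j assume j: "j \<in> J"
    note D = triangle_indexD[OF hj[OF j]]
    have "Min (snd (h j)) \<in> snd (h j)" "Max (snd (h j)) \<in> snd (h j)" using Q[OF j] by (metis insertCI)+
    then show "finite (?T j) \<and> card (?T j) = Suc n \<and> ?T j \<subseteq> {1..m - 1} \<and>
      Min (?T j) \<in> ?T j \<and> Min (snd (h j)) \<in> ?T j \<and> Max (snd (h j)) \<in> ?T j \<and>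
      Min (?T j) \<noteq> Min (snd (h j)) \<and> Min (?T j) \<noteq> Max (snd (h j)) \<and> Min (snd (h j)) \<noteq> Max (snd (h j))"
      using D Q[OF j] by (metis subsetD)
  qed
qed

section \<open>Assembly and induction\<close>

lemma no_down_homotopy_equivalent:
  assumes n: "1 \<le> n" and m: "1 \<le> m"
  shows "realize (no_down n m) homotopy_equivalent_space VR_space (n - 1) (m - 1) 2"
proof -
  have "realize (no_free n m) homotopy_equivalent_space VR_space (n - 1) (m - 1) 2"
    unfolding VR_space_eq homotopy_equivalent_space_sym[of "realize (no_free n m)"]
    by (rule homeomorphic_imp_homotopy_equivalent_space[OF no_free_relabel[OF n m]])
  then show ?thesis
    by (rule homotopy_eqv_trans[OF homotopy_eqv_trans[OF no_down_collapse_to_one_free(2)[OF m]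
        one_free_collapse_to_no_free[OF n m]]])
qed

text \<open>\<open>X\<close> may be any model of the smaller complex. Taking that complex itself
  gives the explicit wedge formula; taking a wedge of spheres gives the induction step.\<close>

lemma VR_space_equivalent_attachment:
  assumes n: "1 \<le> n" and m: "1 \<le> m" and J: "finite J" "card J = ((m - 1) choose (n + 1)) * (n choose 2)"
    and X: "VR_space (n - 1) (m - 1) 2 homotopy_equivalent_space X" "path_connected_space X" "b \<in> topspace X"
    and att: "cone_attachment X (prod_topology (discrete_topology J) (nsphere 1)) fst (\<lambda>_. b) Y e c"
  shows "VR_space n m 2 homotopy_equivalent_space Y"
proof -
  let ?L = "no_down n m" and ?A = "prod_topology (discrete_topology J) (nsphere 1)"
  let ?K = "?L \<union> down_triangles n m"
  obtain T x0 x1 x2 where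
    bij: "bij_betw (\<lambda>j. {T j - {x0 j}, T j - {x1 j}, T j - {x2 j}}) J (down_triangles n m)"
    and T: "\<And>j. j \<in> J \<Longrightarrow> finite (T j) \<and> card (T j) = Suc n \<and> T j \<subseteq> {1..m - 1} \<and>
      x0 j \<in> T j \<and> x1 j \<in> T j \<and> x2 j \<in> T j \<and> x0 j \<noteq> x1 j \<and> x0 j \<noteq> x2 j \<and> x1 j \<noteq> x2 j"
    by (rule triangle_enumeration[OF m J], rule that)
  let ?c = "triangle_map (\<lambda>j. T j - {x0 j}) (\<lambda>j. T j - {x1 j}) (\<lambda>j. T j - {x2 j})"
  have "?K - ?L = down_triangles n m" by (auto simp: no_down_def down_triangles_def)
  with bij have bij': "bij_betw (\<lambda>j. {T j - {x0 j}, T j - {x1 j}, T j - {x2 j}}) J (?K - ?L)" by simp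
  have attK: "cone_attachment (realize ?L) ?A fst (\<lambda>a. ?c (a, 1)) (realize ?K) id ?c"
  proof (rule triangles_cone_attachment[OF johnson_collapse_to_triangles(1) finite_complex_no_down Un_upper1 J(1) bij'])
    show "T j - {x0 j} \<noteq> T j - {x1 j} \<and> T j - {x0 j} \<noteq> T j - {x2 j} \<and> T j - {x1 j} \<noteq> T j - {x2 j}"
      if "j \<in> J" for j
      using T[OF that] by blast
  qed
  obtain r i where r: "continuous_map (realize ?L) X r" and i: "continuous_map X (realize ?L) i"
    and ir: "homotopic_with (\<lambda>_. True) (realize ?L) (realize ?L) (i \<circ> r) id"
    and ri: "homotopic_with (\<lambda>_. True) X X (r \<circ> i) id"
    using homotopy_eqv_trans[OF no_down_homotopy_equivalent[OF n m] X(1)]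
    unfolding homotopy_equivalent_space_def by blast
  have hom: "homotopic_with (\<lambda>_. True) ?A X (r \<circ> (\<lambda>a. ?c (a, 1))) (\<lambda>_. b)"
  proof (rule homotopic_with_discrete_prod)
    fix j assume "j \<in> J"
    note Tj = T[OF this]
    let ?o = "\<lambda>x y. insert m (T j - {x, y})"
    let ?f = "\<lambda>s. ?c ((j, s), 1)" and ?p = "point_of [(?o (x1 j) (x2 j), 1)]"
    have oct: "{T j - {y}, T j - {z}, ?o y z} \<in> ?L" "{T j - {x}, ?o x z, ?o x y} \<in> ?L" "{?o y z, ?o x z, ?o x y} \<in> ?L"
      if "x \<in> T j" "y \<in> T j" "z \<in> T j" "x \<noteq> y" "x \<noteq> z" "y \<noteq> z" for x y z
      using octahedron_in_no_down[OF n m, of "T j" x y z] Tj that by auto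
    have sym: "?o x y = ?o y x" for x y by (simp add: insert_commute)
    have null: "homotopic_with (\<lambda>_. True) (nsphere 1) (realize ?L) ?f (\<lambda>_. ?p)"
      unfolding triangle_map_def prod.case
    proof (rule octahedron_boundary_nullhomotopic[OF finite_complex_no_down])
      show "{T j - {x1 j}, T j - {x2 j}, ?o (x1 j) (x2 j)} \<in> ?L" "{T j - {x0 j}, ?o (x0 j) (x2 j), ?o (x0 j) (x1 j)} \<in> ?L"
        "{?o (x1 j) (x2 j), ?o (x0 j) (x2 j), ?o (x0 j) (x1 j)} \<in> ?L"
        using oct[of "x0 j" "x1 j" "x2 j"] Tj by blast+
      show "{T j - {x0 j}, T j - {x2 j}, ?o (x0 j) (x2 j)} \<in> ?L" "{T j - {x1 j}, ?o (x1 j) (x2 j), ?o (x0 j) (x1 j)} \<in> ?L"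
        using oct[of "x1 j" "x0 j" "x2 j"] Tj by (simp_all add: sym[of "x1 j" "x0 j"])
      show "{T j - {x0 j}, T j - {x1 j}, ?o (x0 j) (x1 j)} \<in> ?L" "{T j - {x2 j}, ?o (x1 j) (x2 j), ?o (x0 j) (x2 j)} \<in> ?L"
        using oct[of "x2 j" "x0 j" "x1 j"] Tj by (simp_all add: sym[of "x2 j" "x0 j"] sym[of "x2 j" "x1 j"])
    qed
    have p: "continuous_map (nsphere 1) (realize ?L) (\<lambda>_. ?p)"
      using homotopic_with_imp_continuous_maps[OF null] by blast
    have "homotopic_with (\<lambda>_. True) (nsphere 1) X (r \<circ> ?f) (r \<circ> (\<lambda>_. ?p))"
      using null r by (rule homotopic_with_compose_continuous_map_left) simp
    \<comment> \<open>The null-homotopy ends at some point depending on \<open>j\<close>; a path in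
      \<open>X\<close> carries it to the common point \<open>b\<close>.\<close>
    moreover have "homotopic_with (\<lambda>_. True) (nsphere 1) X (r \<circ> (\<lambda>_. ?p)) (\<lambda>_. b)"
    proof -
      have "?p \<in> topspace (realize ?L)" using p by (simp only: continuous_map_const nonempty_nsphere) simp
      then have "r ?p \<in> topspace X" using continuous_map_image_subset_topspace[OF r] by blast
      then have "path_component_of X (r ?p) b"
        using X(2,3) path_connected_space_imp_path_component_of by metis
      then show ?thesis by (simp add: o_def homotopic_constant_maps)
    qed
    ultimately show "homotopic_with (\<lambda>_. True) (nsphere 1) X (\<lambda>s. (r \<circ> (\<lambda>a. ?c (a, 1))) (j, s)) (\<lambda>s. b)"
      using homotopic_with_trans by (fastforce simp: o_def)
  qed
  have "realize ?K homotopy_equivalent_space Y"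
    by (rule cone_attachment_homotopy_equivalent[OF attK att r i ir ri hom])
  then show ?thesis
    unfolding VR_space_eq by (rule homotopy_eqv_trans[OF johnson_collapse_to_triangles(2)])
qed

lemma homotopy_equivalent_path_connected:
  assumes "X homotopy_equivalent_space Y" "path_connected_space Y"
  shows "path_connected_space X"
proof -
  obtain f g h where f: "continuous_map X Y f" and g: "continuous_map Y X g"
    and h: "continuous_map (prod_topology I01 X) X h" "\<And>x. h (0, x) = g (f x)" "\<And>x. h (1, x) = x"
    using assms(1) unfolding homotopy_equivalent_space_def homotopic_with_def by auto
  have gf: "path_component_of X (g (f x)) x" if "x \<in> topspace X" for x
  proof -
    have "continuous_map I01 X (\<lambda>t. h (t, x))"
      using that by (intro continuous_map_comp[OF _ h(1)] continuous_map_pairedI) auto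
    then show ?thesis
      using h(2,3) unfolding path_component_of_def pathin_def by (intro exI[of _ "\<lambda>t. h (t, x)"]) simp
  qed
  have gY: "path_connectedin X (g ` topspace Y)"
    by (rule path_connectedin_continuous_map_image[OF g]) (simp add: assms(2) path_connectedin_topspace)
  show ?thesis
    unfolding path_connected_space_iff_path_component
  proof (intro ballI)
    fix x y assume xy: "x \<in> topspace X" "y \<in> topspace X"
    then have "f x \<in> topspace Y" "f y \<in> topspace Y" using continuous_map_image_subset_topspace[OF f] by auto
    then have "path_component_of X (g (f x)) (g (f y))"
      using gY unfolding path_component_of by blast
    then show "path_component_of X x y"
      using gf[OF xy(1)] gf[OF xy(2)] by (blast intro: path_component_of_trans path_component_of_sym)
  qed
qed

text \<open>Any two singletons are within distance 2, so the complex is a full simplex and contracts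
  linearly to a vertex; the empty wedge is a point.\<close>

lemma VR_space_singletons:
  assumes m: "1 \<le> m"
  shows "VR_space 1 m 2 homotopy_equivalent_space wedge_spheres ({} :: nat set) d"
proof -
  let ?K = "johnson_complex 1 m" and ?W = "wedge_spheres ({} :: nat set) d"
  have sub: "subsets_of_size 1 m \<in> ?K"
  proof -
    have "card (A - B) \<le> 1" if "A \<in> subsets_of_size 1 m" for A B
      using subsets_of_sizeD[OF that] card_mono[of A "A - B"] by simp
    moreover have "{1} \<in> subsets_of_size 1 m" using m by (simp add: subsets_of_size_def)
    ultimately show ?thesis by (auto simp: johnson_complex_def)
  qed
  define p :: "nat set \<Rightarrow> real" where "p = point_of [({1}, 1)]"
  have p: "p \<in> closed_simplex (subsets_of_size 1 m)"
    unfolding p_def using m finite_subsets_of_size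
    by (intro point_of_in_closed_simplex) (auto simp: subsets_of_size_def)
  then have pK: "p \<in> topspace (realize ?K)" using sub by auto
  have W: "topspace ?W = {None}" by (auto simp: topspace_wedge_spheres)
  have "homotopic_with (\<lambda>_. True) (realize ?K) (realize ?K) (\<lambda>_. p) id"
  proof (rule contiguous_imp_homotopic[OF finite_complex_johnson])
    fix q assume "q \<in> topspace (realize ?K)"
    then obtain F where "F \<in> ?K" "q \<in> closed_simplex F" by auto
    then have "q \<in> closed_simplex (subsets_of_size 1 m)"
      using closed_simplex_mono finite_subsets_of_size johnson_complexD(2) by metis
    then show "\<exists>F\<in>?K. p \<in> closed_simplex F \<and> id q \<in> closed_simplex F" using p sub by auto
  qed (use pK in simp_all)
  moreover have "homotopic_with (\<lambda>_. True) ?W ?W (\<lambda>_. None) id"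
    by (rule homotopic_with_equal) (auto simp: W)
  ultimately show ?thesis
    unfolding homotopy_equivalent_space_def VR_space_eq
    by (intro exI[of _ "\<lambda>_. None"] exI[of _ "\<lambda>_. p"]) (use pK W in \<open>simp add: o_def\<close>)
qed

text \<open>Path-connectedness is added for the induction step, which must move base points. The
  index set is required to be nonempty only from size 2 on, since for singletons the wedge is a
  point.\<close>

lemma VR_space_wedge_of_spheres:
  assumes "1 \<le> n" "n < m - 1"
  shows "\<exists>(I :: nat set) d. finite I \<and> (1 < n \<longrightarrow> I \<noteq> {}) \<and>
    path_connected_space (wedge_spheres I d) \<and> VR_space n m 2 homotopy_equivalent_space wedge_spheres I d"
  using assms
proof (induction n arbitrary: m rule: nat_induct_at_least)
  case base
  have "path_connected_space (wedge_spheres ({} :: nat set) d)" for d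
    by (intro contractible_imp_path_connected_space contractible_space_subset_singleton[of _ None])
       (auto simp: topspace_wedge_spheres)
  moreover have "1 \<le> m" using base by simp
  ultimately show ?case using VR_space_singletons[of m "\<lambda>_. 2"] by blast
next
  case (Suc n)
  have "n < m - 1 - 1" using Suc.prems by simp
  from Suc.IH[OF this] obtain I :: "nat set" and d where I: "finite I" and pc: "path_connected_space (wedge_spheres I d)"
    and eq: "VR_space n (m - 1) 2 homotopy_equivalent_space wedge_spheres I d"
    by blast
  define N where "N = ((m - 1) choose (Suc n + 1)) * (Suc n choose 2)"
  \<comment> \<open>Both binomials are positive: the set size is at least 2, and one more than it
    still fits into \<open>m - 1\<close>.\<close>
  have "N \<noteq> 0" using Suc.hyps Suc.prems by (simp add: N_def zero_less_binomial_iff)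
  \<comment> \<open>Fresh indices beyond all of \<open>I\<close>; inserting 0 makes the maximum
    meaningful for empty \<open>I\<close>.\<close>
  define J where "J = (\<lambda>i. Suc (Max (insert 0 I)) + i) ` {..<N}"
  have J: "finite J" "card J = N" by (auto simp: J_def card_image inj_on_def)
  have disj: "I \<inter> J = {}"
  proof -
    have "i \<le> Max (insert 0 I)" if "i \<in> I" for i using I that by simp
    then show ?thesis by (fastforce simp: J_def)
  qed
  note att = wedge_spheres_cone_attachment[OF I J(1) disj, of d]
  have "VR_space (Suc n) m 2 homotopy_equivalent_space wedge_spheres (I \<union> J) (\<lambda>i. if i \<in> J then 2 else d i)"
  proof (rule VR_space_equivalent_attachment[OF _ _ J(1) _ _ pc _ att])
    show "card J = ((m - 1) choose (Suc n + 1)) * (Suc n choose 2)" using J by (simp add: N_def)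
    show "VR_space (Suc n - 1) (m - 1) 2 homotopy_equivalent_space wedge_spheres I d" using eq by simp
  qed (use Suc.prems in \<open>auto simp: topspace_wedge_spheres\<close>)
  moreover have "path_connected_space (wedge_spheres (I \<union> J) (\<lambda>i. if i \<in> J then 2 else d i))"
    by (rule cone_attachment.path_connected_total[OF att pc])
  moreover have "I \<union> J \<noteq> {}" using J \<open>N \<noteq> 0\<close> by auto
  ultimately show ?case using I J(1) by blast
qed

theorem theorem10:
  fixes n m :: nat
  assumes "1 < n" and "n < m - 1"
  shows "(\<exists>(I :: nat set) (d :: nat \<Rightarrow> nat). finite I \<and> I \<noteq> {} \<and>
            VR_space n m 2 homotopy_equivalent_space wedge_spheres I d) \<and>
         (\<forall>b \<in> topspace (VR_space (n - 1) (m - 1) 2).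
            VR_space n m 2 homotopy_equivalent_space
              wedge (wedge_spheres {..<((m - 1) choose (n + 1)) * (n choose 2)} (\<lambda>_. 2)) None
                    (VR_space (n - 1) (m - 1) 2) b)"
proof (intro conjI ballI)
  show "\<exists>(I :: nat set) (d :: nat \<Rightarrow> nat). finite I \<and> I \<noteq> {} \<and>
      VR_space n m 2 homotopy_equivalent_space wedge_spheres I d"
    using VR_space_wedge_of_spheres[of n m] assms by auto
next
  fix b assume b: "b \<in> topspace (VR_space (n - 1) (m - 1) 2)"
  let ?X = "VR_space (n - 1) (m - 1) 2"
  have X: "compact_space ?X" "Hausdorff_space ?X"
    by (simp_all add: VR_space_eq compact_space_realization Hausdorff_space_realization finite_complex_johnson)
  have pc: "path_connected_space ?X"
  proof -
    \<comment> \<open>The sphere decomposition of the smaller complex is used here only for its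
      path-connectedness.\<close>
    have "1 \<le> n - 1" "n - 1 < m - 1 - 1" using assms by simp_all
    from VR_space_wedge_of_spheres[OF this] show ?thesis
      using homotopy_equivalent_path_connected by blast
  qed
  show "VR_space n m 2 homotopy_equivalent_space
      wedge (wedge_spheres {..<((m - 1) choose (n + 1)) * (n choose 2)} (\<lambda>_. 2)) None ?X b"
    by (rule VR_space_equivalent_attachment[OF _ _ finite_lessThan card_lessThan
          homotopy_equivalent_space_refl pc b wedge_cone_attachment[OF X b finite_lessThan]])
       (use assms in auto)
qed

end
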